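(* Let $E$ be a graded division algebra with center $T$, of index $n$, with a unitary graded involution $\tau$, and let $R=T^\tau$. Suppose $E$ is totally ramified over $T$ and $T$ is unramified over $R$. Let $e$ be the exponent of the finite abelian group $\Gamma_E/\Gamma_T$. Then $$\operatorname{SK}_1(E,\tau)\ \cong\ \{a\in T_0^*\mid a^n\in R_0^*\}\big/\{a\in T_0^*\mid a^e\in R_0^*\}\ \cong\ \{\omega\in\mu_n(T_0)\mid\tau(\omega)=\omega^{-1}\}\big/\mu_e .$$ In particular: (i) The restriction of the map $K_1(E,\tau)\to K_1(E)$ given by $a\,\Sigma_\tau(E)\mapsto a^{1-\tau}E'$ induces an injective map $$\alpha\colon \operatorname{SK}_1(E,\tau)\longrightarrow \operatorname{SK}_1(E)\ \cong\ \mu_n(T_0)/\mu_e .$$ (ii) If the exponent $e$ is odd, then $\alpha$ is an isomorphism. (iii) If $e>2$, then $T_0=R_0(\mu_e)$, and $\tau$ acts on $\mu_e$ by $\omega\mapsto\omega^{-1}$.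
   Context: A graded division ring is a ring $E=\bigoplus_{\gamma\in\Gamma}E_\gamma$ graded by a torsion-free abelian group $\Gamma$ in which every nonzero homogeneous element is invertible; $\Gamma_E=\{\gamma\mid E_\gamma\ne0\}$ (a group), $E_0$ is a division ring, and the unit group $E^*$ is the set of nonzero homogeneous elements. A graded field is a commutative graded division ring. $E$ is assumed finite-dimensional over its center $T=Z(E)$, a graded field; $\operatorname{ind}(E)^2=[E:T]$. $E$ is totally ramified over $T$ if $E_0=T_0$. $\operatorname{Nrd}_E\colon E^*\to T^*$ is the restriction of the reduced norm of the quotient division ring $q(E)=E\otimes_Tq(T)$, $q(T)$ the quotient field of $T$. A graded involution $\tau$ is an antiautomorphism of $E$ with $\tau^2=\mathrm{id}$ and $\tau(E_\gamma)=E_\gamma$ for all $\gamma$; it is unitary if $\tau|_T\ne\mathrm{id}$. Then $R=T^\tau=\{t\in T\mid\tau(t)=t\}$ is a graded subfield with $[T:R]=2=[T_0:R_0]\,|\Gamma_T:\Gamma_R|$; "$T$ unramified over $R$" means $\Gamma_T=\Gamma_R$. Notation: $a^{1-\tau}=a\,\tau(a)^{-1}$; $E'=[E^*,E^*]$; $K_1(E)=E^*/E'$; $\operatorname{SK}_1(E)=\{a\in E^*\mid\operatorname{Nrd}_E(a)=1\}/E'$; $\Sigma_\tau(E)=\langle a\in E^*\mid\tau(a)=a\rangle$ (it contains $E'$); $\Sigma'_\tau(E)=\{a\in E^*\mid\operatorname{Nrd}_E(a)\in R^*\}$; $K_1(E,\tau)=E^*/\Sigma_\tau(E)$; $\operatorname{SK}_1(E,\tau)=\Sigma'_\tau(E)/\Sigma_\tau(E)$.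 For a field $k$, $\mu_n$ is the group of $n$-th roots of unity in an algebraic closure of $k$ and $\mu_n(k)=\mu_n\cap k^*$; here $\mu_e$ is taken for the field $T_0$, and $T_0$ contains all $e$-th roots of unity. *)

theory Defs
  imports
    "HOL-Algebra.Algebraic_Closure_Type"
    "HOL-Algebra.Generated_Groups"
    "HOL-Algebra.Generated_Fields"
    "HOL-Computational_Algebra.Fraction_Field"
    "HOL-Computational_Algebra.Polynomial_Factorial"
    "Jordan_Normal_Form.Determinant"
begin

section \<open>Graded division rings\<close>

text \<open>
  The ring is a type; its grading is a family of additive subgroups indexed by an abelian group,
  which is written multiplicatively as usual in HOL-Algebra. Only the components with index in the
  carrier matter. The zero ring is excluded by the sort \<open>ring_1\<close>.
\<close>

locale graded_division_ring =
  fixes \<Gamma> :: "('g, 'h) monoid_scheme" (structure)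
    and E :: "'g \<Rightarrow> 'a::ring_1 set"
  assumes grading_group: "comm_group \<Gamma>"
    and torsion_free:
      "\<lbrakk>\<gamma> \<in> carrier \<Gamma>; 0 < (k::nat); \<gamma> [^]\<^bsub>\<Gamma>\<^esub> k = \<one>\<^bsub>\<Gamma>\<^esub>\<rbrakk> \<Longrightarrow> \<gamma> = \<one>\<^bsub>\<Gamma>\<^esub>"
    and component_zero: "\<gamma> \<in> carrier \<Gamma> \<Longrightarrow> 0 \<in> E \<gamma>"
    and component_add: "\<lbrakk>\<gamma> \<in> carrier \<Gamma>; x \<in> E \<gamma>; y \<in> E \<gamma>\<rbrakk> \<Longrightarrow> x + y \<in> E \<gamma>"
    and component_minus: "\<lbrakk>\<gamma> \<in> carrier \<Gamma>; x \<in> E \<gamma>\<rbrakk> \<Longrightarrow> - x \<in> E \<gamma>"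
    and component_mult:
      "\<lbrakk>\<gamma> \<in> carrier \<Gamma>; \<delta> \<in> carrier \<Gamma>; x \<in> E \<gamma>; y \<in> E \<delta>\<rbrakk> \<Longrightarrow> x * y \<in> E (\<gamma> \<otimes>\<^bsub>\<Gamma>\<^esub> \<delta>)"
    and direct_sum:
      "\<exists>!f. (\<forall>\<gamma>\<in>carrier \<Gamma>. f \<gamma> \<in> E \<gamma>) \<and> (\<forall>\<gamma>. \<gamma> \<notin> carrier \<Gamma> \<longrightarrow> f \<gamma> = 0)
          \<and> finite {\<gamma>. f \<gamma> \<noteq> 0} \<and> x = (\<Sum>\<gamma> | f \<gamma> \<noteq> 0. f \<gamma>)"
    and homogeneous_invertible:
      "\<lbrakk>\<gamma> \<in> carrier \<Gamma>; x \<in> E \<gamma>; x \<noteq> 0\<rbrakk> \<Longrightarrow> \<exists>y. x * y = 1 \<and> y * x = 1"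

text \<open>
  The index set of the nonzero components of a family; this is \<open>\<Gamma>\<^sub>E\<close>, \<open>\<Gamma>\<^sub>T\<close>, \<open>\<Gamma>\<^sub>R\<close> for the
  respective families.
\<close>

definition degrees :: "('g, 'h) monoid_scheme \<Rightarrow> ('g \<Rightarrow> 'a::zero set) \<Rightarrow> 'g set" where
  "degrees \<Gamma> F = {\<gamma> \<in> carrier \<Gamma>. F \<gamma> \<noteq> {0}}"

definition homogeneous :: "('g, 'h) monoid_scheme \<Rightarrow> ('g \<Rightarrow> 'a set) \<Rightarrow> 'a set" where
  "homogeneous \<Gamma> F = (\<Union>\<gamma>\<in>carrier \<Gamma>. F \<gamma>)"

definition unit_group :: "('g, 'h) monoid_scheme \<Rightarrow> ('g \<Rightarrow> 'a::ring_1 set) \<Rightarrow> 'a monoid" where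
  "unit_group \<Gamma> F = \<lparr>carrier = homogeneous \<Gamma> F - {0}, monoid.mult = (*), one = 1\<rparr>"

subsection \<open>Such rings have no zero divisors\<close>

text \<open>
  Everything below is stated for a ring type of sort \<open>ring_1_no_zero_divisors\<close>, because the quotient
  field of the center has to be a type. The lemma \<open>graded_division_ring.no_zero_divisors\<close> at
  the end of this subsection shows that this excludes no graded division ring: a torsion-free
  abelian group can be totally ordered, and then one compares leading terms.
\<close>

definition positive_cone :: "('g, 'h) monoid_scheme \<Rightarrow> 'g set \<Rightarrow> bool" where
  "positive_cone G P \<longleftrightarrow> P \<subseteq> carrier G \<and> \<one>\<^bsub>G\<^esub> \<in> P \<and> (\<forall>x\<in>P. \<forall>y\<in>P. x \<otimes>\<^bsub>G\<^esub> y \<in> P)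
     \<and> (\<forall>x\<in>P. inv\<^bsub>G\<^esub> x \<in> P \<longrightarrow> x = \<one>\<^bsub>G\<^esub>)"

lemma (in comm_group) positive_cone_pow:
  assumes "positive_cone G P" "x \<in> P"
  shows "x [^] (k::nat) \<in> P"
proof (induction k)
  case 0
  then show ?case using assms by (simp add: positive_cone_def)
next
  case (Suc k)
  then show ?case using assms by (simp add: positive_cone_def)
qed

lemma (in comm_group) positive_cone_extend:
  assumes P: "positive_cone G P" and x: "x \<in> carrier G"
    and no_power: "\<And>m::nat. m > 0 \<Longrightarrow> inv (x [^] m) \<notin> P"
  shows "positive_cone G {p \<otimes> x [^] (k::nat) |p k. p \<in> P}" (is "positive_cone G ?Q")
proof -
  have PG: "P \<subseteq> carrier G" and P1: "\<one> \<in> P"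
    and Pm: "\<And>x y. x \<in> P \<Longrightarrow> y \<in> P \<Longrightarrow> x \<otimes> y \<in> P"
    and Pi: "\<And>x. x \<in> P \<Longrightarrow> inv x \<in> P \<Longrightarrow> x = \<one>"
    using P by (auto simp: positive_cone_def)
  have "?Q \<subseteq> carrier G" using PG x by auto
  moreover have "\<one> \<in> ?Q"
    using P1 by (auto intro!: exI[of _ \<one>] exI[of _ "0::nat"])
  moreover have "u \<otimes> v \<in> ?Q" if uv: "u \<in> ?Q" "v \<in> ?Q" for u v
  proof -
    obtain p k q l where *: "u = p \<otimes> x [^] (k::nat)" "v = q \<otimes> x [^] (l::nat)" "p \<in> P" "q \<in> P"
      using uv by blast
    have "u \<otimes> v = (p \<otimes> q) \<otimes> x [^] (k + l)"
      using * PG x by (simp add: nat_pow_mult[symmetric] subset_iff m_ac)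
    then show ?thesis using Pm * by blast
  qed
  moreover have "u = \<one>" if u: "u \<in> ?Q" "inv u \<in> ?Q" for u
  proof -
    obtain p k q l where *: "u = p \<otimes> x [^] (k::nat)" "inv u = q \<otimes> x [^] (l::nat)" "p \<in> P" "q \<in> P"
      using u by blast
    have pq: "p \<in> carrier G" "q \<in> carrier G" using * PG by auto
    have "(p \<otimes> q) \<otimes> x [^] (k + l) = u \<otimes> inv u"
      using *(1,2) pq x by (simp add: nat_pow_mult[symmetric] m_ac)
    also have "\<dots> = \<one>" using *(1) pq x by simp
    finally have eq: "(p \<otimes> q) \<otimes> x [^] (k + l) = \<one>" .
    show ?thesis
    proof (cases "k + l = 0")
      case True
      then have "p \<otimes> q = \<one>" using eq pq by simp
      then have "inv p = q" using pq by (metis inv_equality m_comm)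
      then have "p = \<one>" using Pi * by metis
      then show ?thesis using True * by simp
    next
      case False
      have "inv (x [^] (k + l)) = p \<otimes> q"
        using eq pq x by (metis inv_equality m_closed nat_pow_closed)
      then show ?thesis using no_power[of "k + l"] False Pm * by simp
    qed
  qed
  ultimately show ?thesis unfolding positive_cone_def by blast
qed

lemma (in comm_group) total_positive_cone:
  assumes tf: "\<And>x (k::nat). \<lbrakk>x \<in> carrier G; 0 < k; x [^] k = \<one>\<rbrakk> \<Longrightarrow> x = \<one>"
  obtains P where "positive_cone G P" "\<And>x. x \<in> carrier G \<Longrightarrow> x \<in> P \<or> inv x \<in> P"
proof -
  have base: "positive_cone G {\<one>}" by (auto simp: positive_cone_def)
  have chain: "positive_cone G (\<Union>C)" if C: "C \<noteq> {}" "subset.chain (Collect (positive_cone G)) C" for C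
  proof -
    have cone: "positive_cone G P" if "P \<in> C" for P
      using C(2) that by (auto simp: subset_chain_def)
    have mult: "x \<otimes> y \<in> \<Union>C" and inv: "inv x \<in> \<Union>C \<Longrightarrow> x = \<one>" if "x \<in> \<Union>C" "y \<in> \<Union>C" for x y
    proof -
      have common: "\<exists>P\<in>C. u \<in> P \<and> v \<in> P" if uv: "u \<in> \<Union>C" "v \<in> \<Union>C" for u v
      proof -
        obtain U V where "U \<in> C" "V \<in> C" "u \<in> U" "v \<in> V" using uv by blast
        moreover have "U \<subseteq> V \<or> V \<subseteq> U"
          using C(2) \<open>U \<in> C\<close> \<open>V \<in> C\<close> by (auto simp: subset_chain_def)
        ultimately show ?thesis by blast
      qed
      obtain Q where "Q \<in> C" "x \<in> Q" "y \<in> Q" using common \<open>x \<in> \<Union>C\<close> \<open>y \<in> \<Union>C\<close> by meson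
      moreover from this cone[of Q] have "x \<otimes> y \<in> Q" unfolding positive_cone_def by blast
      ultimately show "x \<otimes> y \<in> \<Union>C" by blast
      show "x = \<one>" if inv: "inv x \<in> \<Union>C"
      proof -
        obtain Q where "Q \<in> C" "x \<in> Q" "inv x \<in> Q" using common \<open>x \<in> \<Union>C\<close> inv by meson
        with cone[of Q] show ?thesis unfolding positive_cone_def by blast
      qed
    qed
    have "\<Union>C \<subseteq> carrier G" "\<one> \<in> \<Union>C"
      using cone C(1) unfolding positive_cone_def by blast+
    with mult inv show ?thesis unfolding positive_cone_def by blast
  qed
  have "\<exists>M\<in>Collect (positive_cone G). \<forall>N\<in>Collect (positive_cone G). M \<subseteq> N \<longrightarrow> N = M"
    by (rule subset_Zorn_nonempty) (use base chain in auto)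
  then obtain M where M: "positive_cone G M"
    and max: "\<And>N. positive_cone G N \<Longrightarrow> M \<subseteq> N \<Longrightarrow> N = M" by auto
  have MG: "M \<subseteq> carrier G" and M1: "\<one> \<in> M" using M by (auto simp: positive_cone_def)
  have step: "x \<in> M \<or> (\<exists>m::nat. m > 0 \<and> inv (x [^] m) \<in> M)" if x: "x \<in> carrier G" for x
  proof (rule ccontr)
    assume neg: "\<not> ?thesis"
    let ?Q = "{p \<otimes> x [^] (k::nat) |p k. p \<in> M}"
    have "positive_cone G ?Q" using positive_cone_extend[OF M x] neg by blast
    moreover have "p \<in> ?Q" if "p \<in> M" for p
    proof -
      have "p = p \<otimes> x [^] (0::nat)" using that MG by auto
      then show ?thesis using that by blast
    qed
    ultimately have "?Q = M" using max by blast
    moreover have "x \<in> ?Q"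
    proof -
      have "x = \<one> \<otimes> x [^] (1::nat)" using x by simp
      then show ?thesis using M1 by blast
    qed
    ultimately show False using neg by blast
  qed
  have "x \<in> M \<or> inv x \<in> M" if x: "x \<in> carrier G" for x
  proof (rule ccontr)
    assume neg: "\<not> ?thesis"
    obtain m :: nat where m: "m > 0" "inv (x [^] m) \<in> M" using step[OF x] neg by blast
    obtain l :: nat where l: "l > 0" "inv (inv x [^] l) \<in> M"
      using step[of "inv x"] neg x by blast
    have "x [^] l \<in> M" using l(2) x by (simp add: nat_pow_inv)
    then have 1: "x [^] (l * m) \<in> M"
      using positive_cone_pow[OF M] x by (metis nat_pow_pow)
    have "inv (x [^] m) [^] l \<in> M" using m(2) positive_cone_pow[OF M] by blast
    then have "inv (x [^] (l * m)) \<in> M"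
      using x by (simp add: nat_pow_inv nat_pow_pow mult.commute)
    with 1 M have "x [^] (l * m) = \<one>" by (auto simp: positive_cone_def)
    then have "x = \<one>" using tf[OF x, of "l * m"] l m by simp
    then show False using neg M1 by simp
  qed
  with M that show thesis by blast
qed

lemma (in comm_group) positive_cone_max:
  assumes P: "positive_cone G P" "\<And>x. x \<in> carrier G \<Longrightarrow> x \<in> P \<or> inv x \<in> P"
    and S: "finite S" "S \<noteq> {}" "S \<subseteq> carrier G"
  shows "\<exists>\<mu>\<in>S. \<forall>\<alpha>\<in>S. \<mu> \<otimes> inv \<alpha> \<in> P"
  using S
proof (induction S rule: finite_ne_induct)
  case (singleton x)
  then show ?case using P(1) by (auto simp: positive_cone_def)
next
  case (insert x F)
  then obtain \<mu> where \<mu>: "\<mu> \<in> F" "\<forall>\<alpha>\<in>F. \<mu> \<otimes> inv \<alpha> \<in> P" by auto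
  have xc: "x \<in> carrier G" and mc: "\<mu> \<in> carrier G" and Fc: "F \<subseteq> carrier G"
    using insert \<mu> by auto
  have P1: "\<one> \<in> P" using P(1) by (auto simp: positive_cone_def)
  show ?case
  proof (cases "\<mu> \<otimes> inv x \<in> P")
    case True
    then show ?thesis using \<mu> by auto
  next
    case False
    then have "inv (\<mu> \<otimes> inv x) \<in> P" using P(2)[of "\<mu> \<otimes> inv x"] xc mc by auto
    then have xm: "x \<otimes> inv \<mu> \<in> P" using xc mc by (simp add: inv_mult_group)
    have "x \<otimes> inv \<alpha> \<in> P" if "\<alpha> \<in> F" for \<alpha>
    proof -
      have ac: "\<alpha> \<in> carrier G" using that Fc by auto
      have "inv \<mu> \<otimes> (\<mu> \<otimes> inv \<alpha>) = inv \<alpha>"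
        using mc ac by (simp add: m_assoc[symmetric])
      then have "(x \<otimes> inv \<mu>) \<otimes> (\<mu> \<otimes> inv \<alpha>) = x \<otimes> inv \<alpha>"
        using xc mc ac by (simp add: m_assoc)
      then show ?thesis using xm \<mu>(2) that P(1) unfolding positive_cone_def by metis
    qed
    then show ?thesis using xc P1 by auto
  qed
qed

lemma ex1_equality: "\<exists>!x. P x \<Longrightarrow> P a \<Longrightarrow> P b \<Longrightarrow> a = b"
  by blast

lemma (in graded_division_ring) no_zero_divisors:
  fixes x y :: 'a
  assumes "x \<noteq> 0" "y \<noteq> 0"
  shows "x * y \<noteq> 0"
proof
  assume xy: "x * y = 0"
  interpret \<Gamma>: comm_group \<Gamma> by (rule grading_group)
  let ?D = "\<lambda>x f. (\<forall>\<gamma>\<in>carrier \<Gamma>. f \<gamma> \<in> E \<gamma>) \<and> (\<forall>\<gamma>. \<gamma> \<notin> carrier \<Gamma> \<longrightarrow> f \<gamma> = 0)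
          \<and> finite {\<gamma>. f \<gamma> \<noteq> 0} \<and> x = (\<Sum>\<gamma> | f \<gamma> \<noteq> 0. f \<gamma>)"
  obtain P where P: "positive_cone \<Gamma> P" "\<And>x. x \<in> carrier \<Gamma> \<Longrightarrow> x \<in> P \<or> inv x \<in> P"
    using \<Gamma>.total_positive_cone torsion_free by metis
  obtain f where f: "?D x f" using direct_sum[of x] by blast
  obtain g where g: "?D y g" using direct_sum[of y] by blast
  define A where "A = {\<gamma>. f \<gamma> \<noteq> 0}"
  define B where "B = {\<gamma>. g \<gamma> \<noteq> 0}"
  have A: "finite A" "A \<subseteq> carrier \<Gamma>" and B: "finite B" "B \<subseteq> carrier \<Gamma>"
    using f g by (auto simp: A_def B_def)
  have "A \<noteq> {}" "B \<noteq> {}"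
    using f g assms unfolding A_def B_def by (metis sum.empty)+
  obtain \<mu> where \<mu>: "\<mu> \<in> A" "\<forall>\<alpha>\<in>A. \<mu> \<otimes> inv \<alpha> \<in> P"
    using \<Gamma>.positive_cone_max[OF P A(1) \<open>A \<noteq> {}\<close> A(2)] by blast
  obtain \<nu> where \<nu>: "\<nu> \<in> B" "\<forall>\<beta>\<in>B. \<nu> \<otimes> inv \<beta> \<in> P"
    using \<Gamma>.positive_cone_max[OF P B(1) \<open>B \<noteq> {}\<close> B(2)] by blast
  have mc: "\<mu> \<in> carrier \<Gamma>" and nc: "\<nu> \<in> carrier \<Gamma>" using \<mu> \<nu> A B by auto
  define h where "h \<epsilon> = (\<Sum>p\<in>{p\<in>A\<times>B. fst p \<otimes> snd p = \<epsilon>}. f (fst p) * g (snd p))" for \<epsilon>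
  let ?S = "(\<lambda>p. fst p \<otimes> snd p) ` (A \<times> B)"
  have finS: "finite ?S" using A B by simp
  have hsub: "{\<epsilon>. h \<epsilon> \<noteq> 0} \<subseteq> ?S"
  proof
    fix \<epsilon> assume "\<epsilon> \<in> {\<epsilon>. h \<epsilon> \<noteq> 0}"
    then have "{p\<in>A\<times>B. fst p \<otimes> snd p = \<epsilon>} \<noteq> {}" unfolding h_def by (metis (mono_tags) mem_Collect_eq sum.empty)
    then show "\<epsilon> \<in> ?S" by blast
  qed
  have "x * y = (\<Sum>\<alpha>\<in>A. f \<alpha>) * (\<Sum>\<beta>\<in>B. g \<beta>)" using f g by (simp add: A_def B_def)
  also have "\<dots> = (\<Sum>p\<in>A\<times>B. f (fst p) * g (snd p))"
    by (simp add: sum_product sum.cartesian_product case_prod_unfold)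
  also have "\<dots> = (\<Sum>\<epsilon>\<in>?S. h \<epsilon>)"
    unfolding h_def using A B by (subst sum.group[OF _ finS]) auto
  also have "\<dots> = (\<Sum>\<epsilon> | h \<epsilon> \<noteq> 0. h \<epsilon>)"
    using finS hsub by (intro sum.mono_neutral_right) auto
  finally have sum: "0 = (\<Sum>\<epsilon> | h \<epsilon> \<noteq> 0. h \<epsilon>)" using xy by simp
  have comp_sum: "(\<Sum>i\<in>I. u i) \<in> E \<gamma>" if "\<gamma> \<in> carrier \<Gamma>" "\<And>i. i \<in> I \<Longrightarrow> u i \<in> E \<gamma>"
    for \<gamma> and I :: "('g \<times> 'g) set" and u
    using that by (induction I rule: infinite_finite_induct) (auto intro: component_zero component_add)
  have "h \<epsilon> \<in> E \<epsilon>" if "\<epsilon> \<in> carrier \<Gamma>" for \<epsilon>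
    unfolding h_def
  proof (rule comp_sum[OF that])
    fix p assume p: "p \<in> {p\<in>A\<times>B. fst p \<otimes> snd p = \<epsilon>}"
    then have "fst p \<in> carrier \<Gamma>" "snd p \<in> carrier \<Gamma>" using A B by auto
    then show "f (fst p) * g (snd p) \<in> E \<epsilon>"
      using component_mult[of "fst p" "snd p"] f g p by auto
  qed
  moreover have "h \<epsilon> = 0" if "\<epsilon> \<notin> carrier \<Gamma>" for \<epsilon>
  proof -
    have "\<epsilon> \<notin> ?S" using that A(2) B(2) by (auto simp: subset_iff)
    then show ?thesis using hsub by blast
  qed
  moreover have "finite {\<epsilon>. h \<epsilon> \<noteq> 0}" using finS hsub finite_subset by blast
  ultimately have "?D 0 h" using sum by blast
  moreover have "?D 0 (\<lambda>_. 0)" by (auto simp: component_zero)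
  ultimately have "h = (\<lambda>_. 0)" by (rule ex1_equality[OF direct_sum[of 0]])
  moreover have "{p\<in>A\<times>B. fst p \<otimes> snd p = \<mu> \<otimes> \<nu>} = {(\<mu>, \<nu>)}"
  proof (intro equalityI subsetI)
    fix p assume p: "p \<in> {p\<in>A\<times>B. fst p \<otimes> snd p = \<mu> \<otimes> \<nu>}"
    obtain \<alpha> \<beta> where ab: "p = (\<alpha>, \<beta>)" by (cases p)
    have a: "\<alpha> \<in> A" "\<beta> \<in> B" "\<alpha> \<otimes> \<beta> = \<mu> \<otimes> \<nu>" using p ab by auto
    have ac: "\<alpha> \<in> carrier \<Gamma>" and bc: "\<beta> \<in> carrier \<Gamma>" using a A B by auto
    have swap: "a \<otimes> b \<otimes> c \<otimes> d = (b \<otimes> c) \<otimes> (a \<otimes> d)"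
      if "a \<in> carrier \<Gamma>" "b \<in> carrier \<Gamma>" "c \<in> carrier \<Gamma>" "d \<in> carrier \<Gamma>" for a b c d
      using that by (simp add: \<Gamma>.m_ac)
    have "inv (\<mu> \<otimes> inv \<alpha>) = \<alpha> \<otimes> inv \<mu>"
      using mc ac by (simp add: \<Gamma>.inv_mult_group)
    also have "\<dots> = (\<mu> \<otimes> \<nu>) \<otimes> inv \<beta> \<otimes> inv \<mu>"
      unfolding a(3)[symmetric] using ac bc by (simp add: \<Gamma>.m_assoc)
    also have "\<dots> = (\<nu> \<otimes> inv \<beta>) \<otimes> (\<mu> \<otimes> inv \<mu>)"
      by (rule swap) (use mc nc bc in simp_all)
    also have "\<dots> = \<nu> \<otimes> inv \<beta>" using mc nc bc by simp
    finally have "inv (\<mu> \<otimes> inv \<alpha>) \<in> P" using \<nu>(2) a by simp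
    then have "\<mu> \<otimes> inv \<alpha> = \<one>" using P(1) \<mu>(2) a by (auto simp: positive_cone_def)
    then have "\<alpha> = \<mu>" using mc ac by (metis \<Gamma>.inv_equality \<Gamma>.inv_inv \<Gamma>.inv_closed)
    then have "\<beta> = \<nu>" using a(3) mc nc bc by simp
    with \<open>\<alpha> = \<mu>\<close> ab show "p \<in> {(\<mu>, \<nu>)}" by simp
  qed (use \<mu> \<nu> in auto)
  moreover have "h (\<mu> \<otimes> \<nu>) = f \<mu> * g \<nu>"
    unfolding h_def calculation(2) by simp
  ultimately have "f \<mu> * g \<nu> = 0" by simp
  moreover have "f \<mu> \<noteq> 0" "f \<mu> \<in> E \<mu>" "g \<nu> \<noteq> 0" using \<mu> \<nu> f mc by (auto simp: A_def B_def)
  moreover obtain z where "z * f \<mu> = 1"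
    using homogeneous_invertible[OF mc, of "f \<mu>"] calculation by blast
  ultimately show False by (metis mult.assoc mult_1_left mult_zero_right)
qed

section \<open>Center and quotient division ring\<close>

typedef (overloaded) 'a center = "{z::'a::ring_1. \<forall>x. z * x = x * z}"
  morphisms of_center to_center
  by (rule exI[of _ 1]) simp

setup_lifting type_definition_center

lemma central_mult:
  fixes a b x :: "'a::ring_1"
  assumes a: "\<And>x. a * x = x * a" and b: "\<And>x. b * x = x * b"
  shows "a * b * x = x * (a * b)"
proof -
  have "a * b * x = a * (b * x)" by (rule mult.assoc)
  also have "\<dots> = (a * x) * b" by (simp only: b[of x] mult.assoc)
  also have "\<dots> = x * (a * b)" by (simp only: a[of x] mult.assoc)
  finally show ?thesis .
qed

instantiation center :: (ring_1) comm_ring_1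
begin

lift_definition zero_center :: "'a center" is 0 by simp
lift_definition one_center :: "'a center" is 1 by simp
lift_definition plus_center :: "'a center \<Rightarrow> 'a center \<Rightarrow> 'a center" is "(+)"
  by (simp only: distrib_left distrib_right mem_Collect_eq)
lift_definition minus_center :: "'a center \<Rightarrow> 'a center \<Rightarrow> 'a center" is "(-)"
  by (simp only: left_diff_distrib right_diff_distrib mem_Collect_eq)
lift_definition uminus_center :: "'a center \<Rightarrow> 'a center" is uminus
  by simp
lift_definition times_center :: "'a center \<Rightarrow> 'a center \<Rightarrow> 'a center" is "(*)"
  by (blast intro: central_mult)

instance
proof
  fix a b c :: "'a center"
  show "a + b + c = a + (b + c)" by transfer (rule add.assoc)
  show "a + b = b + a" by transfer (rule add.commute)
  show "0 + a = a" by transfer (rule add_0_left)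
  show "- a + a = 0" by transfer (rule left_minus)
  show "a - b = a + - b" by transfer (rule diff_conv_add_uminus)
  show "a * b * c = a * (b * c)" by transfer (rule mult.assoc)
  show "a * b = b * a" by transfer blast
  show "1 * a = a" by transfer (rule mult_1_left)
  show "(a + b) * c = a * c + b * c" by transfer (rule distrib_right)
  show "(0 :: 'a center) \<noteq> 1" by transfer (rule zero_neq_one)
qed

end

instance center :: (ring_1_no_zero_divisors) idom
proof
  fix a b :: "'a center"
  show "a \<noteq> 0 \<Longrightarrow> b \<noteq> 0 \<Longrightarrow> a * b \<noteq> 0" by transfer (rule no_zero_divisors)
qed

lemma of_center_commute: "of_center z * x = x * of_center z"
  by transfer blast

lemma of_center_simps [simp]:
  "of_center 0 = 0" "of_center 1 = 1" "of_center (s + t) = of_center s + of_center t"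
  "of_center (- s) = - of_center s" "of_center (s * t) = of_center s * of_center t"
  by (simp_all add: zero_center.rep_eq one_center.rep_eq plus_center.rep_eq uminus_center.rep_eq
      times_center.rep_eq)

lemma of_center_eq_0_iff [simp]: "of_center z = 0 \<longleftrightarrow> z = 0"
  by transfer (rule refl)

lifting_forget center.lifting

definition center_scale :: "'a center \<Rightarrow> 'a \<Rightarrow> 'a::ring_1" where
  "center_scale t x = of_center t * x"

global_interpretation center: Modules.module center_scale
  by standard (simp_all add: center_scale_def distrib_left distrib_right mult.assoc)

lemma center_scale_scale: "of_center s * (of_center t * x) = of_center (s * t) * x"
  by (simp add: mult.assoc)

lemma center_left_commute: "x * (of_center s * y) = of_center s * (x * y)"
  by (metis mult.assoc of_center_commute)

lemma center_scale_mult: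
  "of_center (s * t) * (x * y) = (of_center s * x) * (of_center t * y)"
proof -
  have "(of_center s * x) * (of_center t * y) = of_center s * (x * of_center t) * y"
    by (simp only: mult.assoc)
  also have "x * of_center t = of_center t * x" by (rule of_center_commute[symmetric])
  finally show ?thesis by (simp add: mult.assoc)
qed

text \<open>
  \<open>q(E) = E \<otimes>\<^sub>T q(T)\<close> is realised as the ring of fractions \<open>a / s\<close> with \<open>a\<close> in the ring and \<open>s \<noteq> 0\<close>
  in its center. The field \<open>q(T)\<close> is \<open>'a center fract\<close>.
\<close>

definition fractions_rel :: "'a::ring_1_no_zero_divisors \<times> 'a center \<Rightarrow> 'a \<times> 'a center \<Rightarrow> bool" where
  "fractions_rel x y \<longleftrightarrow>
     snd x \<noteq> 0 \<and> snd y \<noteq> 0 \<and> fst x * of_center (snd y) = fst y * of_center (snd x)"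

lemma part_equivp_fractions_rel: "part_equivp fractions_rel"
proof (rule part_equivpI)
  show "\<exists>x::'a \<times> 'a center. fractions_rel x x"
    by (rule exI[of _ "(0, 1)"]) (simp add: fractions_rel_def)
  show "symp (fractions_rel :: 'a \<times> 'a center \<Rightarrow> _)"
    by (auto simp: symp_def fractions_rel_def)
  show "transp (fractions_rel :: 'a \<times> 'a center \<Rightarrow> _)"
  proof (rule transpI)
    fix x y z :: "'a \<times> 'a center"
    assume xy: "fractions_rel x y" and yz: "fractions_rel y z"
    let ?s = "\<lambda>p :: 'a \<times> 'a center. of_center (snd p)"
    have swap: "a * of_center s * of_center t = a * of_center t * of_center s" for a :: 'a and s t
      by (metis mult.assoc of_center_commute)
    have "(fst x * ?s z) * ?s y = fst x * ?s y * ?s z" by (rule swap)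
    also have "\<dots> = fst y * ?s x * ?s z" using xy by (simp add: fractions_rel_def)
    also have "\<dots> = fst y * ?s z * ?s x" by (rule swap)
    also have "\<dots> = fst z * ?s y * ?s x" using yz by (simp add: fractions_rel_def)
    also have "\<dots> = (fst z * ?s x) * ?s y" by (rule swap)
    finally show "fractions_rel x z"
      using xy yz by (simp add: fractions_rel_def)
  qed
qed

quotient_type (overloaded) 'a quotient_ring =
  "'a::ring_1_no_zero_divisors \<times> 'a center" / partial: fractions_rel
  by (rule part_equivp_fractions_rel)

lemma fractions_rel_cancel:
  assumes "snd x \<noteq> 0" "w \<noteq> 0" "fst y = of_center w * fst x" "snd y = w * snd x"
  shows "fractions_rel x y"
  using assms
  by (simp add: fractions_rel_def mult.assoc)
    (metis mult.assoc of_center_commute of_center_simps(5))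

instantiation quotient_ring :: (ring_1_no_zero_divisors) ring_1
begin

lift_definition zero_quotient_ring :: "'a quotient_ring" is "(0, 1)"
  by (simp add: fractions_rel_def)

lift_definition one_quotient_ring :: "'a quotient_ring" is "(1, 1)"
  by (simp add: fractions_rel_def)

lift_definition plus_quotient_ring :: "'a quotient_ring \<Rightarrow> 'a quotient_ring \<Rightarrow> 'a quotient_ring"
  is "\<lambda>x y. (of_center (snd y) * fst x + of_center (snd x) * fst y, snd x * snd y)"
proof -
  fix x x' y y' :: "'a \<times> 'a center"
  assume x: "fractions_rel x x'" and y: "fractions_rel y y'"
  obtain a s where [simp]: "x = (a, s)" by (cases x)
  obtain a' s' where [simp]: "x' = (a', s')" by (cases x')
  obtain b t where [simp]: "y = (b, t)" by (cases y)
  obtain b' t' where [simp]: "y' = (b', t')" by (cases y')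
  have 1: "of_center s' * a = of_center s * a'"
    using x by (simp add: fractions_rel_def of_center_commute)
  have 2: "of_center t' * b = of_center t * b'"
    using y by (simp add: fractions_rel_def of_center_commute)
  have "of_center (s' * t') * (of_center t * a + of_center s * b)
      = of_center (t * t') * (of_center s' * a) + of_center (s * s') * (of_center t' * b)"
    by (simp only: distrib_left center_scale_scale mult_ac)
  also have "\<dots> = of_center (s * t) * (of_center t' * a' + of_center s' * b')"
    unfolding 1 2 by (simp only: distrib_left center_scale_scale mult_ac)
  finally show "fractions_rel (of_center (snd y) * fst x + of_center (snd x) * fst y, snd x * snd y)
      (of_center (snd y') * fst x' + of_center (snd x') * fst y', snd x' * snd y')"
    using x y by (simp add: fractions_rel_def of_center_commute del: of_center_simps)
qed

lift_definition uminus_quotient_ring :: "'a quotient_ring \<Rightarrow> 'a quotient_ring"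
  is "\<lambda>x. (- fst x, snd x)"
  by (simp add: fractions_rel_def)

lift_definition times_quotient_ring :: "'a quotient_ring \<Rightarrow> 'a quotient_ring \<Rightarrow> 'a quotient_ring"
  is "\<lambda>x y. (fst x * fst y, snd x * snd y)"
proof -
  fix x x' y y' :: "'a \<times> 'a center"
  assume x: "fractions_rel x x'" and y: "fractions_rel y y'"
  obtain a s where [simp]: "x = (a, s)" by (cases x)
  obtain a' s' where [simp]: "x' = (a', s')" by (cases x')
  obtain b t where [simp]: "y = (b, t)" by (cases y)
  obtain b' t' where [simp]: "y' = (b', t')" by (cases y')
  have 1: "of_center s' * a = of_center s * a'"
    using x by (simp add: fractions_rel_def of_center_commute)
  have 2: "of_center t' * b = of_center t * b'"
    using y by (simp add: fractions_rel_def of_center_commute)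
  have "of_center (s' * t') * (a * b) = (of_center s' * a) * (of_center t' * b)"
    by (rule center_scale_mult)
  also have "\<dots> = of_center (s * t) * (a' * b')"
    unfolding 1 2 by (rule center_scale_mult[symmetric])
  finally show "fractions_rel (fst x * fst y, snd x * snd y) (fst x' * fst y', snd x' * snd y')"
    using x y by (simp add: fractions_rel_def of_center_commute del: of_center_simps)
qed

definition minus_quotient_ring :: "'a quotient_ring \<Rightarrow> 'a quotient_ring \<Rightarrow> 'a quotient_ring"
  where "x - y = x + - (y :: 'a quotient_ring)"

instance
proof
  fix q r u :: "'a quotient_ring"
  show "q * r * u = q * (r * u)"
    by transfer (simp add: fractions_rel_def mult.assoc)
  show "q + r + u = q + (r + u)"
    by transfer (auto simp only: fractions_rel_def fst_conv snd_conv distrib_left center_scale_scale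
        mult_ac add_ac mult_eq_0_iff)
  show "q + r = r + q"
    by transfer (auto simp only: fractions_rel_def fst_conv snd_conv mult_ac add_ac mult_eq_0_iff)
  show "0 + q = q" "- q + q = 0" "1 * q = q" "q * 1 = q"
    by (transfer; simp add: fractions_rel_def)+
  show "q - r = q + - r" by (rule minus_quotient_ring_def)
  show "(q + r) * u = q * u + r * u"
  proof (transfer, goal_cases)
    case (1 q r u)
    then show ?case
      by (intro fractions_rel_cancel[where w = "snd u"])
        (auto simp only: fractions_rel_def fst_conv snd_conv distrib_left distrib_right mult.assoc
          center_scale_scale mult_ac mult_eq_0_iff)
  qed
  show "u * (q + r) = u * q + u * r"
  proof (transfer, goal_cases)
    case (1 u q r)
    then show ?case
      by (intro fractions_rel_cancel[where w = "snd u"])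
        (auto simp only: fractions_rel_def fst_conv snd_conv distrib_left distrib_right
          center_left_commute[of "fst u"] center_scale_scale mult_ac mult_eq_0_iff)
  qed
  show "(0 :: 'a quotient_ring) \<noteq> 1"
    by transfer (simp add: fractions_rel_def)
qed

end

lift_definition fraction :: "'a \<Rightarrow> 'a center \<Rightarrow> 'a::ring_1_no_zero_divisors quotient_ring"
  is "\<lambda>a s. if s = 0 then (0, 1) else (a, s)"
  by (simp add: fractions_rel_def)

lemma fraction_eq_iff:
  assumes "s \<noteq> 0" "t \<noteq> 0"
  shows "fraction a s = fraction b t \<longleftrightarrow> a * of_center t = b * of_center s"
  using assms by transfer (simp add: fractions_rel_def)

lemma fraction_simps:
  assumes "s \<noteq> 0" "t \<noteq> 0"
  shows "fraction a s + fraction b t = fraction (of_center t * a + of_center s * b) (s * t)"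
    and "fraction a s * fraction b t = fraction (a * b) (s * t)"
  using assms by (transfer; simp add: fractions_rel_def)+

lemma fraction_1_1: "fraction 1 1 = 1"
  by transfer (simp add: fractions_rel_def)

definition of_center_fract :: "'a center fract \<Rightarrow> 'a::ring_1_no_zero_divisors quotient_ring" where
  "of_center_fract c = (case rep_fract c of (t, s) \<Rightarrow> fraction (of_center t) s)"

lemma of_center_fract_Fract:
  fixes s t :: "'a::ring_1_no_zero_divisors center"
  assumes "s \<noteq> 0"
  shows "of_center_fract (Fract t s) = fraction (of_center t) s"
proof -
  obtain t' s' where r: "rep_fract (Fract t s) = (t', s')" by fastforce
  have "fractrel (rep_fract (Fract t s)) (rep_fract (Fract t s))"
    and "abs_fract (rep_fract (Fract t s)) = Fract t s"
    using Quotient3_fract by (auto simp: Quotient3_def)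
  then have s': "s' \<noteq> 0" and "abs_fract (t', s') = Fract t s" by (simp_all add: r)
  then have "Fract t' s' = Fract t s" by (simp add: Fract.abs_eq)
  then have "t' * s = t * s'" using assms s' by (simp add: eq_fract)
  then have "of_center t' * of_center s = of_center t * of_center s'"
    by (metis of_center_simps(5))
  then show ?thesis using assms s' by (simp add: of_center_fract_def r fraction_eq_iff)
qed

lemma of_center_fract_simps:
  fixes c d :: "'a::ring_1_no_zero_divisors center fract"
  shows "of_center_fract 1 = (1 :: 'a quotient_ring)"
    and "of_center_fract (c + d) = of_center_fract c + of_center_fract d"
    and "of_center_fract (c * d) = of_center_fract c * of_center_fract d"
proof -
  show "of_center_fract 1 = (1 :: 'a quotient_ring)"
    by (simp add: One_fract_def of_center_fract_Fract fraction_1_1)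
  obtain t s where c: "c = Fract t s" "s \<noteq> 0" by (cases c)
  obtain u v where d: "d = Fract u v" "v \<noteq> 0" by (cases d)
  show "of_center_fract (c + d) = of_center_fract c + of_center_fract d"
    using c d
    by (simp add: of_center_fract_Fract fraction_simps mult.commute[of t v] mult.commute[of u s])
  show "of_center_fract (c * d) = of_center_fract c * of_center_fract d"
    using c d by (simp add: of_center_fract_Fract fraction_simps)
qed

definition quotient_scale ::
    "'a center fract \<Rightarrow> 'a quotient_ring \<Rightarrow> 'a::ring_1_no_zero_divisors quotient_ring" where
  "quotient_scale c x = of_center_fract c * x"

global_interpretation quotient: vector_space quotient_scale
proof
  fix c d :: "'a center fract" and x y :: "'a quotient_ring"
  show "quotient_scale c (x + y) = quotient_scale c x + quotient_scale c y"
    unfolding quotient_scale_def by (rule distrib_left)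
  show "quotient_scale (c + d) x = quotient_scale c x + quotient_scale d x"
    unfolding quotient_scale_def of_center_fract_simps by (rule distrib_right)
  show "quotient_scale c (quotient_scale d x) = quotient_scale (c * d) x"
    unfolding quotient_scale_def of_center_fract_simps by (rule mult.assoc[symmetric])
  show "quotient_scale 1 x = x"
    unfolding quotient_scale_def of_center_fract_simps by (rule mult_1_left)
qed

section \<open>Reduced norm\<close>

text \<open>
  A splitting of \<open>q(E)\<close> over the algebraic closure \<open>L\<close> of \<open>q(T)\<close>: a \<open>q(T)\<close>-algebra homomorphism into
  the \<open>m \<times> m\<close> matrices over \<open>L\<close> whose \<open>L\<close>-linear extension to \<open>q(E) \<otimes> L\<close> is onto (last condition),
  hence, as the dimensions agree (first condition), an isomorphism of \<open>L\<close>-algebras.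
\<close>

definition splitting ::
    "nat \<Rightarrow> ('a::ring_1_no_zero_divisors quotient_ring \<Rightarrow> 'a center fract alg_closure mat) \<Rightarrow> bool" where
  "splitting m \<phi> \<longleftrightarrow>
     m\<^sup>2 = quotient.dim (UNIV :: 'a quotient_ring set)
     \<and> (\<forall>x. \<phi> x \<in> carrier_mat m m)
     \<and> \<phi> 1 = 1\<^sub>m m
     \<and> (\<forall>x y. \<phi> (x + y) = \<phi> x + \<phi> y)
     \<and> (\<forall>x y. \<phi> (x * y) = \<phi> x * \<phi> y)
     \<and> (\<forall>c x. \<phi> (quotient_scale c x) = to_ac c \<cdot>\<^sub>m \<phi> x)
     \<and> (\<forall>M\<in>carrier_mat m m. \<exists>S c. finite S \<and>
          (\<forall>i<m. \<forall>j<m. M $$ (i, j) = (\<Sum>x\<in>S. c x * \<phi> x $$ (i, j))))"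

definition reduced_norm :: "'a::ring_1_no_zero_divisors quotient_ring \<Rightarrow> 'a center fract" where
  "reduced_norm x = (THE c. \<exists>m \<phi>. splitting m \<phi> \<and> Determinant.det (\<phi> x) = to_ac c)"

text \<open>
  The values are taken in \<open>q(T)\<close>, which contains the unit group of \<open>T\<close> through \<open>to_fract\<close>.
\<close>

definition Nrd :: "'a::ring_1_no_zero_divisors \<Rightarrow> 'a center fract" where
  "Nrd a = reduced_norm (fraction a 1)"

section \<open>Graded center, index, involution\<close>

definition central_part :: "('g \<Rightarrow> 'a::ring_1 set) \<Rightarrow> 'g \<Rightarrow> 'a set" where
  "central_part E \<gamma> = E \<gamma> \<inter> range of_center"

definition fixed_part :: "('g \<Rightarrow> 'a::ring_1 set) \<Rightarrow> ('a \<Rightarrow> 'a) \<Rightarrow> 'g \<Rightarrow> 'a set" where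
  "fixed_part E \<tau> \<gamma> = {t \<in> central_part E \<gamma>. \<tau> t = t}"

text \<open>
  \<open>[E:T]\<close> is finite and equal to \<open>n\<^sup>2\<close>: like every graded module over a graded field, the ring has a
  base over \<open>T\<close> consisting of homogeneous elements, and the size of a base is the dimension.
\<close>

definition has_index :: "('g, 'h) monoid_scheme \<Rightarrow> ('g \<Rightarrow> 'a::ring_1 set) \<Rightarrow> nat \<Rightarrow> bool" where
  "has_index \<Gamma> E n \<longleftrightarrow>
     (\<exists>B \<subseteq> homogeneous \<Gamma> E. \<not> center.dependent B
        \<and> center.span B = UNIV \<and> finite B \<and> card B = n\<^sup>2)"

definition graded_involution ::
    "('g, 'h) monoid_scheme \<Rightarrow> ('g \<Rightarrow> 'a::ring_1 set) \<Rightarrow> ('a \<Rightarrow> 'a) \<Rightarrow> bool" where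
  "graded_involution \<Gamma> E \<tau> \<longleftrightarrow>
     (\<forall>x y. \<tau> (x + y) = \<tau> x + \<tau> y) \<and> (\<forall>x y. \<tau> (x * y) = \<tau> y * \<tau> x)
     \<and> (\<forall>x. \<tau> (\<tau> x) = x) \<and> (\<forall>\<gamma>\<in>carrier \<Gamma>. \<tau> ` E \<gamma> = E \<gamma>)"

definition unitary :: "('a::ring_1 \<Rightarrow> 'a) \<Rightarrow> bool" where
  "unitary \<tau> \<longleftrightarrow> (\<exists>t \<in> range of_center. \<tau> t \<noteq> t)"

definition totally_ramified :: "('g, 'h) monoid_scheme \<Rightarrow> ('g \<Rightarrow> 'a::ring_1 set) \<Rightarrow> bool" where
  "totally_ramified \<Gamma> E \<longleftrightarrow> E \<one>\<^bsub>\<Gamma>\<^esub> = central_part E \<one>\<^bsub>\<Gamma>\<^esub>"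

definition group_exponent :: "('g, 'h) monoid_scheme \<Rightarrow> nat" where
  "group_exponent G = (LEAST k. 0 < k \<and> (\<forall>x\<in>carrier G. x [^]\<^bsub>G\<^esub> k = \<one>\<^bsub>G\<^esub>))"

section \<open>The groups \<open>K\<^sub>1\<close> and \<open>SK\<^sub>1\<close>\<close>

abbreviation restrict_group :: "('g, 'h) monoid_scheme \<Rightarrow> 'g set \<Rightarrow> ('g, 'h) monoid_scheme"
    (infixl \<open>\<restriction>\<close> 70) where
  "G \<restriction> H \<equiv> G\<lparr>carrier := H\<rparr>"

context
  fixes \<Gamma> :: "('g, 'h) monoid_scheme" and E :: "'g \<Rightarrow> 'a::ring_1_no_zero_divisors set"
begin

definition commutators :: "'a set" where
  "commutators = derived (unit_group \<Gamma> E) (carrier (unit_group \<Gamma> E))"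

definition Nrd_one :: "'a set" where
  "Nrd_one = {a \<in> carrier (unit_group \<Gamma> E). Nrd a = 1}"

definition K1 :: "'a set monoid" where
  "K1 = unit_group \<Gamma> E Mod commutators"

definition SK1 :: "'a set monoid" where
  "SK1 = (unit_group \<Gamma> E \<restriction> Nrd_one) Mod commutators"

text \<open>The element \<open>a\<^sup>1\<^sup>-\<^sup>\<tau>\<close>.\<close>

definition one_minus :: "('a \<Rightarrow> 'a) \<Rightarrow> 'a \<Rightarrow> 'a" where
  "one_minus \<tau> a = a \<otimes>\<^bsub>unit_group \<Gamma> E\<^esub> inv\<^bsub>unit_group \<Gamma> E\<^esub> (\<tau> a)"

definition Sigma_sym :: "('a \<Rightarrow> 'a) \<Rightarrow> 'a set" where
  "Sigma_sym \<tau> = generate (unit_group \<Gamma> E) {a \<in> carrier (unit_group \<Gamma> E). \<tau> a = a}"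

definition Sigma_Nrd :: "('a \<Rightarrow> 'a) \<Rightarrow> 'a set" where
  "Sigma_Nrd \<tau> = {a \<in> carrier (unit_group \<Gamma> E).
     \<exists>r. of_center r \<in> carrier (unit_group \<Gamma> (fixed_part E \<tau>)) \<and> Nrd a = to_fract r}"

definition unitary_K1 :: "('a \<Rightarrow> 'a) \<Rightarrow> 'a set monoid" where
  "unitary_K1 \<tau> = unit_group \<Gamma> E Mod Sigma_sym \<tau>"

definition unitary_SK1 :: "('a \<Rightarrow> 'a) \<Rightarrow> 'a set monoid" where
  "unitary_SK1 \<tau> = (unit_group \<Gamma> E \<restriction> Sigma_Nrd \<tau>) Mod Sigma_sym \<tau>"

section \<open>Subgroups of \<open>T\<^sub>0\<close>\<close>

definition T0_ring :: "'a ring" where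
  "T0_ring = ring_of_type_algebra\<lparr>carrier := central_part E \<one>\<^bsub>\<Gamma>\<^esub>\<rparr>"

definition power_in_R0 :: "('a \<Rightarrow> 'a) \<Rightarrow> nat \<Rightarrow> 'a set" where
  "power_in_R0 \<tau> k =
     {a \<in> central_part E \<one>\<^bsub>\<Gamma>\<^esub> - {0}. a ^ k \<in> fixed_part E \<tau> \<one>\<^bsub>\<Gamma>\<^esub> - {0}}"

text \<open>
  The roots of unity in an algebraic closure of \<open>T\<^sub>0\<close> are those in the algebraic closure of \<open>q(T)\<close>,
  because \<open>T\<^sub>0\<close> is a subfield of \<open>q(T)\<close>.
\<close>

definition roots_of_unity :: "nat \<Rightarrow> 'a center fract alg_closure set" where
  "roots_of_unity k = {z. z ^ k = 1}"

definition center_to_closure :: "'a center \<Rightarrow> 'a center fract alg_closure" where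
  "center_to_closure t = to_ac (to_fract t)"

definition mu_T0 :: "nat \<Rightarrow> 'a set" where
  "mu_T0 k = of_center ` {t. of_center t \<in> central_part E \<one>\<^bsub>\<Gamma>\<^esub> - {0}
     \<and> center_to_closure t \<in> roots_of_unity k}"

definition mu_T0_inverted :: "('a \<Rightarrow> 'a) \<Rightarrow> nat \<Rightarrow> 'a set" where
  "mu_T0_inverted \<tau> k = {\<omega> \<in> mu_T0 k. \<tau> \<omega> = inv\<^bsub>unit_group \<Gamma> E\<^esub> \<omega>}"

end

end

(* The reduced norm is computed by splitting q(E) explicitly. Choose a maximal commutative subgroup H of
   E^* together with a character H -> L^* extending T^* -> L^*, where L is the algebraic closure of q(T);
   inducing it to E^* gives monomial matrices. They form a splitting because the images of
   inequivalent homogeneous elements are simultaneous eigenvectors, with distinct characters, for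
   conjugation by E^*. In any splitting the matrix of a homogeneous a is conjugate to its multiples
   by all commutators [g,a], so its characteristic polynomial is (X^k - a^k)^(n/k), where k is the order
   of a modulo T^*; hence Nrd(a) is a^n up to sign.

   Every homogeneous element is a = t s with t in T_0 and s symmetric, and a^(1-tau) = t^(1-tau). The
   product of symmetric elements s, s' is u s'' with u^(1-tau) = [s,s'], and commutators generate mu_e;
   therefore Sigma_tau(E) meets T_0 exactly in {u | u^e in R_0}. Everything then follows by sending t
   to t^(1-tau), with Hilbert 90 for T_0 over R_0. *)

theory Submission
  imports Defs "Jordan_Normal_Form.Char_Poly" "HOL-Algebra.Sylow"
begin

section \<open>Homogeneous components and units\<close>

text \<open>Total ramification puts every commutator into T_0, which is central. Hence the
  commutator is a bimultiplicative pairing on E^*/T^*, a group of order n^2, and it is nondegenerate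
  because an element commuting with all of E^* is central. This is why the self-centralizing
  subgroup H has index exactly n, so that the induced matrices have the right size. It also explains
  mu_e: the values of the pairing are e-th roots of unity, while the |E'|-th power kills the
  pairing, so e <= |E'| <= |mu_e| <= e. The reduced norm is a definite description over all
  splittings. Its value on a homogeneous element is therefore computed in an arbitrary splitting,
  which replaces an appeal to Skolem-Noether. The sign left in Nrd(a) is harmless: membership in R^*
  ignores it, and Nrd(a) = 1 forces a into degree 0, where Nrd(a) is exactly a^n. That T is
  unramified over R keeps tau nontrivial on T_0; this supplies the skew elements t - tau(t) that
  \<open>symmetric_exists\<close> and \<open>Hilbert90\<close> rely on in every
  characteristic.\<close>

locale graded_division_algebra = graded_division_ring \<Gamma> E
  for \<Gamma> :: "('g, 'h) monoid_scheme" (structure) and E :: "'g \<Rightarrow> 'a::ring_1_no_zero_divisors set"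
begin

definition cpt :: "'a \<Rightarrow> 'g \<Rightarrow> 'a" where
  "cpt x = (THE f. (\<forall>\<gamma>\<in>carrier \<Gamma>. f \<gamma> \<in> E \<gamma>) \<and> (\<forall>\<gamma>. \<gamma> \<notin> carrier \<Gamma> \<longrightarrow> f \<gamma> = 0)
          \<and> finite {\<gamma>. f \<gamma> \<noteq> 0} \<and> x = (\<Sum>\<gamma> | f \<gamma> \<noteq> 0. f \<gamma>))"

lemma cpt:
  shows cpt_mem: "\<gamma> \<in> carrier \<Gamma> \<Longrightarrow> cpt x \<gamma> \<in> E \<gamma>"
    and cpt_outside: "\<gamma> \<notin> carrier \<Gamma> \<Longrightarrow> cpt x \<gamma> = 0"
    and finite_cpt: "finite {\<gamma>. cpt x \<gamma> \<noteq> 0}"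
    and sum_cpt: "(\<Sum>\<gamma> | cpt x \<gamma> \<noteq> 0. cpt x \<gamma>) = x"
  using theI'[OF direct_sum[of x], folded cpt_def] by auto

sublocale grading: comm_group \<Gamma>
  by (rule grading_group)

abbreviation "deg0 \<equiv> \<one>"

lemma cpt_eqI:
  assumes "finite S" "S \<subseteq> carrier \<Gamma>" "\<And>\<gamma>. \<gamma> \<in> S \<Longrightarrow> f \<gamma> \<in> E \<gamma>" "x = (\<Sum>\<gamma>\<in>S. f \<gamma>)"
  shows "cpt x = (\<lambda>\<gamma>. if \<gamma> \<in> S then f \<gamma> else 0)"
proof -
  let ?f = "\<lambda>\<gamma>. if \<gamma> \<in> S then f \<gamma> else 0"
  have sub: "{\<gamma>. ?f \<gamma> \<noteq> 0} \<subseteq> S" by auto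
  have "(\<Sum>\<gamma> | ?f \<gamma> \<noteq> 0. ?f \<gamma>) = (\<Sum>\<gamma>\<in>S. ?f \<gamma>)"
    by (rule sum.mono_neutral_left) (use assms(1) sub in auto)
  then have "x = (\<Sum>\<gamma> | ?f \<gamma> \<noteq> 0. ?f \<gamma>)" using assms(4) by simp
  moreover have "finite {\<gamma>. ?f \<gamma> \<noteq> 0}" using sub assms(1) finite_subset by blast
  ultimately have "(\<forall>\<gamma>\<in>carrier \<Gamma>. ?f \<gamma> \<in> E \<gamma>) \<and> (\<forall>\<gamma>. \<gamma> \<notin> carrier \<Gamma> \<longrightarrow> ?f \<gamma> = 0)
          \<and> finite {\<gamma>. ?f \<gamma> \<noteq> 0} \<and> x = (\<Sum>\<gamma> | ?f \<gamma> \<noteq> 0. ?f \<gamma>)"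
    using assms(2,3) component_zero by auto
  then show ?thesis
    unfolding cpt_def by (rule the1_equality[OF direct_sum])
qed

lemma cpt_homogeneous:
  assumes "\<delta> \<in> carrier \<Gamma>" "x \<in> E \<delta>"
  shows "cpt x = (\<lambda>\<gamma>. if \<gamma> = \<delta> then x else 0)"
  using cpt_eqI[of "{\<delta>}" "\<lambda>_. x" x] assms by auto

lemma degree_unique:
  assumes "\<gamma> \<in> carrier \<Gamma>" "\<delta> \<in> carrier \<Gamma>" "x \<in> E \<gamma>" "x \<in> E \<delta>" "x \<noteq> 0"
  shows "\<gamma> = \<delta>"
  using cpt_homogeneous[OF assms(1,3)] cpt_homogeneous[OF assms(2,4)] assms(5)
  by (metis (full_types))

text \<open>Apply \<open>\<phi>\<close> to the decomposition of \<open>x\<close>; injectivity of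
  \<open>\<pi>\<close> keeps the shifted degrees distinct, so uniqueness identifies the result as
  the decomposition of \<open>\<phi> x\<close>. It is used for left and right multiplication by a
  homogeneous element.\<close>

lemma cpt_image:
  assumes add: "\<And>x y. \<phi> (x + y) = \<phi> x + \<phi> y"
    and \<pi>: "inj_on \<pi> (carrier \<Gamma>)" "\<pi> ` carrier \<Gamma> \<subseteq> carrier \<Gamma>"
    and mem: "\<And>\<gamma> x. \<gamma> \<in> carrier \<Gamma> \<Longrightarrow> x \<in> E \<gamma> \<Longrightarrow> \<phi> x \<in> E (\<pi> \<gamma>)"
    and g: "\<gamma> \<in> carrier \<Gamma>"
  shows "cpt (\<phi> x) (\<pi> \<gamma>) = \<phi> (cpt x \<gamma>)"
proof -
  let ?S = "{\<gamma>. cpt x \<gamma> \<noteq> 0}" and ?q = "the_inv_into (carrier \<Gamma>) \<pi>"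
  have S: "finite ?S" "?S \<subseteq> carrier \<Gamma>" using finite_cpt cpt_outside by auto
  have q: "?q (\<pi> \<delta>) = \<delta>" if "\<delta> \<in> carrier \<Gamma>" for \<delta> using \<pi>(1) that by (rule the_inv_into_f_f)
  have \<phi>0: "\<phi> 0 = 0" using add[of 0 0] by simp
  have "\<phi> (sum f A) = (\<Sum>i\<in>A. \<phi> (f i))" if "finite A" for f and A :: "'g set"
    using that by (induction A rule: finite_induct) (simp_all add: \<phi>0 add)
  from this[OF S(1), of "cpt x"] have "\<phi> x = (\<Sum>\<delta>\<in>?S. \<phi> (cpt x \<delta>))" by (simp add: sum_cpt)
  also have "\<dots> = (\<Sum>\<epsilon>\<in>\<pi> ` ?S. \<phi> (cpt x (?q \<epsilon>)))"
    using S q by (subst sum.reindex[OF inj_on_subset[OF \<pi>(1)]]) (auto intro!: sum.cong simp: subset_iff)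
  finally have eq: "\<phi> x = (\<Sum>\<epsilon>\<in>\<pi> ` ?S. \<phi> (cpt x (?q \<epsilon>)))" .
  have "\<phi> (cpt x (?q \<epsilon>)) \<in> E \<epsilon>" if e: "\<epsilon> \<in> \<pi> ` ?S" for \<epsilon>
  proof -
    obtain \<delta> where "\<delta> \<in> carrier \<Gamma>" "\<epsilon> = \<pi> \<delta>" using e S by blast
    then show ?thesis using q mem cpt_mem by simp
  qed
  then have "cpt (\<phi> x) (\<pi> \<gamma>) = (if \<pi> \<gamma> \<in> \<pi> ` ?S then \<phi> (cpt x (?q (\<pi> \<gamma>))) else 0)"
    by (subst cpt_eqI[OF _ _ _ eq]) (use S \<pi> in auto)
  also have "\<dots> = \<phi> (cpt x \<gamma>)"
    using q[OF g] \<pi>(1) S g \<phi>0 by (auto simp: inj_on_image_mem_iff)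
  finally show ?thesis .
qed

lemma cpt_mult:
  assumes "\<delta> \<in> carrier \<Gamma>" "a \<in> E \<delta>" "\<gamma> \<in> carrier \<Gamma>"
  shows "cpt (a * x) (\<delta> \<otimes> \<gamma>) = a * cpt x \<gamma>"
    and "cpt (x * a) (\<gamma> \<otimes> \<delta>) = cpt x \<gamma> * a"
  using assms
  by (intro cpt_image[where \<phi> = "\<lambda>x. a * x" and \<pi> = "\<lambda>\<gamma>. \<delta> \<otimes> \<gamma>"]
      cpt_image[where \<phi> = "\<lambda>x. x * a" and \<pi> = "\<lambda>\<gamma>. \<gamma> \<otimes> \<delta>"];
      auto simp: distrib_left distrib_right component_mult intro!: inj_onI)+

text \<open>The axioms do not place 1 in degree 0. Comparing components in \<open>1 * x = x\<close>
  shows that the degree-0 component of 1 is a left identity on homogeneous elements, hence on 1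
  itself.\<close>

lemma one_mem: "1 \<in> E deg0"
proof -
  have hom: "cpt 1 deg0 * x = x" if "\<delta> \<in> carrier \<Gamma>" "x \<in> E \<delta>" for \<delta> x
  proof -
    have "cpt (1 * x) (deg0 \<otimes> \<delta>) = cpt 1 deg0 * x"
      by (rule cpt_mult(2)) (use that in auto)
    then show ?thesis using cpt_homogeneous[OF that] that by simp
  qed
  have "cpt 1 deg0 * 1 = cpt 1 deg0 * (\<Sum>\<gamma> | cpt 1 \<gamma> \<noteq> 0. cpt 1 \<gamma>)"
    by (simp only: sum_cpt)
  also have "\<dots> = (\<Sum>\<gamma> | cpt 1 \<gamma> \<noteq> 0. cpt 1 \<gamma>)"
    unfolding sum_distrib_left
    by (rule sum.cong[OF refl]) (use hom cpt_mem cpt_outside in blast)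
  also have "\<dots> = 1" by (rule sum_cpt)
  finally have "cpt 1 deg0 = 1" by simp
  then show ?thesis using cpt_mem[of deg0 1] by simp
qed

text \<open>\<open>homogeneous_invertible\<close> gives an inverse without a degree. Its component
  in degree \<open>inv \<gamma>\<close> is again a right inverse of \<open>a\<close>, by the
  degree-0 part of \<open>a * y = 1\<close>, and so is all of \<open>y\<close>.\<close>

lemma homogeneous_inverse:
  assumes "\<gamma> \<in> carrier \<Gamma>" "a \<in> E \<gamma>" "a \<noteq> 0"
  obtains y where "y \<in> E (inv \<gamma>)" "a * y = 1" "y * a = 1"
proof -
  obtain y where y: "a * y = 1" "y * a = 1" using homogeneous_invertible assms by blast
  have "cpt (a * y) (\<gamma> \<otimes> inv \<gamma>) = a * cpt y (inv \<gamma>)"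
    by (rule cpt_mult(1)) (use assms in auto)
  then have "a * cpt y (inv \<gamma>) = 1"
    using y(1) cpt_homogeneous[OF _ one_mem] assms by simp
  then have "cpt y (inv \<gamma>) = y" using y by (metis mult.assoc mult_1_left mult_1_right)
  then have "y \<in> E (inv \<gamma>)" using cpt_mem[of "inv \<gamma>" y] assms by simp
  with y that show thesis by blast
qed

abbreviation "U \<equiv> unit_group \<Gamma> E"

abbreviation "Eu \<equiv> carrier U"

lemma mem_U: "x \<in> Eu \<longleftrightarrow> x \<noteq> 0 \<and> (\<exists>\<gamma>\<in>carrier \<Gamma>. x \<in> E \<gamma>)"
  by (auto simp: unit_group_def homogeneous_def)

lemma unit_groupI: "x \<noteq> 0 \<Longrightarrow> \<gamma> \<in> carrier \<Gamma> \<Longrightarrow> x \<in> E \<gamma> \<Longrightarrow> x \<in> Eu"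
  by (auto simp: mem_U)

lemma U_mult: "monoid.mult U = (*)" and U_one: "one U = 1"
  by (simp_all add: unit_group_def)

lemma group_U: "group U"
proof (rule groupI)
  show "x \<otimes>\<^bsub>U\<^esub> y \<in> Eu" if xy: "x \<in> Eu" "y \<in> Eu" for x y
  proof -
    obtain \<gamma> \<delta> where "\<gamma> \<in> carrier \<Gamma>" "\<delta> \<in> carrier \<Gamma>" "x \<in> E \<gamma>" "y \<in> E \<delta>"
      using xy unfolding mem_U by blast
    then show ?thesis
      using xy component_mult[of \<gamma> \<delta> x y] by (auto simp: mem_U U_mult)
  qed
  show "\<one>\<^bsub>U\<^esub> \<in> Eu" using one_mem by (auto simp: mem_U U_one)
  show "\<exists>y\<in>Eu. y \<otimes>\<^bsub>U\<^esub> x = \<one>\<^bsub>U\<^esub>" if x: "x \<in> Eu" for x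
  proof -
    obtain \<gamma> where g: "\<gamma> \<in> carrier \<Gamma>" "x \<in> E \<gamma>" "x \<noteq> 0" using x unfolding mem_U by blast
    then obtain y where y: "y \<in> E (inv \<gamma>)" "x * y = 1" "y * x = 1"
      by (rule homogeneous_inverse)
    then have "y \<in> Eu" using g by (intro unit_groupI[of _ "inv \<gamma>"]) auto
    with y show ?thesis by (auto simp: U_mult U_one)
  qed
qed (auto simp: U_mult U_one mult.assoc)

lemma U_pow: "x [^]\<^bsub>U\<^esub> (k::nat) = x ^ k"
  by (induction k) (simp_all add: nat_pow_def U_mult U_one power_Suc2 del: power_Suc)

text \<open>The rewrites let the group lemmas speak of ring products and powers; only the inverse,
  which is partial on the ring, stays a group operation.\<close>

sublocale units: group U
  rewrites "monoid.mult U = (*)" and "one U = 1" and "\<And>x k. x [^]\<^bsub>U\<^esub> (k::nat) = x ^ k"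
  by (rule group_U) (simp_all add: U_mult U_one U_pow)

abbreviation iv :: "'a \<Rightarrow> 'a" where "iv x \<equiv> inv\<^bsub>U\<^esub> x"

lemma U_nonzero: "x \<in> Eu \<Longrightarrow> x \<noteq> 0"
  by (simp add: mem_U)

lemma iv_cancel [simp]:
  assumes "x \<in> Eu"
  shows "iv x * (x * y) = y" "x * (iv x * y) = y" "y * x * iv x = y" "y * iv x * x = y"
  using assms by (simp_all add: mult.assoc[symmetric]) (simp_all add: mult.assoc)

lemma iv_eqI: "x \<in> Eu \<Longrightarrow> x * y = 1 \<Longrightarrow> iv x = y"
  by (metis iv_cancel(1) mult_1_right)

lemma iv_mem:
  assumes "\<gamma> \<in> carrier \<Gamma>" "x \<in> E \<gamma>" "x \<noteq> 0"
  shows "iv x \<in> E (inv \<gamma>)"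
proof -
  obtain y where "y \<in> E (inv \<gamma>)" "x * y = 1" using homogeneous_inverse[OF assms] by blast
  then show ?thesis using iv_eqI[of x y] unit_groupI assms by auto
qed

lemma homogeneous_induct [case_names zero add unit]:
  assumes "P 0" "\<And>x y. P x \<Longrightarrow> P y \<Longrightarrow> P (x + y)" "\<And>u. u \<in> Eu \<Longrightarrow> P u"
  shows "P x"
proof -
  have "P (\<Sum>\<gamma>\<in>S. cpt x \<gamma>)" if "finite S" "S \<subseteq> carrier \<Gamma>" for S
    using that
  proof (induction S rule: finite_induct)
    case (insert \<gamma> S)
    have "P (cpt x \<gamma>)"
      using assms(1,3) cpt_mem[of \<gamma> x] insert unit_groupI[of "cpt x \<gamma>" \<gamma>] by (metis insert_subset)
    then show ?case using insert assms(2) by simp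
  qed (simp add: assms(1))
  from this[of "{\<gamma>. cpt x \<gamma> \<noteq> 0}"] show ?thesis
    using finite_cpt cpt_outside by (auto simp: sum_cpt)
qed

lemma central_iff: "(x::'a) \<in> range of_center \<longleftrightarrow> (\<forall>y. x * y = y * x)"
  using type_definition.Rep_range[OF type_definition_center] by auto

lemma centralI:
  assumes "\<And>u. u \<in> Eu \<Longrightarrow> x * u = u * x"
  shows "x \<in> range of_center"
  unfolding central_iff
proof
  show "x * y = y * x" for y
    by (induction y rule: homogeneous_induct) (simp_all add: assms distrib_left distrib_right)
qed

text \<open>The center is a graded subring: compare the components of \<open>t * u = u * t\<close>
  in the degree of \<open>cpt t \<gamma> * u\<close>, for each homogeneous unit
  \<open>u\<close>.\<close>

lemma cpt_central:
  assumes "t \<in> range of_center"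
  shows "cpt t \<gamma> \<in> range of_center"
proof (cases "\<gamma> \<in> carrier \<Gamma>")
  case True
  show ?thesis
  proof (rule centralI)
    fix u assume u: "u \<in> Eu"
    obtain \<delta> where d: "\<delta> \<in> carrier \<Gamma>" "u \<in> E \<delta>" using u unfolding mem_U by blast
    have "cpt t \<gamma> * u = cpt (t * u) (\<gamma> \<otimes> \<delta>)"
      using cpt_mult(2)[OF d True] by simp
    also have "\<dots> = cpt (u * t) (\<delta> \<otimes> \<gamma>)"
      using assms True d by (simp add: central_iff grading.m_comm)
    also have "\<dots> = u * cpt t \<gamma>" by (rule cpt_mult(1)[OF d True])
    finally show "cpt t \<gamma> * u = u * cpt t \<gamma>" .
  qed
next
  case False
  then show ?thesis by (simp add: cpt_outside central_iff)
qed

definition Z :: "'a set" where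
  "Z = Eu \<inter> range of_center"

lemma Z_U: "x \<in> Z \<Longrightarrow> x \<in> Eu"
  and Z_commute: "x \<in> Z \<Longrightarrow> x * y = y * x"
  by (auto simp: Z_def central_iff)

lemma Z_left_commute: "x \<in> Z \<Longrightarrow> y * (x * z) = x * (y * z)"
  by (metis Z_commute mult.assoc)

lemma ZI: "x \<in> Eu \<Longrightarrow> (\<And>u. u \<in> Eu \<Longrightarrow> x * u = u * x) \<Longrightarrow> x \<in> Z"
  by (simp add: Z_def centralI)

lemma Z_one [simp]: "1 \<in> Z"
  by (rule ZI) simp_all

lemma Z_mult: "x \<in> Z \<Longrightarrow> y \<in> Z \<Longrightarrow> x * y \<in> Z"
  by (rule ZI) (simp_all add: Z_U, metis Z_commute mult.assoc)

lemma Z_inverse: 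
  assumes "x \<in> Z" shows "iv x \<in> Z"
proof (rule ZI)
  show "iv x \<in> Eu" using assms by (simp add: Z_U)
  fix u assume u: "u \<in> Eu"
  have "iv x * u = iv x * (u * x) * iv x" using assms by (simp add: Z_U mult.assoc)
  also have "\<dots> = u * iv x" using assms by (simp add: Z_commute[symmetric] Z_U mult.assoc[symmetric])
  finally show "iv x * u = u * iv x" .
qed

lemma Z_power: "x \<in> Z \<Longrightarrow> x ^ (k::nat) \<in> Z"
  by (induction k) (simp_all add: Z_mult)

lemma Z_power_mult: "x \<in> Z \<Longrightarrow> (x * y) ^ (k::nat) = x ^ k * y ^ k"
proof (induction k)
  case (Suc k)
  then show ?case
    by (simp add: mult.assoc) (metis Z_left_commute Z_power)
qed simp

lemma U_power: "x \<in> Eu \<Longrightarrow> x ^ (k::nat) \<in> Eu"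
  by (rule units.nat_pow_closed)

lemma iv_power: "x \<in> Eu \<Longrightarrow> iv (x ^ k) = iv x ^ (k::nat)"
  using units.nat_pow_inv[of x k] by simp

lemma subgroup_Z: "subgroup Z U"
  by unfold_locales (auto simp: Z_U U_mult U_one Z_mult Z_inverse)

lemma uminus_U: "x \<in> Eu \<Longrightarrow> - x \<in> Eu"
  unfolding mem_U using component_minus by auto

lemma uminus_Z: "x \<in> Z \<Longrightarrow> - x \<in> Z"
  by (rule ZI) (auto simp: uminus_U Z_U Z_commute)

section \<open>The commutator pairing\<close>

definition cm :: "'a \<Rightarrow> 'a \<Rightarrow> 'a" where
  "cm g h = g * h * iv g * iv h"

lemma cm_U [simp]: "g \<in> Eu \<Longrightarrow> h \<in> Eu \<Longrightarrow> cm g h \<in> Eu"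
  by (simp add: cm_def)

lemma cm_swap: "g \<in> Eu \<Longrightarrow> h \<in> Eu \<Longrightarrow> cm g h * (h * g) = g * h"
  by (simp add: cm_def mult.assoc)

lemma cm_eqI: "g \<in> Eu \<Longrightarrow> h \<in> Eu \<Longrightarrow> c * (h * g) = g * h \<Longrightarrow> cm g h = c"
  by (metis cm_swap U_nonzero mult_cancel_right units.m_closed)

lemma cm_eq_1_iff: "g \<in> Eu \<Longrightarrow> h \<in> Eu \<Longrightarrow> cm g h = 1 \<longleftrightarrow> g * h = h * g"
  by (metis cm_eqI cm_swap mult_1_left)

lemma cm_degree:
  assumes "g \<in> Eu" "h \<in> Eu"
  shows "cm g h \<in> E deg0"
proof -
  obtain \<gamma> \<delta> where d: "\<gamma> \<in> carrier \<Gamma>" "\<delta> \<in> carrier \<Gamma>" "g \<in> E \<gamma>" "h \<in> E \<delta>" "g \<noteq> 0" "h \<noteq> 0"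
    using assms unfolding mem_U by blast
  have "cm g h \<in> E (\<gamma> \<otimes> \<delta> \<otimes> inv \<gamma> \<otimes> inv \<delta>)"
    unfolding cm_def using d by (intro component_mult iv_mem) auto
  also have "\<gamma> \<otimes> \<delta> \<otimes> inv \<gamma> \<otimes> inv \<delta> = deg0"
    using d by (simp add: grading.m_comm[of \<gamma> \<delta>] grading.m_assoc)
  finally show ?thesis .
qed

lemma same_degree_quotient:
  assumes "\<gamma> \<in> carrier \<Gamma>" "x \<in> E \<gamma>" "y \<in> E \<gamma>" "y \<noteq> 0"
  shows "x * iv y \<in> E deg0"
  using component_mult[OF assms(1) _ assms(2) iv_mem[OF assms(1,3,4)]] assms(1) by simp

end

locale totally_ramified_algebra = graded_division_algebra +
  assumes ramified: "totally_ramified \<Gamma> E"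
begin

lemma degree0_central: "x \<in> E deg0 \<Longrightarrow> x \<in> range of_center"
  using ramified by (auto simp: totally_ramified_def central_part_def)

lemma central_part_degree0: "central_part E deg0 = E deg0"
  using ramified by (simp add: totally_ramified_def)

lemma degree0_Z: "x \<in> E deg0 \<Longrightarrow> x \<noteq> 0 \<Longrightarrow> x \<in> Z"
  using degree0_central unit_groupI[of x deg0] by (simp add: Z_def)

text \<open>Degrees commute, so a commutator has degree 0, and total ramification makes degree 0
  central. Centrality is what gives bimultiplicativity below.\<close>

lemma cm_Z [simp]: "g \<in> Eu \<Longrightarrow> h \<in> Eu \<Longrightarrow> cm g h \<in> Z"
  by (rule degree0_Z[OF cm_degree U_nonzero[OF cm_U]])

lemma cm_mult_left:
  assumes "g \<in> Eu" "g' \<in> Eu" "h \<in> Eu"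
  shows "cm (g * g') h = cm g h * cm g' h"
proof (rule cm_eqI)
  have "g * g' * h = g * (cm g' h * (h * g'))" using cm_swap[of g' h] assms by (simp add: mult.assoc)
  also have "\<dots> = cm g' h * (g * h) * g'"
    using assms by (simp add: Z_left_commute[of "cm g' h"] mult.assoc)
  also have "\<dots> = cm g' h * (cm g h * (h * g)) * g'" using cm_swap[of g h] assms by simp
  also have "\<dots> = cm g h * cm g' h * (h * (g * g'))"
    using assms by (simp add: Z_left_commute[of "cm g h"] mult.assoc)
  finally show "cm g h * cm g' h * (h * (g * g')) = g * g' * h" by simp
qed (use assms in auto)

lemma cm_mult_right:
  assumes "g \<in> Eu" "h \<in> Eu" "h' \<in> Eu"
  shows "cm g (h * h') = cm g h * cm g h'"
proof (rule cm_eqI)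
  have "g * (h * h') = cm g h * (h * g) * h'" using cm_swap[of g h] assms by (simp add: mult.assoc)
  also have "\<dots> = cm g h * h * (g * h')" by (simp add: mult.assoc)
  also have "\<dots> = cm g h * h * (cm g h' * (h' * g))" using cm_swap[of g h'] assms by simp
  also have "\<dots> = cm g h * cm g h' * (h * h' * g)"
    using assms by (simp add: Z_left_commute[of "cm g h'"] mult.assoc)
  finally show "cm g h * cm g h' * (h * h' * g) = g * (h * h')" by simp
qed (use assms in auto)

lemma cm_Z_left: "z \<in> Z \<Longrightarrow> h \<in> Eu \<Longrightarrow> cm z h = 1"
  and cm_Z_right: "z \<in> Z \<Longrightarrow> h \<in> Eu \<Longrightarrow> cm h z = 1"
  by (simp_all add: cm_eq_1_iff Z_U Z_commute)

lemma cm_one [simp]: "h \<in> Eu \<Longrightarrow> cm 1 h = 1" "h \<in> Eu \<Longrightarrow> cm h 1 = 1"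
  by (simp_all add: cm_Z_left cm_Z_right)

lemma cm_power_right: "g \<in> Eu \<Longrightarrow> h \<in> Eu \<Longrightarrow> cm g (h ^ (k::nat)) = cm g h ^ k"
  by (induction k) (simp_all add: cm_mult_right U_power)

text \<open>Nondegeneracy of the pairing: its radical is exactly T^*. Later centrality claims about
  powers and quotients go through this.\<close>

lemma Z_iff_cm: "x \<in> Eu \<Longrightarrow> x \<in> Z \<longleftrightarrow> (\<forall>g\<in>Eu. cm g x = 1)"
  by (metis Z_commute ZI cm_eq_1_iff)

lemma cm_inverse_left: 
  assumes "g \<in> Eu" "h \<in> Eu"
  shows "cm (iv g) h = iv (cm g h)"
  using cm_mult_left[of g "iv g" h] assms iv_eqI[of "cm g h" "cm (iv g) h"] by simp

lemma cm_inverse_right: 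
  assumes "g \<in> Eu" "h \<in> Eu"
  shows "cm g (iv h) = iv (cm g h)"
  using cm_mult_right[of g h "iv h"] assms iv_eqI[of "cm g h" "cm g (iv h)"] by simp

end

section \<open>Bases over the center\<close>

text \<open>Dedekind's argument for the independence of characters, with \<open>S\<close> standing
  for the set of all linear relations. Taking for \<open>a\<close> the eigenvalue at one index of
  the support shortens a relation without killing a second, separated index. The three uses differ
  only in what a relation is: in q(E), among matrices, among characters of a subgroup.\<close>

lemma eigenfamily_independent:
  fixes S :: "('i \<Rightarrow> 'k::field) set" and lam :: "'j \<Rightarrow> 'i \<Rightarrow> 'k"
  assumes I: "finite I"
    and shift: "\<And>c g a. c \<in> S \<Longrightarrow> g \<in> G \<Longrightarrow> (\<lambda>i. (lam g i - a) * c i) \<in> S"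
    and sep: "\<And>i j. i \<in> I \<Longrightarrow> j \<in> I \<Longrightarrow> i \<noteq> j \<Longrightarrow> \<exists>g\<in>G. lam g i \<noteq> lam g j"
    and single: "\<And>c i. c \<in> S \<Longrightarrow> i \<in> I \<Longrightarrow> (\<And>j. j \<in> I \<Longrightarrow> j \<noteq> i \<Longrightarrow> c j = 0) \<Longrightarrow> c i = 0"
    and c: "c \<in> S" "i \<in> I"
  shows "c i = 0"
  using c
proof (induction "card {i \<in> I. c i \<noteq> 0}" arbitrary: c i rule: less_induct)
  case less
  show ?case
  proof (rule ccontr)
    assume ci: "c i \<noteq> 0"
    then obtain j where j: "j \<in> I" "j \<noteq> i" "c j \<noteq> 0" using single less.prems by blast
    obtain g where g: "g \<in> G" "lam g i \<noteq> lam g j" using sep less.prems j by blast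
    \<comment> \<open>Subtracting the eigenvalue at \<open>i\<close> removes \<open>i\<close> from
      the support and keeps \<open>j\<close>, because \<open>g\<close> separates the two.\<close>
    let ?c = "\<lambda>k. (lam g k - lam g i) * c k"
    have "{k \<in> I. ?c k \<noteq> 0} \<subseteq> {k \<in> I. c k \<noteq> 0} - {i}" by auto
    also have "\<dots> \<subset> {k \<in> I. c k \<noteq> 0}" using ci less.prems by auto
    finally have "card {k \<in> I. ?c k \<noteq> 0} < card {k \<in> I. c k \<noteq> 0}"
      using I by (intro psubset_card_mono) auto
    then have "?c j = 0" by (rule less.hyps) (use shift less.prems g j in auto)
    then show False using g j by simp
  qed
qed

text \<open>Gaussian elimination by induction on the equations: an unknown \<open>j\<close> that
  occurs in the new equation \<open>x\<close> is eliminated from the others; if no unknown occurs,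
  the new equation is vacuous.\<close>

lemma underdetermined_system:
  fixes v :: "'i \<Rightarrow> 'x \<Rightarrow> 'k::field"
  assumes "finite Y" "finite I" "card Y < card I"
  shows "\<exists>c. (\<exists>i\<in>I. c i \<noteq> 0) \<and> (\<forall>x\<in>Y. (\<Sum>i\<in>I. c i * v i x) = 0)"
  using assms
proof (induction Y arbitrary: I v rule: finite_induct)
  case empty
  then have "I \<noteq> {}" by auto
  then show ?case by (intro exI[of _ "\<lambda>_. 1"]) auto
next
  case (insert x Y)
  show ?case
  proof (cases "\<exists>j\<in>I. v j x \<noteq> 0")
    case False
    obtain c where "\<exists>i\<in>I. c i \<noteq> 0" "\<forall>x\<in>Y. (\<Sum>i\<in>I. c i * v i x) = 0"
      using insert.IH[of I v] insert.prems insert.hyps by auto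
    with False show ?thesis by (intro exI[of _ c]) auto
  next
    case True
    then obtain j where j: "j \<in> I" "v j x \<noteq> 0" by blast
    let ?I = "I - {j}"
    define w where "w i y = v i y - v i x / v j x * v j y" for i y
    have "card Y < card ?I" using insert j by auto
    then obtain c where c: "\<exists>i\<in>?I. c i \<noteq> 0" "\<forall>y\<in>Y. (\<Sum>i\<in>?I. c i * w i y) = 0"
      using insert.IH[of ?I w] insert.prems by auto
    define s where "s = (\<Sum>i\<in>?I. c i * v i x)"
    \<comment> \<open>The eliminated unknown is restored with the value that equation
      \<open>x\<close> prescribes.\<close>
    let ?d = "c(j := - s / v j x)"
    have split: "(\<Sum>i\<in>I. ?d i * v i y) = - s / v j x * v j y + (\<Sum>i\<in>?I. c i * v i y)" for y
      using j insert.prems by (subst sum.remove[of I j]) (auto intro: sum.cong)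
    have "(\<Sum>i\<in>?I. c i * w i y) = (\<Sum>i\<in>?I. c i * v i y) - s / v j x * v j y" for y
      unfolding s_def w_def sum_divide_distrib sum_distrib_right sum_subtractf[symmetric]
      by (intro sum.cong) (auto simp: algebra_simps)
    with split have "(\<Sum>i\<in>I. ?d i * v i y) = (\<Sum>i\<in>?I. c i * w i y)" for y by simp
    moreover have "(\<Sum>i\<in>?I. c i * w i x) = 0" using j by (simp add: w_def)
    ultimately have "\<forall>y\<in>insert x Y. (\<Sum>i\<in>I. ?d i * v i y) = 0" using c(2) by simp
    moreover have "\<exists>i\<in>I. ?d i \<noteq> 0" using c(1) by auto
    ultimately show ?thesis by blast
  qed
qed

lemma independent_family_card_le:
  fixes v :: "'i \<Rightarrow> 'x \<Rightarrow> 'k::field"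
  assumes "finite Y" "finite I"
    and ind: "\<And>c i. \<forall>x\<in>Y. (\<Sum>i\<in>I. c i * v i x) = 0 \<Longrightarrow> i \<in> I \<Longrightarrow> c i = 0"
  shows "card I \<le> card Y"
proof (rule ccontr)
  assume "\<not> ?thesis"
  then obtain c where c: "\<exists>i\<in>I. c i \<noteq> 0" "\<forall>x\<in>Y. (\<Sum>i\<in>I. c i * v i x) = 0"
    using underdetermined_system[OF assms(1,2), of v] by auto
  then show False using ind[of c] by blast
qed

text \<open>Adjoin \<open>w\<close> as one more vector, indexed by \<open>None\<close>: now there is
  a nontrivial relation, and independence of the others forces the coefficient of \<open>w\<close>
  to be nonzero.\<close>

lemma independent_family_spans:
  fixes v :: "'i \<Rightarrow> 'x \<Rightarrow> 'k::field"
  assumes Y: "finite Y" and I: "finite I" and card: "card Y = card I"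
    and ind: "\<And>c i. \<forall>x\<in>Y. (\<Sum>i\<in>I. c i * v i x) = 0 \<Longrightarrow> i \<in> I \<Longrightarrow> c i = 0"
  shows "\<exists>c. \<forall>x\<in>Y. w x = (\<Sum>i\<in>I. c i * v i x)"
proof -
  let ?J = "insert None (Some ` I)"
  have "card ?J = Suc (card I)" using I by (subst card_insert_disjoint) (auto simp: card_image)
  then obtain c where c: "\<exists>i\<in>?J. c i \<noteq> 0"
      "\<forall>x\<in>Y. (\<Sum>i\<in>?J. c i * (case i of None \<Rightarrow> w | Some i \<Rightarrow> v i) x) = 0"
    using underdetermined_system[OF Y, of ?J "\<lambda>i. case i of None \<Rightarrow> w | Some i \<Rightarrow> v i"] I card by auto
  have eq: "c None * w x + (\<Sum>i\<in>I. c (Some i) * v i x) = 0" if "x \<in> Y" for x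
    using c(2) that I by (subst (asm) sum.insert) (auto simp: sum.reindex)
  have none: "c None \<noteq> 0"
  proof
    assume 0: "c None = 0"
    then have "c (Some i) = 0" if "i \<in> I" for i
      using ind[of "\<lambda>i. c (Some i)"] eq that by simp
    with 0 c(1) show False by auto
  qed
  have "w x = (\<Sum>i\<in>I. (- c (Some i) / c None) * v i x)" if "x \<in> Y" for x
  proof -
    have "c None * w x = - (\<Sum>i\<in>I. c (Some i) * v i x)" using eq[OF that] by (simp add: eq_neg_iff_add_eq_0)
    then have "w x = - (\<Sum>i\<in>I. c (Some i) * v i x) / c None" using none by (simp add: field_simps)
    then show ?thesis by (simp add: sum_negf sum_divide_distrib)
  qed
  then show ?thesis by (intro exI[of _ "\<lambda>i. - c (Some i) / c None"] ballI)
qed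

section \<open>E and T inside q(E) and q(T)\<close>

type_synonym 'a closure = "'a center fract alg_closure"

definition emb :: "'a \<Rightarrow> 'a::ring_1_no_zero_divisors quotient_ring" where
  "emb a = fraction a 1"

lemma emb_simps:
  "emb (a + b) = emb a + emb b" "emb (a * b) = emb a * emb b" "emb 1 = 1"
  by (simp_all add: emb_def fraction_simps fraction_1_1)

lemma emb_eq_iff [simp]: "emb a = emb b \<longleftrightarrow> a = b"
  by (simp add: emb_def fraction_eq_iff)

lemma emb_0 [simp]: "emb 0 = 0"
  using emb_simps(1)[of 0 0] by simp

lemma emb_sum: "emb (sum f A) = (\<Sum>i\<in>A. emb (f i))"
  by (induction A rule: infinite_finite_induct) (simp_all add: emb_simps)

lemma quotient_scale_to_fract: "quotient_scale (to_fract t) (emb a) = emb (of_center t * a)"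
  by (simp add: quotient_scale_def emb_def to_fract_def of_center_fract_Fract fraction_simps)

lemma quotient_ring_cases:
  fixes x :: "'a::ring_1_no_zero_divisors quotient_ring"
  obtains a s where "s \<noteq> 0" "x = fraction a s"
proof -
  have "\<exists>a s. s \<noteq> 0 \<and> x = fraction a s"
  proof (transfer)
    fix x :: "'a \<times> 'a center"
    assume "fractions_rel x x"
    then show "\<exists>a s. s \<noteq> 0 \<and> fractions_rel x (if s = 0 then (0, 1) else (a, s))"
      by (intro exI[of _ "fst x"] exI[of _ "snd x"]) (auto simp: fractions_rel_def)
  qed
  with that show thesis by blast
qed

lemma fraction_conv_scale:
  fixes s :: "'a::ring_1_no_zero_divisors center"
  assumes "s \<noteq> 0"
  shows "fraction a s = quotient_scale (inverse (to_fract s)) (emb a)"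
proof -
  have "inverse (to_fract s) = Fract 1 s" by (simp add: to_fract_def)
  then show ?thesis
    using assms by (simp add: quotient_scale_def of_center_fract_Fract emb_def fraction_simps)
qed

lemma quotient_scale_mult_left: "quotient_scale c x * y = quotient_scale c (x * y)"
  by (simp add: quotient_scale_def mult.assoc)

lemma quotient_scale_mult_right: "x * quotient_scale c y = quotient_scale c (x * y)"
proof -
  obtain t s where c: "c = Fract t s" "s \<noteq> 0" by (cases c)
  obtain a r where x: "x = fraction a r" "r \<noteq> 0" using quotient_ring_cases by blast
  have "x * of_center_fract c = of_center_fract c * x"
    using c x by (simp add: of_center_fract_Fract fraction_simps of_center_commute mult.commute)
  then show ?thesis by (simp add: quotient_scale_def mult.assoc[symmetric])
qed

text \<open>The inclusions of T into q(T) and, with \<open>iota\<close>, into its algebraic closure,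
  written as functions on all of E; they are meaningful only on \<open>range of_center\<close>,
  since \<open>to_center\<close> is unspecified elsewhere.\<close>

definition tf :: "'a \<Rightarrow> 'a::ring_1_no_zero_divisors center fract" where
  "tf x = to_fract (to_center x)"

definition iota :: "'a \<Rightarrow> 'a::ring_1_no_zero_divisors closure" where
  "iota x = to_ac (tf x)"

lemma of_center_to_center: "x \<in> range of_center \<Longrightarrow> of_center (to_center x) = x"
  by (auto simp: of_center_inverse)

lemma to_center_of_center [simp]: "to_center (of_center t) = t"
  by (rule of_center_inverse)

lemma tf_hom:
  assumes "x \<in> range of_center" "y \<in> range of_center"
  shows tf_mult: "tf (x * y) = tf x * tf y"
    and tf_add: "tf (x + y) = tf x + tf y"
    and tf_eq_iff: "tf x = tf y \<longleftrightarrow> x = y"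
proof -
  obtain s t where st: "x = of_center s" "y = of_center t" using assms by blast
  have "x * y = of_center (s * t)" "x + y = of_center (s + t)" using st by simp_all
  then show "tf (x * y) = tf x * tf y" "tf (x + y) = tf x + tf y"
    using st by (simp_all only: tf_def to_center_of_center to_fract_mult to_fract_add)
  show "tf x = tf y \<longleftrightarrow> x = y" using st by (simp add: tf_def of_center_inject)
qed

lemma tf_0_1 [simp]: "tf 0 = 0" "tf 1 = 1"
proof -
  have "tf (of_center 0) = 0" "tf (of_center 1) = 1"
    by (simp_all only: tf_def to_center_of_center to_fract_0 to_fract_1)
  then show "tf 0 = 0" "tf 1 = 1" by simp_all
qed

lemma central_closed:
  "(0::'a::ring_1_no_zero_divisors) \<in> range of_center" "(1::'a) \<in> range of_center"
  "x \<in> range of_center \<Longrightarrow> y \<in> range of_center \<Longrightarrow> (x::'a) * y \<in> range of_center"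
  "x \<in> range of_center \<Longrightarrow> y \<in> range of_center \<Longrightarrow> (x::'a) + y \<in> range of_center"
  "x \<in> range of_center \<Longrightarrow> - (x::'a) \<in> range of_center"
  "x \<in> range of_center \<Longrightarrow> (x::'a) ^ k \<in> range of_center"
proof -
  show 0: "(0::'a) \<in> range of_center" and 1: "(1::'a) \<in> range of_center"
    by (metis of_center_simps(1) rangeI, metis of_center_simps(2) rangeI)
  show m: "x * y \<in> range of_center" if "x \<in> range of_center" "y \<in> range of_center" for x y :: 'a
    using that by (metis (no_types, lifting) of_center_simps(5) rangeE rangeI)
  show "x + y \<in> range of_center" if "x \<in> range of_center" "y \<in> range of_center" for x y :: 'a
    using that by (metis (no_types, lifting) of_center_simps(3) rangeE rangeI)
  show "- x \<in> range of_center" if "x \<in> range of_center" for x :: 'a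
    using that by (metis (no_types, lifting) of_center_simps(4) rangeE rangeI)
  show "x ^ k \<in> range of_center" if "x \<in> range of_center" for x :: 'a
    by (induction k) (use that m 1 in auto)
qed

lemma tf_uminus:
  assumes "x \<in> range of_center"
  shows "tf (- x) = - tf x"
proof -
  have "tf x + tf (- x) = 0" using tf_add[OF assms central_closed(5)[OF assms]] by simp
  then show ?thesis by (metis minus_unique)
qed

lemma tf_power: "x \<in> range of_center \<Longrightarrow> tf (x ^ k) = tf x ^ k"
  by (induction k) (simp_all add: tf_mult central_closed)

lemma
  assumes "x \<in> range of_center" "y \<in> range of_center"
  shows iota_mult: "iota (x * y) = iota x * iota y"
    and iota_eq_iff: "iota x = iota y \<longleftrightarrow> x = y"
  using assms by (simp_all add: iota_def tf_hom)

lemma iota_0_1 [simp]: "iota 0 = 0" "iota 1 = 1"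
  by (simp_all add: iota_def)

lemma iota_uminus: "x \<in> range of_center \<Longrightarrow> iota (- x) = - iota x"
  by (simp add: iota_def tf_uminus)

lemma iota_power: "x \<in> range of_center \<Longrightarrow> iota (x ^ k) = iota x ^ k"
  by (simp add: iota_def tf_power)

lemma scale_tf: "z \<in> range of_center \<Longrightarrow> quotient_scale (tf z) (emb a) = emb (z * a)"
  by (simp add: tf_def quotient_scale_to_fract of_center_to_center)

locale totally_ramified_basis = totally_ramified_algebra \<Gamma> E
  for \<Gamma> :: "('g, 'h) monoid_scheme" (structure) and E :: "'g \<Rightarrow> 'a::ring_1_no_zero_divisors set" +
  fixes B :: "'a set" and n :: nat
  assumes B_homogeneous: "B \<subseteq> homogeneous \<Gamma> E"
    and B_independent: "\<not> center.dependent B"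
    and B_span: "center.span B = UNIV"
    and B_finite: "finite B"
    and B_card: "card B = n\<^sup>2"
begin

lemma Z_range [simp]: "z \<in> Z \<Longrightarrow> z \<in> range of_center"
  by (simp add: Z_def)

lemma B_U: "b \<in> B \<Longrightarrow> b \<in> Eu"
proof -
  assume b: "b \<in> B"
  have "0 \<notin> B" using B_independent center.dependent_zero[of B] by blast
  then show "b \<in> Eu" using b B_homogeneous unfolding unit_group_def by auto
qed

lemma n_pos: "n > 0"
proof (rule ccontr)
  assume "\<not> ?thesis"
  then have "B = {}" using B_card B_finite by simp
  then have "UNIV = {0::'a}" using B_span by simp
  then show False by (metis UNIV_I singletonD zero_neq_one)
qed

text \<open>\<open>b' - z * b = 0\<close> would be a linear relation over T. So distinct elements of
  \<open>B\<close> lie in distinct cosets of T^*.\<close>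

lemma basis_inequivalent:
  assumes "b \<in> B" "b' \<in> B" "z \<in> Z" "b' = z * b"
  shows "b' = b"
proof (rule ccontr)
  assume ne: "b' \<noteq> b"
  define c where "c x = (if x = b then - to_center z else (1 :: 'a center))" for x
  have "(\<Sum>x\<in>{b, b'}. center_scale (c x) x) = 0"
    using ne assms by (simp add: c_def center_scale_def of_center_to_center)
  then have "c b' = 0"
    using center.independentD[OF B_independent, of "{b, b'}"] assms by blast
  then show False using ne by (simp add: c_def)
qed

lemma cm_scale: "g \<in> Eu \<Longrightarrow> u \<in> Eu \<Longrightarrow> cm g u * u = g * u * iv g"
  by (simp add: cm_def)

text \<open>The quotient of \<open>u\<close> by \<open>b\<close> pairs trivially with everything, so
  it lies in the radical.\<close>

lemma cm_eq_quotient_Z: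
  assumes "u \<in> Eu" "b \<in> Eu" "\<And>g. g \<in> Eu \<Longrightarrow> cm g u = cm g b"
  shows "u * iv b \<in> Z"
proof -
  have "cm g (u * iv b) = 1" if "g \<in> Eu" for g
    using assms that by (simp add: cm_mult_right cm_inverse_right)
  then show ?thesis using assms Z_iff_cm[of "u * iv b"] by simp
qed

text \<open>Conjugation by a unit multiplies \<open>u\<close> and every basis element by central scalars; so a basis
  element occurring in \<open>u\<close> has the same commutators as \<open>u\<close>.\<close>

lemma basis_representative:
  assumes u: "u \<in> Eu"
  shows "\<exists>b\<in>B. u * iv b \<in> Z"
proof -
  have "u \<in> center.span B" using B_span by simp
  then obtain r where r: "u = (\<Sum>b\<in>B. center_scale (r b) b)"
    using center.sum_representation_eq[OF B_independent _ B_finite order_refl] by metis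
  have eq: "cm g u * of_center (r b) = cm g b * of_center (r b)" if g: "g \<in> Eu" and b: "b \<in> B" for g b
  proof -
    have "(\<Sum>b\<in>B. center_scale (to_center (cm g u) * r b - to_center (cm g b) * r b) b)
        = (\<Sum>b\<in>B. cm g u * (of_center (r b) * b) - of_center (r b) * (cm g b * b))"
    proof (rule sum.cong[OF refl])
      fix b assume b: "b \<in> B"
      have oc: "of_center (to_center (cm g u)) = cm g u" "of_center (to_center (cm g b)) = cm g b"
        using g u B_U[OF b] by (simp_all add: of_center_to_center)
      have "center_scale (to_center (cm g u) * r b - to_center (cm g b) * r b) b
        = cm g u * of_center (r b) * b - cm g b * of_center (r b) * b"
        by (simp only: center.scale_left_diff_distrib, simp only: center_scale_def of_center_simps oc)
      also have "cm g b * of_center (r b) = of_center (r b) * cm g b"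
        by (metis of_center_commute)
      finally show "center_scale (to_center (cm g u) * r b - to_center (cm g b) * r b) b
        = cm g u * (of_center (r b) * b) - of_center (r b) * (cm g b * b)"
        by (simp add: mult.assoc)
    qed
    also have "\<dots> = cm g u * u - g * u * iv g"
    proof -
      have "g * u * iv g = (\<Sum>b\<in>B. of_center (r b) * (cm g b * b))"
      proof -
        have "g * u * iv g = (\<Sum>b\<in>B. g * center_scale (r b) b * iv g)"
          by (subst r) (simp only: sum_distrib_left sum_distrib_right)
        also have "\<dots> = (\<Sum>b\<in>B. of_center (r b) * (cm g b * b))"
          by (rule sum.cong[OF refl])
            (simp only: center_scale_def center_left_commute[of g] cm_scale[OF g B_U] mult.assoc)
        finally show ?thesis .
      qed
      moreover have "cm g u * u = (\<Sum>b\<in>B. cm g u * (of_center (r b) * b))"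
        by (subst (2) r) (simp add: sum_distrib_left center_scale_def)
      ultimately show ?thesis by (simp add: sum_subtractf)
    qed
    also have "\<dots> = 0" using g u by (simp add: cm_scale)
    finally have "to_center (cm g u) * r b - to_center (cm g b) * r b = 0"
      by (rule center.independentD[OF B_independent B_finite order_refl _ b])
    then have "of_center (to_center (cm g u) * r b) = of_center (to_center (cm g b) * r b)"
      by (simp only: right_minus_eq)
    then show ?thesis using g u B_U[OF b] by (simp add: of_center_to_center)
  qed
  obtain b where b: "b \<in> B" "r b \<noteq> 0"
  proof -
    have "\<exists>b\<in>B. r b \<noteq> 0"
    proof (rule ccontr)
      assume "\<not> ?thesis"
      then have "u = 0" by (subst r) simp
      then show False using U_nonzero[OF u] by simp
    qed
    with that show thesis by blast
  qed
  have "cm g u = cm g b" if "g \<in> Eu" for g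
    using eq[OF that b(1)] b(2) by simp
  then show ?thesis using cm_eq_quotient_Z[OF u B_U[OF b(1)]] b(1) by blast
qed

lemma basis_separated:
  assumes "b \<in> B" "b' \<in> B" "b \<noteq> b'"
  shows "\<exists>g\<in>Eu. cm g b \<noteq> cm g b'"
proof (rule ccontr)
  assume "\<not> ?thesis"
  then have "b' * iv b \<in> Z" using cm_eq_quotient_Z[of b' b] B_U assms by auto
  moreover have "b' = (b' * iv b) * b" using B_U assms by simp
  ultimately show False using basis_inequivalent assms by blast
qed

lemma inj_emb: "inj_on emb A"
  by (auto intro: inj_onI)

text \<open>Conjugation by \<open>emb g\<close> is linear over q(T) and acts on \<open>emb b\<close>
  by the scalar \<open>tf (cm g b)\<close>, so it turns relations into relations; by
  \<open>basis_separated\<close> these scalars tell the elements of \<open>B\<close> apart. A single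
  \<open>emb b\<close> is nonzero because \<open>emb\<close> is injective.\<close>

lemma quotient_basis_coefficients:
  assumes "(\<Sum>b\<in>B. quotient_scale (c b) (emb b)) = 0" "b \<in> B"
  shows "c b = 0"
proof (rule eigenfamily_independent[where I = B and G = "Eu" and lam = "\<lambda>g b. tf (cm g b)"
      and S = "{c. (\<Sum>b\<in>B. quotient_scale (c b) (emb b)) = 0}"])
  fix c g a assume c: "c \<in> {c. (\<Sum>b\<in>B. quotient_scale (c b) (emb b)) = 0}" and g: "g \<in> Eu"
  have "emb g * (\<Sum>b\<in>B. quotient_scale (c b) (emb b)) * emb (iv g)
      = (\<Sum>b\<in>B. quotient_scale (tf (cm g b) * c b) (emb b))"
    unfolding sum_distrib_left sum_distrib_right
  proof (rule sum.cong[OF refl])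
    fix b assume b: "b \<in> B"
    have "emb g * quotient_scale (c b) (emb b) * emb (iv g) = quotient_scale (c b) (emb (g * b * iv g))"
      by (simp add: quotient_scale_mult_left quotient_scale_mult_right emb_simps)
    also have "\<dots> = quotient_scale (c b) (quotient_scale (tf (cm g b)) (emb b))"
      using g B_U[OF b] by (simp add: scale_tf cm_scale)
    finally show "emb g * quotient_scale (c b) (emb b) * emb (iv g) = quotient_scale (tf (cm g b) * c b) (emb b)"
      by (simp add: mult.commute)
  qed
  then have "(\<Sum>b\<in>B. quotient_scale (tf (cm g b) * c b) (emb b)) = 0" using c by simp
  moreover have "(\<Sum>b\<in>B. quotient_scale ((tf (cm g b) - a) * c b) (emb b))
    = (\<Sum>b\<in>B. quotient_scale (tf (cm g b) * c b) (emb b)) - quotient_scale a (\<Sum>b\<in>B. quotient_scale (c b) (emb b))"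
    by (simp add: quotient.scale_sum_right sum_subtractf[symmetric] left_diff_distrib quotient.scale_left_diff_distrib)
  ultimately show "(\<lambda>i. (tf (cm g i) - a) * c i) \<in> {c. (\<Sum>b\<in>B. quotient_scale (c b) (emb b)) = 0}"
    using c by simp
next
  fix b b' assume "b \<in> B" "b' \<in> B" "b \<noteq> b'"
  then show "\<exists>g\<in>Eu. tf (cm g b) \<noteq> tf (cm g b')"
    using basis_separated B_U by (simp add: tf_eq_iff)
next
  fix c b assume c: "c \<in> {c. (\<Sum>b\<in>B. quotient_scale (c b) (emb b)) = 0}" and b: "b \<in> B"
    and z: "\<And>b'. b' \<in> B \<Longrightarrow> b' \<noteq> b \<Longrightarrow> c b' = 0"
  have "(\<Sum>b\<in>B. quotient_scale (c b) (emb b)) = quotient_scale (c b) (emb b)"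
    using b z B_finite by (subst sum.remove[OF B_finite b]) (auto intro!: sum.neutral)
  then have "quotient_scale (c b) (emb b) = 0" using c by simp
  moreover have "emb b \<noteq> 0" using U_nonzero[OF B_U[OF b]] by (metis emb_0 emb_eq_iff)
  ultimately show "c b = 0" by simp
qed (use assms B_finite in auto)

lemma quotient_basis_independent: "\<not> quotient.dependent (emb ` B)"
proof (rule quotient.independent_if_scalars_zero)
  fix f :: "'a quotient_ring \<Rightarrow> 'a center fract" and x
  assume s: "(\<Sum>x\<in>emb ` B. quotient_scale (f x) x) = 0" and "x \<in> emb ` B"
  then obtain b where b: "b \<in> B" "x = emb b" by blast
  have "(\<Sum>b\<in>B. quotient_scale (f (emb b)) (emb b)) = 0"
    using s by (simp add: sum.reindex[OF inj_emb])
  then show "f x = 0" using quotient_basis_coefficients[of "\<lambda>b. f (emb b)"] b by simp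
qed (use B_finite in simp)

lemma quotient_basis_span: "quotient.span (emb ` B) = UNIV"
proof (rule UNIV_eq_I[symmetric])
  fix x :: "'a quotient_ring"
  obtain a s where x: "s \<noteq> 0" "x = fraction a s" by (rule quotient_ring_cases)
  have "a \<in> center.span B" using B_span by simp
  then obtain r where r: "a = (\<Sum>b\<in>B. center_scale (r b) b)"
    using center.sum_representation_eq[OF B_independent _ B_finite order_refl] by metis
  have "emb a = (\<Sum>b\<in>B. quotient_scale (to_fract (r b)) (emb b))"
    by (subst r) (simp add: emb_sum center_scale_def quotient_scale_to_fract)
  also have "\<dots> \<in> quotient.span (emb ` B)"
    by (intro quotient.span_sum quotient.span_scale quotient.span_base) auto
  finally show "x \<in> quotient.span (emb ` B)"
    using x by (simp add: fraction_conv_scale quotient.span_scale)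
qed

lemma quotient_dim: "quotient.dim (UNIV :: 'a quotient_ring set) = n\<^sup>2"
proof -
  have "quotient.dim (UNIV :: 'a quotient_ring set) = card (emb ` B)"
    using quotient.dim_eq_card[OF _ quotient_basis_independent, of UNIV] quotient_basis_span by simp
  then show ?thesis by (simp add: card_image[OF inj_emb] B_card)
qed

end

section \<open>A splitting of the quotient ring\<close>

context totally_ramified_basis
begin

text \<open>Pigeonhole: every power of \<open>u\<close> lies in one of the finitely many cosets of
  T^* represented by \<open>B\<close>.\<close>

lemma power_central:
  assumes u: "u \<in> Eu"
  shows "\<exists>k>0. u ^ k \<in> Z"
proof -
  define f where "f i = (SOME b. b \<in> B \<and> u ^ i * iv b \<in> Z)" for i :: nat
  have f: "f i \<in> B" "u ^ i * iv (f i) \<in> Z" for i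
    using someI_ex[of "\<lambda>b. b \<in> B \<and> u ^ i * iv b \<in> Z"] basis_representative[of "u ^ i"] u
    unfolding f_def by (auto simp: U_power)
  have "finite (range f)" using f(1) B_finite by (meson finite_subset image_subsetI)
  then have "\<not> inj f" using finite_imageD[of f UNIV] by auto
  then obtain i j where ij: "f i = f j" "i < j" by (metis injI linorder_neqE_nat)
  have "u ^ j * iv (f j) * iv (u ^ i * iv (f i)) \<in> Z"
    by (rule Z_mult[OF f(2) Z_inverse[OF f(2)]])
  moreover have "u ^ j * iv (f j) * iv (u ^ i * iv (f i)) = u ^ j * iv (u ^ i)"
    using B_U[OF f(1)] u by (simp add: units.inv_mult_group ij U_power mult.assoc)
  moreover have "u ^ j = u ^ (j - i) * u ^ i" using ij by (simp add: power_add[symmetric])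
  ultimately have "u ^ (j - i) \<in> Z" using u by (simp add: U_power)
  then show ?thesis using ij by (intro exI[of _ "j - i"]) auto
qed

text \<open>Graphs of characters of commutative subgroups extending \<open>iota\<close> on \<open>T\<^sup>*\<close>, so that Zorn applies to inclusion.\<close>

definition partial_character :: "('a \<times> 'a closure) set \<Rightarrow> bool" where
  "partial_character G \<longleftrightarrow>
     (\<forall>z\<in>Z. (z, iota z) \<in> G) \<and> (\<forall>a x. (a, x) \<in> G \<longrightarrow> a \<in> Eu \<and> x \<noteq> 0)
     \<and> (\<forall>a x b y. (a, x) \<in> G \<longrightarrow> (b, y) \<in> G \<longrightarrow> (a * b, x * y) \<in> G \<and> a * b = b * a)
     \<and> (\<forall>a x. (a, x) \<in> G \<longrightarrow> (iv a, inverse x) \<in> G) \<and> (\<forall>x. (1, x) \<in> G \<longrightarrow> x = 1)"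

lemma partial_characterD:
  assumes "partial_character G"
  shows "z \<in> Z \<Longrightarrow> (z, iota z) \<in> G" "(a, x) \<in> G \<Longrightarrow> a \<in> Eu" "(a, x) \<in> G \<Longrightarrow> x \<noteq> 0"
    "(a, x) \<in> G \<Longrightarrow> (b, y) \<in> G \<Longrightarrow> (a * b, x * y) \<in> G" 
    "(a, x) \<in> G \<Longrightarrow> (b, y) \<in> G \<Longrightarrow> a * b = b * a" 
    "(a, x) \<in> G \<Longrightarrow> (iv a, inverse x) \<in> G" "(1, x) \<in> G \<Longrightarrow> x = 1"
  using assms unfolding partial_character_def by blast+

lemma partial_character_power:
  assumes "partial_character G" "(a, x) \<in> G"
  shows "(a ^ k, x ^ (k::nat)) \<in> G"
proof (induction k)
  case 0
  then show ?case using partial_characterD(1)[OF assms(1), of 1] by simp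
next
  case (Suc k)
  then show ?case using partial_characterD(4)[OF assms(1,2) Suc] by simp
qed

lemma partial_character_base: "partial_character ((\<lambda>z. (z, iota z)) ` Z)"
  unfolding partial_character_def
proof (intro conjI allI impI ballI)
  fix a x b y
  assume a: "(a, x) \<in> (\<lambda>z. (z, iota z)) ` Z"
  then show "a \<in> Eu" by (auto simp: Z_U)
  have az: "a \<in> Z" "x = iota a" using a by auto
  show "x \<noteq> 0" using az iota_eq_iff[of a 0] U_nonzero[OF Z_U] central_closed(1) by auto
  have "iota (iv a) * iota a = 1"
    using az by (simp add: iota_mult[symmetric] Z_inverse Z_U)
  then have "iota (iv a) = inverse x" using az by (metis inverse_unique mult.commute)
  then show "(iv a, inverse x) \<in> (\<lambda>z. (z, iota z)) ` Z" using az Z_inverse by (metis image_eqI)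
  assume "(b, y) \<in> (\<lambda>z. (z, iota z)) ` Z"
  then have bz: "b \<in> Z" "y = iota b" by auto
  show "(a * b, x * y) \<in> (\<lambda>z. (z, iota z)) ` Z"
    using az bz by (auto simp: iota_mult Z_mult intro!: image_eqI[of _ _ "a * b"])
  show "a * b = b * a" by (rule Z_commute[OF az(1)])
qed auto

lemma partial_character_Union:
  assumes "\<C> \<noteq> {}" "subset.chain (Collect partial_character) \<C>"
  shows "partial_character (\<Union>\<C>)"
proof -
  have pc: "partial_character G" if "G \<in> \<C>" for G
    using assms(2) that by (auto simp: subset_chain_def)
  have common: "\<exists>G\<in>\<C>. u \<in> G \<and> v \<in> G" if uv: "u \<in> \<Union>\<C>" "v \<in> \<Union>\<C>" for u v
  proof -
    obtain G G' where "G \<in> \<C>" "G' \<in> \<C>" "u \<in> G" "v \<in> G'" using uv by blast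
    moreover have "G \<subseteq> G' \<or> G' \<subseteq> G"
      using assms(2) \<open>G \<in> \<C>\<close> \<open>G' \<in> \<C>\<close> by (auto simp: subset_chain_def)
    ultimately show ?thesis by blast
  qed
  show ?thesis
    unfolding partial_character_def
  proof (intro conjI allI impI ballI)
    show "(z, iota z) \<in> \<Union>\<C>" if "z \<in> Z" for z
      using assms(1) pc partial_characterD(1)[OF _ that] by blast
    show "x = 1" if "(1, x) \<in> \<Union>\<C>" for x
      using pc partial_characterD(7) that by blast
    fix a x b y
    assume a: "(a, x) \<in> \<Union>\<C>"
    show "a \<in> Eu" "x \<noteq> 0" "(iv a, inverse x) \<in> \<Union>\<C>"
      using a pc partial_characterD(2,3,6) by blast+
    assume b: "(b, y) \<in> \<Union>\<C>"
    obtain G where G: "G \<in> \<C>" "(a, x) \<in> G" "(b, y) \<in> G" using common[OF a b] by blast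
    show "(a * b, x * y) \<in> \<Union>\<C>" "a * b = b * a"
      using partial_characterD(4,5)[OF pc[OF G(1)] G(2,3)] G(1) by blast+
  qed
qed

lemma commute_power: "a * h = h * (a::'a) \<Longrightarrow> a ^ i * h = h * a ^ (i::nat)"
  by (induction i) (simp_all add: mult.assoc, metis mult.assoc)

text \<open>Let \<open>k\<close> be the least positive exponent with \<open>a ^ k\<close> in the
  domain of \<open>G\<close>, and \<open>w\<close> its value. The values lie in an algebraically
  closed field, so \<open>w\<close> has a k-th root \<open>l\<close>; sending \<open>a\<close> to
  \<open>l\<close> extends \<open>G\<close>, and minimality of \<open>k\<close> makes the extension
  single-valued.\<close>

lemma partial_character_extend:
  assumes G: "partial_character G" and a: "a \<in> Eu"
    and comm: "\<And>h x. (h, x) \<in> G \<Longrightarrow> a * h = h * a"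
  shows "\<exists>G' x. partial_character G' \<and> G \<subseteq> G' \<and> (a, x) \<in> G'"
proof -
  note D = partial_characterD[OF G]
  let ?P = "\<lambda>k::nat. k > 0 \<and> (\<exists>w. (a ^ k, w) \<in> G)"
  define k where "k = (LEAST k. ?P k)"
  obtain k0 where "k0 > 0" "a ^ k0 \<in> Z" using power_central[OF a] by blast
  then have "\<exists>k. ?P k" using D(1)[of "a ^ k0"] by blast
  then have "?P k" unfolding k_def by (rule LeastI_ex)
  then obtain w where k: "k > 0" "(a ^ k, w) \<in> G" by blast
  have min: "\<not> ?P j" if "j < k" for j
    using not_less_Least[of j ?P] that unfolding k_def by blast
  obtain l where l: "l ^ k = w" using nth_root_exists[OF k(1)] by blast
  have w0: "w \<noteq> 0" using D(3) k by blast
  then have l0: "l \<noteq> 0" using l k by auto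
  let ?G = "{(a ^ i * h, l ^ i * x) | (i::nat) h x. (h, x) \<in> G}"
  have commp: "h * a ^ i = a ^ i * h" if "(h, x) \<in> G" for h x and i :: nat
    using commute_power[of a h i] comm[OF that] by simp
  have sub: "(h, x) \<in> ?G" if "(h, x) \<in> G" for h x
    using that by (intro CollectI exI[of _ "0::nat"] exI[of _ h] exI[of _ x]) simp
  have "(1, 1) \<in> G" using D(1)[of 1] by simp
  then have "(a, l) \<in> ?G"
    by (intro CollectI exI[of _ "1::nat"] exI[of _ 1] exI[of _ 1]) simp
  have "partial_character ?G"
    unfolding partial_character_def
  proof (intro conjI allI impI ballI)
    show "(z, iota z) \<in> ?G" if "z \<in> Z" for z using sub D(1)[OF that] by blast
    fix u x v y
    assume u: "(u, x) \<in> ?G"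
    then obtain i g s where i: "u = a ^ i * g" "x = l ^ i * s" "(g, s) \<in> G" by blast
    have gU: "g \<in> Eu" by (rule D(2)[OF i(3)])
    show "u \<in> Eu" unfolding i(1) using gU a by (simp add: U_power)
    show "x \<noteq> 0" unfolding i(2) using D(3)[OF i(3)] l0 by simp
    \<comment> \<open>Only nonnegative powers of \<open>a\<close> occur in \<open>?G\<close>. Since
      \<open>a ^ (k * i)\<close> lies in the old domain, \<open>a ^ (i * (k - 1))\<close> replaces
      the inverse of \<open>a ^ i\<close> up to an element of that domain.\<close>
    let ?j = "i * (k - 1)"
    have sum: "?j + i = k * i" using k(1) by (cases k) auto
    have "a ^ ?j = (a ^ k) ^ i * iv (a ^ i)"
    proof -
      have "a ^ ?j * a ^ i = a ^ (k * i)" by (simp only: power_add[symmetric] sum)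
      then have "a ^ ?j * a ^ i = (a ^ k) ^ i" by (simp only: power_mult)
      then have "a ^ ?j * a ^ i * iv (a ^ i) = (a ^ k) ^ i * iv (a ^ i)" by (rule arg_cong)
      then show ?thesis by (simp only: iv_cancel(3)[OF U_power[OF a]])
    qed
    moreover have "(a ^ k) ^ i * iv (a ^ i) = iv (a ^ i) * (a ^ k) ^ i"
    proof -
      have "a ^ i * (a ^ k) ^ i = (a ^ k) ^ i * a ^ i"
        by (simp only: power_mult[symmetric] power_add[symmetric] add.commute)
      then have "iv (a ^ i) * (a ^ i * (a ^ k) ^ i) * iv (a ^ i) = iv (a ^ i) * ((a ^ k) ^ i * a ^ i) * iv (a ^ i)"
        by simp
      then show ?thesis using a by (simp add: U_power mult.assoc)
    qed
    ultimately have aj: "a ^ ?j = iv (a ^ i) * (a ^ k) ^ i" by simp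
    have inv_mem: "(iv g * iv ((a ^ k) ^ i), inverse s * inverse (w ^ i)) \<in> G"
      by (intro D(4) D(6) i partial_character_power[OF G] k)
    have "iv u = iv g * iv (a ^ i)" using i gU a by (simp add: units.inv_mult_group U_power)
    also have "\<dots> = iv g * (a ^ ?j * iv ((a ^ k) ^ i))" using aj a by (simp add: U_power)
    also have "\<dots> = a ^ ?j * (iv g * iv ((a ^ k) ^ i))"
      using commp[OF D(6)[OF i(3)]] by (simp add: mult.assoc[symmetric])
    finally have 1: "iv u = a ^ ?j * (iv g * iv ((a ^ k) ^ i))" .
    have "l ^ ?j * l ^ i = l ^ (k * i)" by (simp only: power_add[symmetric] sum)
    then have "l ^ ?j * l ^ i = w ^ i" by (simp only: power_mult l)
    then have "l ^ ?j = w ^ i * inverse (l ^ i)"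
      using l0 by (simp only: eq_divide_eq[symmetric] divide_inverse[symmetric] power_not_zero
          nonzero_eq_divide_eq not_False_eq_True)
    moreover have "w ^ i * inverse (w ^ i) = 1" using w0 by simp
    ultimately have 2: "inverse x = l ^ ?j * (inverse s * inverse (w ^ i))"
      by (simp only: i(2) inverse_mult_distrib mult_ac) (simp add: mult.assoc[symmetric])
    show "(iv u, inverse x) \<in> ?G" unfolding 1 2
      using inv_mem by (intro CollectI exI conjI) (rule refl)
    assume v: "(v, y) \<in> ?G"
    then obtain j h t where j: "v = a ^ j * h" "y = l ^ j * t" "(h, t) \<in> G" by blast
    have uv: "u * v = a ^ (i + j) * (g * h)"
    proof -
      have "u * v = a ^ i * (g * a ^ j) * h" by (simp only: i(1) j(1) mult.assoc)
      also have "\<dots> = a ^ i * (a ^ j * g) * h" by (simp only: commp[OF i(3)])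
      finally show ?thesis by (simp only: power_add mult.assoc)
    qed
    have vu: "v * u = a ^ (j + i) * (h * g)"
    proof -
      have "v * u = a ^ j * (h * a ^ i) * g" by (simp only: i(1) j(1) mult.assoc)
      also have "\<dots> = a ^ j * (a ^ i * h) * g" by (simp only: commp[OF j(3)])
      finally show ?thesis by (simp only: power_add mult.assoc)
    qed
    show "u * v = v * u" unfolding uv vu using D(5)[OF i(3) j(3)] by (simp add: add.commute)
    have xy: "x * y = l ^ (i + j) * (s * t)" by (simp add: i j power_add)
    show "(u * v, x * y) \<in> ?G" unfolding uv xy
      using D(4)[OF i(3) j(3)] by (intro CollectI exI conjI) (rule refl)
  next
    fix x assume "(1, x) \<in> ?G"
    then obtain i g s where i: "1 = a ^ i * g" "x = l ^ i * s" "(g, s) \<in> G" by blast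
    have gU: "g \<in> Eu" using D(2) i by blast
    have ai: "a ^ i = iv g"
      using iv_cancel(3)[OF gU, of "a ^ i"] by (simp only: i(1)[symmetric] mult_1_left)
    \<comment> \<open>Here \<open>a ^ i\<close> lies in the old domain, hence so does
      \<open>a ^ (i mod k)\<close>; minimality of \<open>k\<close> leaves
      \<open>i mod k = 0\<close>, and the claim reduces to the one for \<open>G\<close>.\<close>
    have "a ^ i = (a ^ k) ^ (i div k) * a ^ (i mod k)"
      unfolding power_mult[symmetric] power_add[symmetric] by simp
    then have "a ^ (i mod k) = iv ((a ^ k) ^ (i div k)) * iv g"
      using iv_cancel(1)[of "(a ^ k) ^ (i div k)" "a ^ (i mod k)"] ai a by (simp add: U_power)
    moreover have "(iv ((a ^ k) ^ (i div k)) * iv g, inverse (w ^ (i div k)) * inverse s) \<in> G"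
      by (intro D(4) D(6) i partial_character_power[OF G] k)
    ultimately have "i mod k = 0" using min[of "i mod k"] k(1) by auto
    then have ki: "i = k * (i div k)" by auto
    have "(a ^ i, w ^ (i div k)) \<in> G"
      by (subst ki, subst power_mult) (rule partial_character_power[OF G k(2)])
    from D(4)[OF this i(3)] have "(1, w ^ (i div k) * s) \<in> G" by (simp only: i(1)[symmetric])
    then have "w ^ (i div k) * s = 1" by (rule D(7))
    moreover have "l ^ i = w ^ (i div k)" by (subst ki, subst power_mult) (simp add: l)
    ultimately show "x = 1" using i by simp
  qed
  moreover have "G \<subseteq> ?G" by (rule subrelI) (rule sub)
  ultimately show ?thesis using \<open>(a, l) \<in> ?G\<close>
    by (intro exI[of _ ?G] exI[of _ l] conjI)
qed

text \<open>Zorn gives a maximal \<open>G\<close>; it is the graph of a function because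
  \<open>(1, x)\<close> in \<open>G\<close> forces \<open>x = 1\<close>. An \<open>a\<close>
  commuting with the whole domain could be adjoined by \<open>partial_character_extend\<close>, so
  \<open>H\<close> is its own centralizer in E^*.\<close>

lemma maximal_character_exists:
  obtains H and chi :: "'a \<Rightarrow> 'a closure"
  where "Z \<subseteq> H" "H \<subseteq> Eu" "\<And>g h. g \<in> H \<Longrightarrow> h \<in> H \<Longrightarrow> g * h \<in> H"
    "\<And>g. g \<in> H \<Longrightarrow> iv g \<in> H"
    "\<And>a. a \<in> Eu \<Longrightarrow> (\<And>h. h \<in> H \<Longrightarrow> a * h = h * a) \<Longrightarrow> a \<in> H"
    "\<And>g h. g \<in> H \<Longrightarrow> h \<in> H \<Longrightarrow> chi (g * h) = chi g * chi h"
    "\<And>z. z \<in> Z \<Longrightarrow> chi z = iota z"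
proof -
  have "\<exists>M\<in>Collect partial_character. \<forall>N\<in>Collect partial_character. M \<subseteq> N \<longrightarrow> N = M"
    by (rule subset_Zorn_nonempty) (use partial_character_base partial_character_Union in auto)
  then obtain G where G: "partial_character G" and max: "\<And>N. partial_character N \<Longrightarrow> G \<subseteq> N \<Longrightarrow> N = G"
    by auto
  note D = partial_characterD[OF G]
  define chi where "chi a = (SOME x. (a, x) \<in> G)" for a
  have fn: "x = y" if "(a, x) \<in> G" "(a, y) \<in> G" for a x y
  proof -
    have "(a * iv a, x * inverse y) \<in> G" by (intro D(4) D(6) that)
    then have "x * inverse y = 1" using D(2,7) that by simp
    then show ?thesis using D(3)[OF that(2)] by (simp add: field_simps)
  qed
  have chi: "(a, x) \<in> G \<Longrightarrow> chi a = x" for a x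
    unfolding chi_def using fn by (intro some_equality)
  show thesis
  proof (rule that[of "fst ` G" chi])
    show "Z \<subseteq> fst ` G" using D(1) by force
    show "fst ` G \<subseteq> Eu" using D(2) by auto
    show "iv g \<in> fst ` G" if "g \<in> fst ` G" for g using that D(6) by force
    show "chi z = iota z" if "z \<in> Z" for z using chi[OF D(1)[OF that]] .
    show "a \<in> fst ` G" if a: "a \<in> Eu" "\<And>h. h \<in> fst ` G \<Longrightarrow> a * h = h * a" for a
    proof -
      have "a * h = h * a" if "(h, x) \<in> G" for h x using a(2) that by force
      then obtain G' x where "partial_character G'" "G \<subseteq> G'" "(a, x) \<in> G'"
        using partial_character_extend[OF G a(1)] by blast
      then show ?thesis using max by force
    qed
    fix g h assume "g \<in> fst ` G" "h \<in> fst ` G"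
    then obtain x y where xy: "(g, x) \<in> G" "(h, y) \<in> G" by auto
    show "g * h \<in> fst ` G" using D(4)[OF xy] by force
    show "chi (g * h) = chi g * chi h" using chi[OF D(4)[OF xy]] chi[OF xy(1)] chi[OF xy(2)] by simp
  qed
qed

text \<open>Finiteness comes from \<open>B\<close>, which meets every coset of T^* and hence every
  coset of the larger group \<open>H\<close>.\<close>

lemma coset_representatives_exist:
  assumes H: "Z \<subseteq> H" "H \<subseteq> Eu" "\<And>g h. g \<in> H \<Longrightarrow> h \<in> H \<Longrightarrow> g * h \<in> H"
    "\<And>g. g \<in> H \<Longrightarrow> iv g \<in> H"
  obtains m :: nat and \<rho> where "\<And>i. i < m \<Longrightarrow> \<rho> i \<in> Eu"
    "\<And>u. u \<in> Eu \<Longrightarrow> \<exists>!i. i < m \<and> iv (\<rho> i) * u \<in> H"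
proof -
  define q where "q u = {v \<in> Eu. iv u * v \<in> H}" for u
  have q_eq: "q u = q v \<longleftrightarrow> iv u * v \<in> H" if "u \<in> Eu" "v \<in> Eu" for u v
  proof
    assume "q u = q v"
    moreover have "v \<in> q v" using that H(1) Z_one by (auto simp: q_def)
    ultimately show "iv u * v \<in> H" by (auto simp: q_def)
  next
    assume h: "iv u * v \<in> H"
    have h': "iv v * u \<in> H" using H(4)[OF h] that by (simp add: units.inv_mult_group)
    show "q u = q v"
    proof (intro equalityI subsetI)
      fix x assume x: "x \<in> q u"
      then have "(iv v * u) * (iv u * x) \<in> H" using H(3) h' by (auto simp: q_def)
      then show "x \<in> q v" using x that by (auto simp: q_def mult.assoc)
    next
      fix x assume x: "x \<in> q v"
      then have "(iv u * v) * (iv v * x) \<in> H" using H(3) h by (auto simp: q_def)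
      then show "x \<in> q u" using x that by (auto simp: q_def mult.assoc)
    qed
  qed
  have "q ` Eu \<subseteq> q ` B"
  proof
    fix x assume "x \<in> q ` Eu"
    then obtain u where u: "u \<in> Eu" "x = q u" by blast
    obtain b where b: "b \<in> B" "u * iv b \<in> Z" using basis_representative[OF u(1)] by blast
    have bU: "b \<in> Eu" using B_U b by blast
    have "iv b * u = iv b * ((u * iv b) * b)" using bU by simp
    also have "\<dots> = u * iv b" using bU by (simp only: Z_left_commute[OF b(2)]) simp
    finally have "iv b * u \<in> H" using b(2) H(1) by auto
    then have "q b = q u" using q_eq u bU by blast
    then show "x \<in> q ` B" using b u by auto
  qed
  then have fin: "finite (q ` Eu)" using B_finite finite_surj by blast
  obtain f where f: "bij_betw f {0..<card (q ` Eu)} (q ` Eu)"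
    using ex_bij_betw_nat_finite[OF fin] by blast
  define m where "m = card (q ` Eu)"
  define \<rho> where "\<rho> i = (SOME u. u \<in> Eu \<and> f i = q u)" for i
  have \<rho>: "\<rho> i \<in> Eu" "f i = q (\<rho> i)" if i: "i < m" for i
  proof -
    have "f i \<in> q ` Eu" using bij_betw_apply[OF f, of i] i unfolding m_def by simp
    then have "\<exists>u. u \<in> Eu \<and> f i = q u" by blast
    from someI_ex[OF this] show "\<rho> i \<in> Eu" "f i = q (\<rho> i)" unfolding \<rho>_def by auto
  qed
  show thesis
  proof (rule that[of m \<rho>])
    fix u assume u: "u \<in> Eu"
    have "\<exists>!i. i < m \<and> f i = q u"
    proof -
      have "q u \<in> f ` {0..<m}" using f u unfolding m_def by (auto simp: bij_betw_def)
      moreover have "inj_on f {0..<m}" using f unfolding m_def by (simp add: bij_betw_def)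
      ultimately show ?thesis unfolding inj_on_def by auto
    qed
    moreover have "i < m \<and> f i = q u \<longleftrightarrow> i < m \<and> iv (\<rho> i) * u \<in> H" for i
      using \<rho>[of i] q_eq[of "\<rho> i" u] u by auto
    ultimately show "\<exists>!i. i < m \<and> iv (\<rho> i) * u \<in> H" by simp
  qed (use \<rho> in auto)
qed

end

section \<open>The representation induced from the character of H\<close>

locale induced_representation = totally_ramified_basis \<Gamma> E B n
  for \<Gamma> :: "('g, 'h) monoid_scheme" (structure) and E :: "'g \<Rightarrow> 'a::ring_1_no_zero_divisors set"
    and B :: "'a set" and n :: nat +
  fixes H :: "'a set" and chi :: "'a \<Rightarrow> 'a closure"
    and m :: nat and \<rho> :: "nat \<Rightarrow> 'a"
  assumes Z_H: "Z \<subseteq> H" and H_U: "H \<subseteq> Eu"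
    and H_mult: "g \<in> H \<Longrightarrow> h \<in> H \<Longrightarrow> g * h \<in> H"
    and H_inverse: "g \<in> H \<Longrightarrow> iv g \<in> H"
    and H_maximal: "a \<in> Eu \<Longrightarrow> (\<And>h. h \<in> H \<Longrightarrow> a * h = h * a) \<Longrightarrow> a \<in> H"
    and chi_mult: "g \<in> H \<Longrightarrow> h \<in> H \<Longrightarrow> chi (g * h) = chi g * chi h"
    and chi_Z: "z \<in> Z \<Longrightarrow> chi z = iota z"
    and \<rho>_U: "i < m \<Longrightarrow> \<rho> i \<in> Eu"
    and \<rho>_unique: "u \<in> Eu \<Longrightarrow> \<exists>!i. i < m \<and> iv (\<rho> i) * u \<in> H"
begin

definition chi0 :: "'a \<Rightarrow> 'a closure" where
  "chi0 a = (if a \<in> H then chi a else 0)"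

lemma H_cancel_right: 
  assumes "g \<in> Eu" "h \<in> H"
  shows "g * h \<in> H \<longleftrightarrow> g \<in> H"
proof
  assume "g * h \<in> H"
  then have "g * h * iv h \<in> H" using assms H_mult H_inverse by blast
  then show "g \<in> H" using assms H_U by auto
qed (use assms H_mult in blast)

lemma chi0_mult_right:
  assumes "g \<in> Eu" "h \<in> H"
  shows "chi0 (g * h) = chi0 g * chi0 h"
  using H_cancel_right[OF assms] assms by (simp add: chi0_def chi_mult)

lemma chi0_scale:
  assumes "g \<in> Eu" "z \<in> Z"
  shows "chi0 (z * g) = iota z * chi0 g"
proof -
  have "z \<in> H" using assms Z_H by blast
  then show ?thesis
    using chi0_mult_right[of g z] assms by (simp add: Z_commute chi0_def chi_Z)
qed

text \<open>The matrix of \<open>a\<close> in the representation induced from \<open>chi\<close>, in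
  the basis given by the representatives \<open>\<rho>\<close>; as \<open>chi0\<close> vanishes
  outside \<open>H\<close>, each column has one nonzero entry.\<close>

definition M :: "'a \<Rightarrow> nat \<Rightarrow> nat \<Rightarrow> 'a closure" where
  "M a p q = chi0 (iv (\<rho> p) * a * \<rho> q)"

lemma \<rho>_eqI: "u \<in> Eu \<Longrightarrow> i < m \<Longrightarrow> j < m \<Longrightarrow> iv (\<rho> i) * u \<in> H \<Longrightarrow> iv (\<rho> j) * u \<in> H \<Longrightarrow> i = j"
  using \<rho>_unique by blast

lemma M_mult:
  assumes "p < m" "q < m" "a \<in> Eu" "b \<in> Eu"
  shows "M (a * b) p q = (\<Sum>r<m. M a p r * M b r q)"
proof -
  note U = \<rho>_U[OF assms(1)] \<rho>_U[OF assms(2)] assms(3,4)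
  \<comment> \<open>\<open>b\<close> sends the coset of \<open>\<rho> q\<close> to that of
    \<open>\<rho> r\<close>, so column \<open>q\<close> of the matrix of \<open>b\<close> is
    supported at \<open>r\<close>.\<close>
  obtain r where r: "r < m" "iv (\<rho> r) * (b * \<rho> q) \<in> H" using \<rho>_unique[of "b * \<rho> q"] U by auto
  have "M a p s * M b s q = 0" if "s < m" "s \<noteq> r" for s
  proof -
    have "iv (\<rho> s) * (b * \<rho> q) \<notin> H" using \<rho>_eqI[of "b * \<rho> q" r s] r that U by auto
    then show ?thesis by (simp add: M_def chi0_def mult.assoc)
  qed
  then have "(\<Sum>s\<in>{..<m} - {r}. M a p s * M b s q) = 0"
    by (intro sum.neutral) blast
  then have "(\<Sum>r<m. M a p r * M b r q) = M a p r * M b r q"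
    using r by (subst sum.remove[of _ r]) auto
  also have "\<dots> = chi0 ((iv (\<rho> p) * a * \<rho> r) * (iv (\<rho> r) * (b * \<rho> q)))"
    using U r \<rho>_U[OF r(1)] by (subst chi0_mult_right) (simp_all add: M_def mult.assoc)
  also have "(iv (\<rho> p) * a * \<rho> r) * (iv (\<rho> r) * (b * \<rho> q)) = iv (\<rho> p) * (a * b) * \<rho> q"
    using \<rho>_U[OF r(1)] by (simp add: mult.assoc)
  finally show ?thesis by (simp add: M_def)
qed

lemma M_scale:
  assumes "p < m" "q < m" "a \<in> Eu" "z \<in> Z"
  shows "M (z * a) p q = iota z * M a p q"
proof -
  have "iv (\<rho> p) * (z * a) * \<rho> q = z * (iv (\<rho> p) * a * \<rho> q)"
    using assms by (simp add: Z_left_commute mult.assoc)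
  then show ?thesis using assms \<rho>_U by (simp add: M_def chi0_scale)
qed

lemma M_one: "p < m \<Longrightarrow> q < m \<Longrightarrow> M 1 p q = (if p = q then 1 else 0)"
proof -
  assume pq: "p < m" "q < m"
  have "1 \<in> H" using Z_H Z_one by blast
  then show ?thesis
    using \<rho>_eqI[of "\<rho> q" p q] chi_Z[of 1] \<rho>_U[of p] \<rho>_U[of q] pq
    by (cases "p = q") (auto simp: M_def chi0_def)
qed

text \<open>Multiplying a relation by the matrices of \<open>g\<close> and \<open>iv g\<close> on
  the two sides multiplies the coefficient of \<open>b\<close> by \<open>iota (cm g b)\<close>, so
  the Dedekind argument applies. The matrix of a single \<open>b\<close> is not zero, as its product
  with that of \<open>iv b\<close> is the identity.\<close>

lemma M_independent:
  assumes "\<forall>x\<in>{..<m} \<times> {..<m}. (\<Sum>b\<in>B. c b * M b (fst x) (snd x)) = 0" "b \<in> B"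
  shows "c b = 0"
proof -
  define S where "S = {c. \<forall>p<m. \<forall>q<m. (\<Sum>b\<in>B. c b * M b p q) = 0}"
  show ?thesis
  proof (rule eigenfamily_independent[where I = B and G = "Eu" and lam = "\<lambda>g b. iota (cm g b)"
        and S = S])
    show "c \<in> S" using assms(1) by (auto simp: S_def)
    fix c g a assume c: "c \<in> S" and g: "g \<in> Eu"
    have "(\<Sum>b\<in>B. (iota (cm g b) - a) * c b * M b p q) = 0" if pq: "p < m" "q < m" for p q
    proof -
      have "iota (cm g b) * M b p q = (\<Sum>r<m. \<Sum>s<m. M g p r * M b r s * M (iv g) s q)" if b: "b \<in> B" for b
      proof -
        have "iota (cm g b) * M b p q = M (g * (b * iv g)) p q"
          using M_scale[OF pq B_U[OF b] cm_Z[OF g B_U[OF b]]] g B_U[OF b]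
          by (simp add: cm_scale mult.assoc)
        also have "\<dots> = (\<Sum>r<m. \<Sum>s<m. M g p r * M b r s * M (iv g) s q)"
          using pq g B_U[OF b] by (simp add: M_mult sum_distrib_left mult.assoc)
        finally show ?thesis .
      qed
      then have "(\<Sum>b\<in>B. iota (cm g b) * c b * M b p q)
          = (\<Sum>b\<in>B. c b * (\<Sum>r<m. \<Sum>s<m. M g p r * M b r s * M (iv g) s q))"
        by (intro sum.cong) (auto simp: mult_ac)
      also have "\<dots> = (\<Sum>b\<in>B. \<Sum>r<m. \<Sum>s<m. M g p r * M (iv g) s q * (c b * M b r s))"
        by (simp add: sum_distrib_left mult_ac)
      also have "\<dots> = (\<Sum>r<m. \<Sum>b\<in>B. \<Sum>s<m. M g p r * M (iv g) s q * (c b * M b r s))"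
        by (rule sum.swap)
      also have "\<dots> = (\<Sum>r<m. \<Sum>s<m. \<Sum>b\<in>B. M g p r * M (iv g) s q * (c b * M b r s))"
        by (intro sum.cong[OF refl] sum.swap)
      also have "\<dots> = 0"
        using c by (simp add: S_def sum_distrib_left[symmetric])
      finally have "(\<Sum>b\<in>B. iota (cm g b) * c b * M b p q) = 0" .
      moreover have "(\<Sum>b\<in>B. a * c b * M b p q) = 0"
        using c pq by (simp add: S_def mult.assoc sum_distrib_left[symmetric])
      ultimately show ?thesis by (simp add: left_diff_distrib sum_subtractf)
    qed
    then show "(\<lambda>b. (iota (cm g b) - a) * c b) \<in> S" by (simp add: S_def)
  next
    fix b b' assume "b \<in> B" "b' \<in> B" "b \<noteq> b'"
    then show "\<exists>g\<in>Eu. iota (cm g b) \<noteq> iota (cm g b')"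
      using basis_separated B_U by (simp add: iota_eq_iff)
  next
    fix c b assume c: "c \<in> S" and b: "b \<in> B" and z: "\<And>b'. b' \<in> B \<Longrightarrow> b' \<noteq> b \<Longrightarrow> c b' = 0"
    obtain p where p: "p < m" using \<rho>_unique[of 1] by auto
    have eq: "(\<Sum>b\<in>B. c b * M b p q) = c b * M b p q" for p q
      using b z by (subst sum.remove[OF B_finite b]) (auto intro!: sum.neutral)
    show "c b = 0"
    proof (rule ccontr)
      assume "c b \<noteq> 0"
      then have "M b p q = 0" if "q < m" for q using c eq[of p q] p that by (simp add: S_def)
      then have "(\<Sum>q<m. M b p q * M (iv b) q p) = 0" by simp
      then have "M (b * iv b) p p = 0" using p B_U[OF b] M_mult[of p p b "iv b"] by simp
      then show False using B_U[OF b] p by (simp add: M_one)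
    qed
  qed (use assms B_finite in auto)
qed

text \<open>The characters of \<open>H\<close> given by commutators with the \<open>\<rho> i\<close>
  are pairwise distinct because \<open>H\<close> is its own centralizer, hence independent. They
  factor through \<open>H\<close> modulo T^*, which is represented by \<open>B \<inter> H\<close>,
  and this bounds their number.\<close>

lemma cosets_le: "m \<le> card (B \<inter> H)"
proof -
  define S where "S = {c. \<forall>h\<in>H. (\<Sum>i<m. c i * iota (cm (\<rho> i) h)) = 0}"
  have "card {..<m} \<le> card (B \<inter> H)"
  proof (rule independent_family_card_le[where v = "\<lambda>i d. iota (cm (\<rho> i) d)"])
    fix c i assume c: "\<forall>d\<in>B \<inter> H. (\<Sum>i<m. c i * iota (cm (\<rho> i) d)) = 0" and i: "i \<in> {..<m}"
    show "c i = 0"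
    proof (rule eigenfamily_independent[where I = "{..<m}" and G = H
          and lam = "\<lambda>g i. iota (cm (\<rho> i) g)" and S = S])
      have "(\<Sum>i<m. c i * iota (cm (\<rho> i) h)) = 0" if h: "h \<in> H" for h
      proof -
        have hU: "h \<in> Eu" using h H_U by blast
        obtain b where b: "b \<in> B" "h * iv b \<in> Z" using basis_representative[OF hU] by blast
        have bU: "b \<in> Eu" using B_U b by blast
        have bh: "b = iv (h * iv b) * h" using bU hU by (simp add: units.inv_mult_group mult.assoc)
        have "b \<in> H" by (subst bh) (use b Z_H h Z_inverse H_mult in blast)
        moreover have "cm (\<rho> i) h = cm (\<rho> i) b" if "i < m" for i
        proof -
          have "cm (\<rho> i) ((h * iv b) * b) = cm (\<rho> i) (h * iv b) * cm (\<rho> i) b"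
            using bU hU \<rho>_U[OF that] by (intro cm_mult_right) auto
          then show ?thesis using b bU \<rho>_U[OF that] by (simp add: cm_Z_right)
        qed
        ultimately show ?thesis using c b by simp
      qed
      then show "c \<in> S" by (simp add: S_def)
    next
      fix c g a assume c: "c \<in> S" and g: "g \<in> H"
      have "(\<Sum>i<m. (iota (cm (\<rho> i) g) - a) * c i * iota (cm (\<rho> i) h)) = 0" if h: "h \<in> H" for h
      proof -
        have gh: "g \<in> Eu" "h \<in> Eu" using g h H_U by auto
        have "(\<Sum>i<m. (iota (cm (\<rho> i) g) - a) * c i * iota (cm (\<rho> i) h))
          = (\<Sum>i<m. c i * iota (cm (\<rho> i) (g * h)) - a * (c i * iota (cm (\<rho> i) h)))"
          using gh \<rho>_U by (intro sum.cong) (auto simp: cm_mult_right iota_mult algebra_simps)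
        also have "\<dots> = 0"
          using c h H_mult[OF g h] by (simp add: S_def sum_subtractf sum_distrib_left[symmetric])
        finally show ?thesis .
      qed
      then show "(\<lambda>i. (iota (cm (\<rho> i) g) - a) * c i) \<in> S" by (simp add: S_def)
    next
      fix i j assume ij: "i \<in> {..<m}" "j \<in> {..<m}" "i \<noteq> j"
      have U: "\<rho> i \<in> Eu" "\<rho> j \<in> Eu" using ij \<rho>_U by auto
      show "\<exists>g\<in>H. iota (cm (\<rho> i) g) \<noteq> iota (cm (\<rho> j) g)"
      proof (rule ccontr)
        assume "\<not> ?thesis"
        then have eq: "cm (\<rho> i) h = cm (\<rho> j) h" if "h \<in> H" for h
          using that U H_U by (auto simp: iota_eq_iff subset_iff)
        have "iv (\<rho> i) * \<rho> j \<in> H"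
        proof (rule H_maximal)
          fix h assume h: "h \<in> H"
          then have hU: "h \<in> Eu" using H_U by blast
          then have "cm (iv (\<rho> i) * \<rho> j) h = 1"
            using U eq[OF h] by (simp add: cm_mult_left cm_inverse_left)
          then show "iv (\<rho> i) * \<rho> j * h = h * (iv (\<rho> i) * \<rho> j)"
            using cm_eq_1_iff[of "iv (\<rho> i) * \<rho> j" h] hU U by simp
        qed (use U in simp)
        moreover have "iv (\<rho> j) * \<rho> j \<in> H" using U Z_H Z_one by auto
        ultimately show False using \<rho>_eqI[of "\<rho> j" i j] U ij by auto
      qed
    next
      fix c i assume c: "c \<in> S" and i: "i \<in> {..<m}" and z: "\<And>j. j \<in> {..<m} \<Longrightarrow> j \<noteq> i \<Longrightarrow> c j = 0"
      have "(\<Sum>i<m. c i * iota (cm (\<rho> i) 1)) = c i * iota (cm (\<rho> i) 1)"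
        using i z by (subst sum.remove[of _ i]) (auto intro!: sum.neutral)
      also have "\<dots> = c i" using i \<rho>_U by (simp add: cm_Z_right)
      finally have ci: "(\<Sum>i<m. c i * iota (cm (\<rho> i) 1)) = c i" .
      have "1 \<in> H" using Z_H Z_one by blast
      then show "c i = 0" using c ci by (simp add: S_def)
    qed (use i in auto)
  qed (use B_finite in auto)
  then show ?thesis by simp
qed

text \<open>The products \<open>\<rho> i * d\<close> with \<open>d \<in> B \<inter> H\<close> are
  pairwise inequivalent modulo T^*, so their representatives in \<open>B\<close> are distinct. This
  is one half of the index formula for T^* inside \<open>H\<close> inside E^*.\<close>

lemma cosets_mult_le: "m * card (B \<inter> H) \<le> card B"
proof -
  define bs where "bs u = (SOME b. b \<in> B \<and> u * iv b \<in> Z)" for u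
  have bs: "bs u \<in> B" "u * iv (bs u) \<in> Z" if "u \<in> Eu" for u
    using someI_ex[of "\<lambda>b. b \<in> B \<and> u * iv b \<in> Z"] basis_representative[OF that]
    unfolding bs_def by auto
  have eqv: "u * iv v \<in> Z" if "u \<in> Eu" "v \<in> Eu" "bs u = bs v" for u v
  proof -
    have "(u * iv (bs u)) * iv (v * iv (bs v)) \<in> Z"
      by (rule Z_mult[OF bs(2)[OF that(1)] Z_inverse[OF bs(2)[OF that(2)]]])
    then show ?thesis using that B_U[OF bs(1)[OF that(2)]] by (simp add: units.inv_mult_group mult.assoc)
  qed
  have inj: "i = j \<and> d = d'"
    if id: "i < m" "j < m" "d \<in> B" "d \<in> H" "d' \<in> B" "d' \<in> H"
      and eq: "bs (\<rho> i * d) = bs (\<rho> j * d')" for i j d d'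
  proof -
    have U: "\<rho> i \<in> Eu" "\<rho> j \<in> Eu" "d \<in> Eu" "d' \<in> Eu"
      using id \<rho>_U B_U by auto
    define z where "z = (\<rho> i * d) * iv (\<rho> j * d')"
    have z: "z \<in> Z" unfolding z_def by (rule eqv) (use U eq in auto)
    have zeq: "z * (\<rho> j * d') = \<rho> i * d" using U by (simp add: z_def)
    have "iv (\<rho> j) * \<rho> i = iv (\<rho> j) * (\<rho> i * d) * iv d" using U by (simp add: mult.assoc)
    also have "\<dots> = z * d' * iv d"
      using U z by (simp add: zeq[symmetric] Z_left_commute mult.assoc)
    finally have "iv (\<rho> j) * \<rho> i \<in> H" using z Z_H id H_mult H_inverse by auto
    moreover have "iv (\<rho> i) * \<rho> i \<in> H" using U Z_H Z_one by auto
    ultimately have ij: "i = j" using \<rho>_eqI[of "\<rho> i" i j] U id by auto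
    have "iv (\<rho> i) * (\<rho> i * d) = iv (\<rho> i) * (z * (\<rho> i * d'))" using zeq ij by simp
    then have "d = z * d'" using U z by (simp add: Z_left_commute)
    then show ?thesis using ij basis_inequivalent[OF id(5,3) z] by simp
  qed
  have "inj_on (\<lambda>(i, d). bs (\<rho> i * d)) ({..<m} \<times> (B \<inter> H))"
    by (rule inj_onI) (use inj in auto)
  moreover have "(\<lambda>(i, d). bs (\<rho> i * d)) ` ({..<m} \<times> (B \<inter> H)) \<subseteq> B"
    using bs(1) \<rho>_U B_U by auto
  ultimately have "card ({..<m} \<times> (B \<inter> H)) \<le> card B"
    using B_finite by (meson card_inj_on_le)
  then show ?thesis by (simp add: card_cartesian_product)
qed

text \<open>Independence of the m by m matrices of \<open>B\<close> gives n^2 <= m^2; the two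
  preceding counts give m^2 <= n^2.\<close>

lemma cosets_eq: "m = n"
proof -
  have "card B \<le> card ({..<m} \<times> {..<m})"
    by (rule independent_family_card_le[where v = "\<lambda>b x. M b (fst x) (snd x)"])
      (use M_independent B_finite in auto)
  then have "n\<^sup>2 \<le> m\<^sup>2" by (simp add: B_card power2_eq_square)
  moreover have "m * m \<le> card B"
    using mult_le_mono2[OF cosets_le] cosets_mult_le by (rule order_trans)
  then have "m\<^sup>2 \<le> n\<^sup>2" by (simp add: B_card power2_eq_square)
  ultimately show ?thesis by (simp add: power2_eq_iff_nonneg)
qed

lemma M_spans: "\<exists>c. \<forall>p<m. \<forall>q<m. w p q = (\<Sum>b\<in>B. c b * M b p q)"
proof -
  have "card ({..<m} \<times> {..<m}) = card B" by (simp add: cosets_eq B_card power2_eq_square)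
  then have "\<exists>c. \<forall>x\<in>{..<m} \<times> {..<m}. w (fst x) (snd x) = (\<Sum>b\<in>B. c b * M b (fst x) (snd x))"
    by (intro independent_family_spans) (use M_independent B_finite in auto)
  then show ?thesis by auto
qed

definition entry :: "'a quotient_ring \<Rightarrow> nat \<Rightarrow> nat \<Rightarrow> 'a closure" where
  "entry x p q = (\<Sum>b\<in>B. to_ac (quotient.representation (emb ` B) x (emb b)) * M b p q)"

lemma entry_add: "entry (x + y) p q = entry x p q + entry y p q"
  using quotient.representation_add[OF quotient_basis_independent, of y x] quotient_basis_span
  by (simp add: entry_def distrib_right sum.distrib)

lemma entry_scale: "entry (quotient_scale c x) p q = to_ac c * entry x p q"
  using quotient.representation_scale[OF quotient_basis_independent, of x c] quotient_basis_span
  by (simp add: entry_def sum_distrib_left mult.assoc)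

lemma entry_zero: "entry 0 p q = 0"
  using entry_scale[of 0 0 p q] by simp

lemma entry_basis:
  assumes "b \<in> B"
  shows "entry (emb b) p q = M b p q"
proof -
  have "quotient.representation (emb ` B) (emb b) = (\<lambda>v. if v = emb b then 1 else 0)"
    using assms by (intro quotient.representation_basis quotient_basis_independent) auto
  then have "entry (emb b) p q = (\<Sum>b'\<in>B. if b' = b then M b' p q else 0)"
    unfolding entry_def by (intro sum.cong) auto
  then show ?thesis using assms B_finite by simp
qed

text \<open>\<open>entry\<close> is the linear extension of \<open>M\<close> from \<open>B\<close>.
  A product of basis elements is only a central multiple of a basis element, so multiplicativity of
  \<open>entry\<close> relies on this agreement on all of E^*, which \<open>M_scale\<close>
  supplies.\<close>

lemma entry_emb:
  assumes "u \<in> Eu" "p < m" "q < m"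
  shows "entry (emb u) p q = M u p q"
proof -
  obtain b where b: "b \<in> B" "u * iv b \<in> Z" using basis_representative[OF assms(1)] by blast
  have u: "u = (u * iv b) * b" using B_U[OF b(1)] by simp
  have "entry (emb ((u * iv b) * b)) p q = iota (u * iv b) * M b p q"
    using b by (simp add: scale_tf[symmetric] entry_scale entry_basis iota_def)
  also have "\<dots> = M ((u * iv b) * b) p q"
    using M_scale[OF assms(2,3) B_U[OF b(1)] b(2)] by simp
  finally show ?thesis using u by simp
qed

lemma entry_mult:
  assumes pq: "p < m" "q < m"
  shows "entry (x * y) p q = (\<Sum>r<m. entry x p r * entry y r q)"
proof -
  have base: "entry (emb b * y) p q = (\<Sum>r<m. entry (emb b) p r * entry y r q)" if b: "b \<in> B" for b y
  proof -
    have "y \<in> quotient.span (emb ` B)" using quotient_basis_span by simp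
    then show ?thesis
    proof (induction rule: quotient.span_induct_alt)
      case base
      then show ?case by (simp add: entry_zero)
    next
      case (step c x y)
      then obtain b' where b': "b' \<in> B" "x = emb b'" by blast
      have "entry (emb b * x) p q = (\<Sum>r<m. entry (emb b) p r * entry x r q)"
        using b b' pq by (simp add: emb_simps(2)[symmetric] entry_emb B_U M_mult)
      then show ?case
        using step.IH by (simp add: distrib_left quotient_scale_mult_right entry_add entry_scale
            sum.distrib sum_distrib_left mult_ac)
    qed
  qed
  have "x \<in> quotient.span (emb ` B)" using quotient_basis_span by simp
  then show ?thesis
  proof (induction rule: quotient.span_induct_alt)
    case base
    then show ?case by (simp add: entry_zero)
  next
    case (step c x' x)
    then obtain b' where b': "b' \<in> B" "x' = emb b'" by blast
    have "entry (x' * y) p q = (\<Sum>r<m. entry x' p r * entry y r q)"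
      using base b' by simp
    then show ?case
      using step.IH by (simp add: distrib_right distrib_left quotient_scale_mult_left entry_add entry_scale
          sum.distrib sum_distrib_left mult_ac)
  qed
qed

lemma entry_one: "p < m \<Longrightarrow> q < m \<Longrightarrow> entry 1 p q = (if p = q then 1 else 0)"
  using entry_emb[of 1 p q] by (simp add: emb_simps(3) M_one)

definition induced :: "'a quotient_ring \<Rightarrow> 'a closure mat" where
  "induced x = mat n n (\<lambda>(p, q). entry x p q)"

lemma induced_index [simp]:
  "dim_row (induced x) = n" "dim_col (induced x) = n"
  "p < n \<Longrightarrow> q < n \<Longrightarrow> induced x $$ (p, q) = entry x p q"
  by (simp_all add: induced_def)

lemma induced_spans: 
  "\<exists>S c. finite S \<and> (\<forall>i<n. \<forall>j<n. A $$ (i, j) = (\<Sum>x\<in>S. c x * induced x $$ (i, j)))"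
proof -
  obtain c where c: "\<forall>p<m. \<forall>q<m. A $$ (p, q) = (\<Sum>b\<in>B. c b * M b p q)"
    using M_spans[of "\<lambda>p q. A $$ (p, q)"] by blast
  have "A $$ (i, j) = (\<Sum>x\<in>emb ` B. c (the_inv_into B emb x) * induced x $$ (i, j))"
    if ij: "i < n" "j < n" for i j
  proof -
    have "(\<Sum>x\<in>emb ` B. c (the_inv_into B emb x) * induced x $$ (i, j)) = (\<Sum>b\<in>B. c b * M b i j)"
      unfolding sum.reindex[OF inj_emb] comp_def
      by (rule sum.cong[OF refl]) (simp add: ij entry_basis the_inv_into_f_f[OF inj_emb])
    moreover have "A $$ (i, j) = (\<Sum>b\<in>B. c b * M b i j)" using c ij cosets_eq by blast
    ultimately show ?thesis by simp
  qed
  then show ?thesis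
    using B_finite
    by (intro exI[of _ "emb ` B"] exI[of _ "\<lambda>x. c (the_inv_into B emb x)"] conjI allI impI finite_imageI)
qed

lemma splitting_induced: "splitting n induced"
  unfolding splitting_def
proof (intro conjI allI ballI)
  show "n\<^sup>2 = quotient.dim (UNIV :: 'a quotient_ring set)" by (rule quotient_dim[symmetric])
  show "induced 1 = 1\<^sub>m n"
    using entry_one unfolding cosets_eq by (intro eq_matI) simp_all
  fix x y :: "'a quotient_ring" and c
  show "induced x \<in> carrier_mat n n" by (simp add: induced_def)
  show "induced (x + y) = induced x + induced y"
    by (intro eq_matI) (simp_all add: entry_add)
  show "induced (x * y) = induced x * induced y"
    by (intro eq_matI)
      (simp_all add: entry_mult[unfolded cosets_eq] scalar_prod_def atLeast0LessThan)
  show "induced (quotient_scale c x) = to_ac c \<cdot>\<^sub>m induced x"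
    by (intro eq_matI) (simp_all add: entry_scale)
qed (rule induced_spans)

end

lemma (in totally_ramified_basis) splitting_exists:
  "\<exists>\<phi>. splitting n (\<phi> :: 'a quotient_ring \<Rightarrow> _)"
proof (rule maximal_character_exists)
  fix H and chi :: "'a \<Rightarrow> 'a closure"
  assume H: "Z \<subseteq> H" "H \<subseteq> Eu" "\<And>g h. g \<in> H \<Longrightarrow> h \<in> H \<Longrightarrow> g * h \<in> H"
    "\<And>g. g \<in> H \<Longrightarrow> iv g \<in> H"
    "\<And>a. a \<in> Eu \<Longrightarrow> (\<And>h. h \<in> H \<Longrightarrow> a * h = h * a) \<Longrightarrow> a \<in> H"
    "\<And>g h. g \<in> H \<Longrightarrow> h \<in> H \<Longrightarrow> chi (g * h) = chi g * chi h"
    "\<And>z. z \<in> Z \<Longrightarrow> chi z = iota z"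
  show ?thesis
  proof (rule coset_representatives_exist[OF H(1-4)])
    fix m :: nat and \<rho>
    assume \<rho>: "\<And>i. i < m \<Longrightarrow> \<rho> i \<in> Eu"
      "\<And>u. u \<in> Eu \<Longrightarrow> \<exists>!i. i < m \<and> iv (\<rho> i) * u \<in> H"
    have "induced_representation \<Gamma> E B n H chi m \<rho>"
      by (intro induced_representation.intro induced_representation_axioms.intro
          totally_ramified_basis_axioms) (fact H(1), fact H(2), fact H(3), fact H(4), fact H(5),
          fact H(6), fact H(7), fact \<rho>(1), fact \<rho>(2))
    from induced_representation.splitting_induced[OF this] show ?thesis
      by (rule exI[where P = "splitting n"])
  qed
qed

section \<open>Reduced norms of homogeneous elements\<close>

lemma infinite_alg_closed_field: "infinite (UNIV :: 'k::alg_closed_field set)"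
proof
  assume fin: "finite (UNIV :: 'k set)"
  \<comment> \<open>In a finite field, the product of all X - x, plus 1, would be a nonconstant
    polynomial with value 1 at every point.\<close>
  define q where "q = (\<Prod>x\<in>(UNIV :: 'k set). [:- x, 1:])"
  have "degree q = (\<Sum>x\<in>(UNIV :: 'k set). degree [:- x, 1:])"
    unfolding q_def by (rule degree_prod_sum_eq) simp
  also have "\<dots> = card (UNIV :: 'k set)" by simp
  finally have "degree q > 0" using fin by (simp add: card_gt_0_iff)
  then have "degree (q + 1) > 0" by (subst degree_add_eq_left) auto
  then obtain x where "poly (q + 1) x = 0" using alg_closed_imp_poly_has_root by blast
  moreover have "poly q x = 0" using fin by (auto simp: q_def poly_prod)
  ultimately show False by simp
qed

lemma char_poly_smult:
  fixes A :: "'k::field mat"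
  assumes A: "A \<in> carrier_mat n n"
  shows "poly (char_poly (c \<cdot>\<^sub>m A)) (c * x) = c ^ n * poly (char_poly A) x"
proof -
  have "- char_matrix (c \<cdot>\<^sub>m A) (c * x) = c \<cdot>\<^sub>m (- char_matrix A x)"
    using A by (intro eq_matI) (auto simp: char_matrix_def algebra_simps)
  moreover have "dim_col (char_matrix A x) = n" using A by (simp add: char_matrix_def)
  then have "det (c \<cdot>\<^sub>m (- char_matrix A x)) = c ^ n * det (- char_matrix A x)"
    by simp
  ultimately show ?thesis
    using char_poly_matrix[OF A, of x] char_poly_matrix[of "c \<cdot>\<^sub>m A" n "c * x"] A by simp
qed

text \<open>With p the characteristic polynomial, \<open>char_poly_smult\<close> gives p(c x) = c^n
  p(x) at every point. The field is infinite, so this is an identity of polynomials, and a nonzero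
  coefficient at \<open>i\<close> forces c^i = c^n.\<close>

lemma coeff_char_poly_scaling_invariant:
  fixes A :: "'k::alg_closed_field mat"
  assumes A: "A \<in> carrier_mat n n" and c: "c \<noteq> 0"
    and sim: "char_poly (c \<cdot>\<^sub>m A) = char_poly A"
    and i: "coeff (char_poly A) i \<noteq> 0"
  shows "c ^ (n - i) = 1"
proof -
  let ?p = "char_poly A"
  obtain F :: "'k set" where F: "finite F" "card F = Suc (degree (pcompose ?p [:0, c:]) + degree (smult (c ^ n) ?p))"
    using infinite_arbitrarily_large[OF infinite_alg_closed_field] by blast
  have "pcompose ?p [:0, c:] = smult (c ^ n) ?p"
  proof (rule poly_eqI_degree[where A = F])
    show "poly (pcompose ?p [:0, c:]) x = poly (smult (c ^ n) ?p) x" for x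
      using char_poly_smult[OF A, of c x] sim by (simp add: poly_pcompose mult.commute)
  qed (use F in auto)
  then have "coeff (pcompose ?p [:0, c:]) i = coeff (smult (c ^ n) ?p) i" by simp
  then have eq: "c ^ i = c ^ n" using i by (simp add: coeff_pcompose_linear)
  have "i \<le> n" using i degree_monic_char_poly[OF A] le_degree by blast
  then have "c ^ n = c ^ i * c ^ (n - i)" by (simp add: power_add[symmetric])
  then show ?thesis using eq c by simp
qed

lemma monic_single_root:
  fixes q :: "'k::alg_closed_field poly"
  assumes "lead_coeff q = 1" "\<And>y. poly q y = 0 \<Longrightarrow> y = \<theta>"
  shows "poly q x = (x - \<theta>) ^ degree q"
proof -
  have "q \<noteq> 0" using assms(1) by auto
  then obtain S where S: "size S = degree q" "q = smult (lead_coeff q) (\<Prod>x\<in>#S. [:-x, 1:])"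
    using alg_closed_imp_factorization by blast
  then have q: "q = (\<Prod>x\<in>#S. [:-x, 1:])" using assms(1) by simp
  have "y = \<theta>" if "y \<in># S" for y
  proof (rule assms(2))
    obtain S' where "S = add_mset y S'" using \<open>y \<in># S\<close> by (metis insert_DiffM)
    then show "poly q y = 0" unfolding q by simp
  qed
  then have SR: "S = replicate_mset (degree q) \<theta>" using S(1) by (metis set_mset_subset_singletonD singleton_iff subsetI)
  have "(\<Prod>x\<in>#S. [:-x, 1:]) = [:- \<theta>, 1:] ^ degree q" by (subst SR) simp
  from trans[OF q this] have "poly q x = poly ([:- \<theta>, 1:] ^ degree q) x" by (rule arg_cong)
  then show ?thesis by (simp add: poly_power)
qed

text \<open>By \<open>coeff_char_poly_scaling_invariant\<close> only exponents congruent to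
  \<open>n\<close> modulo \<open>k\<close> carry nonzero coefficients. The constant term is one of
  them because \<open>det A\<close> is nonzero; so \<open>k\<close> divides \<open>n\<close>, and
  the characteristic polynomial is q(X^k). Every root of q is the k-th power of an eigenvalue, hence
  equals \<open>\<theta>\<close>, so q is a power of X - \<open>\<theta>\<close>, and its constant
  term is the determinant up to sign.\<close>

lemma det_scaling_invariant:
  fixes A :: "'k::alg_closed_field mat"
  assumes A: "A \<in> carrier_mat n n" and nz: "det A \<noteq> 0" and k: "k > 0"
    and C0: "\<And>c. c \<in> C \<Longrightarrow> c \<noteq> 0"
    and sim: "\<And>c. c \<in> C \<Longrightarrow> char_poly (c \<cdot>\<^sub>m A) = char_poly A"
    and ord: "\<And>j. (\<And>c. c \<in> C \<Longrightarrow> c ^ j = 1) \<Longrightarrow> k dvd j"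
    and root: "\<And>x. eigenvalue A x \<Longrightarrow> x ^ k = \<theta>"
  shows "k dvd n" "det A = (-1) ^ n * (- \<theta>) ^ (n div k)"
proof -
  let ?p = "char_poly A"
  have deg: "degree ?p = n" "coeff ?p n = 1" using degree_monic_char_poly[OF A] by auto
  have "- char_matrix A 0 = (-1) \<cdot>\<^sub>m A" using A by (intro eq_matI) (auto simp: char_matrix_def)
  then have p0: "coeff ?p 0 = (-1) ^ n * det A"
    using char_poly_matrix[OF A, of 0] A by (simp add: poly_0_coeff_0)
  have dvd: "k dvd n - i" if "coeff ?p i \<noteq> 0" for i
    using ord coeff_char_poly_scaling_invariant[OF A C0 sim that] by blast
  from dvd[of 0] show kn: "k dvd n" using p0 nz by simp
  define d where "d = n div k"
  have n: "n = k * d" using kn by (simp add: d_def)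
  have dvd': "k dvd i" if "coeff ?p i \<noteq> 0" for i
  proof -
    have "i \<le> n" using that deg le_degree by blast
    then show ?thesis using dvd[OF that] kn by (metis dvd_diffD1)
  qed
  define q where "q = (\<Sum>j\<le>d. monom (coeff ?p (k * j)) j)"
  have cq: "coeff q j = (if j \<le> d then coeff ?p (k * j) else 0)" for j
    unfolding q_def by (simp add: coeff_sum)
  have "degree q \<le> d" by (rule degree_le) (simp add: cq)
  moreover have "coeff q d = 1" by (simp add: cq n[symmetric] deg)
  ultimately have dq: "degree q = d" using le_degree[of q d] by simp
  have qp: "poly q (x ^ k) = poly ?p x" for x
  proof -
    have "poly ?p x = (\<Sum>i\<le>n. coeff ?p i * x ^ i)" by (simp add: poly_altdef deg)
    also have "\<dots> = (\<Sum>i\<in>(\<lambda>j. k * j) ` {..d}. coeff ?p i * x ^ i)"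
    proof (rule sum.mono_neutral_right)
      show "(\<lambda>j. k * j) ` {..d} \<subseteq> {..n}" using n by auto
      show "\<forall>i\<in>{..n} - (\<lambda>j. k * j) ` {..d}. coeff ?p i * x ^ i = 0"
      proof
        fix i assume i: "i \<in> {..n} - (\<lambda>j. k * j) ` {..d}"
        have "coeff ?p i = 0"
        proof (rule ccontr)
          assume "coeff ?p i \<noteq> 0"
          then obtain j where j: "i = k * j" using dvd' by blast
          then have "j \<le> d" using i n k by auto
          then show False using i j by auto
        qed
        then show "coeff ?p i * x ^ i = 0" by simp
      qed
    qed simp
    also have "\<dots> = (\<Sum>j\<le>d. coeff ?p (k * j) * (x ^ k) ^ j)"
      using k by (subst sum.reindex) (auto intro: inj_onI simp: power_mult)
    also have "\<dots> = poly q (x ^ k)" by (simp add: q_def poly_sum poly_monom)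
    finally show ?thesis by simp
  qed
  have "poly q 0 = (0 - \<theta>) ^ degree q"
  proof (rule monic_single_root)
    show "lead_coeff q = 1" using dq \<open>coeff q d = 1\<close> by simp
    fix y assume y: "poly q y = 0"
    obtain x where "x ^ k = y" using nth_root_exists[OF k] by blast
    then show "y = \<theta>" using y qp[of x] root[of x] eigenvalue_root_char_poly[OF A, of x] by simp
  qed
  then have "coeff ?p 0 = (- \<theta>) ^ d" using cq[of 0] dq by (simp add: poly_0_coeff_0)
  then have "(-1) ^ n * ((-1) ^ n * det A) = (-1) ^ n * (- \<theta>) ^ d" using p0 by simp
  moreover have "(-1) ^ n * ((-1) ^ n * det A) = det A"
    by (simp add: mult.assoc[symmetric] power_add[symmetric] mult_2[symmetric])
  ultimately show "det A = (-1) ^ n * (- \<theta>) ^ (n div k)" by (simp add: d_def)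
qed

context totally_ramified_basis
begin

definition central_order :: "'a \<Rightarrow> nat" where
  "central_order a = (LEAST k. 0 < k \<and> a ^ k \<in> Z)"

lemma central_order:
  assumes "a \<in> Eu"
  shows central_order_pos: "central_order a > 0" and central_order_power: "a ^ central_order a \<in> Z"
proof -
  obtain k where "0 < k \<and> a ^ k \<in> Z" using power_central[OF assms] by blast
  from LeastI[where P = "\<lambda>k. 0 < k \<and> a ^ k \<in> Z", OF this]
  show "central_order a > 0" "a ^ central_order a \<in> Z" by (auto simp: central_order_def)
qed

lemma central_order_dvd:
  assumes a: "a \<in> Eu" and j: "a ^ j \<in> Z"
  shows "central_order a dvd j"
proof -
  let ?k = "central_order a"
  have "a ^ j = (a ^ ?k) ^ (j div ?k) * a ^ (j mod ?k)"
    unfolding power_mult[symmetric] power_add[symmetric] by simp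
  then have "iv ((a ^ ?k) ^ (j div ?k)) * a ^ j = a ^ (j mod ?k)"
    using a by (simp add: U_power)
  moreover have "iv ((a ^ ?k) ^ (j div ?k)) * a ^ j \<in> Z"
    by (rule Z_mult[OF Z_inverse[OF Z_power[OF central_order_power[OF a]]] j])
  ultimately have "a ^ (j mod ?k) \<in> Z" by simp
  moreover have "j mod ?k < ?k" using central_order_pos[OF a] by simp
  ultimately have "j mod ?k = 0"
    using not_less_Least[of "j mod ?k" "\<lambda>k. 0 < k \<and> a ^ k \<in> Z"] by (auto simp: central_order_def)
  then show ?thesis by auto
qed

lemma central_order_Z: "z \<in> Z \<Longrightarrow> central_order z = 1"
  unfolding central_order_def by (rule Least_equality) auto

text \<open>The value of \<open>det_scaling_invariant\<close> for
  \<open>k = central_order a\<close>, formed inside E; \<open>Nrd_homogeneous\<close> shows that it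
  is the reduced norm, now as an element of T^*.\<close>

definition nrd :: "'a \<Rightarrow> 'a" where
  "nrd a = (-1) ^ n * (- (a ^ central_order a)) ^ (n div central_order a)"

lemma minus_one_Z: "- 1 \<in> Z"
  by (simp add: uminus_Z)

lemma nrd_Z: "a \<in> Eu \<Longrightarrow> nrd a \<in> Z"
  unfolding nrd_def by (intro Z_mult Z_power uminus_Z minus_one_Z central_order_power)

lemma splitting_size: "splitting m (\<phi> :: 'a quotient_ring \<Rightarrow> _) \<Longrightarrow> m = n"
  by (simp add: splitting_def quotient_dim power2_eq_iff_nonneg)

text \<open>Conjugating by the image of \<open>g\<close> multiplies the matrix of \<open>a\<close>
  by the scalar \<open>iota (cm g a)\<close>. By nondegeneracy these scalars all have j-th power 1
  only if \<open>a ^ j\<close> is central, so their joint order is \<open>central_order a\<close>.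
  The power of \<open>a\<close> with that exponent is central, so its matrix is scalar, which fixes
  the corresponding power of every eigenvalue.\<close>

lemma splitting_det:
  assumes \<phi>: "splitting m (\<phi> :: 'a quotient_ring \<Rightarrow> _)" and a: "a \<in> Eu"
  shows "central_order a dvd n" "det (\<phi> (emb a)) = iota (nrd a)"
proof -
  let ?k = "central_order a"
  let ?A = "\<phi> (emb a)"
  have m: "m = n" by (rule splitting_size[OF \<phi>])
  have car: "\<phi> x \<in> carrier_mat n n" for x using \<phi> m by (auto simp: splitting_def)
  have mult: "\<phi> (x * y) = \<phi> x * \<phi> y" for x y using \<phi> by (auto simp: splitting_def)
  have one: "\<phi> (emb 1) = 1\<^sub>m n" using \<phi> m by (auto simp: splitting_def emb_simps)
  have scale: "\<phi> (emb (z * x)) = iota z \<cdot>\<^sub>m \<phi> (emb x)" if "z \<in> Z" for z x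
    using \<phi> that by (simp add: splitting_def scale_tf[symmetric] iota_def)
  have inv: "\<phi> (emb g) * \<phi> (emb (iv g)) = 1\<^sub>m n" "\<phi> (emb (iv g)) * \<phi> (emb g) = 1\<^sub>m n"
    if "g \<in> Eu" for g
    using that by (simp_all add: mult[symmetric] emb_simps(2)[symmetric] one)
  have "det ?A * det (\<phi> (emb (iv a))) = det (1\<^sub>m n :: 'a closure mat)"
    using det_mult[OF car car] inv(1)[OF a] by metis
  then have nz: "det ?A \<noteq> 0" by auto
  have C0: "c \<noteq> 0" if c: "c \<in> (\<lambda>g. iota (cm g a)) ` Eu" for c
  proof -
    obtain g where "g \<in> Eu" "c = iota (cm g a)" using c by blast
    then show ?thesis
      using iota_eq_iff[of "cm g a" 0] U_nonzero[OF cm_U[of g a]] central_closed(1) cm_Z[of g a] a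
      by simp
  qed
  have sim: "char_poly (c \<cdot>\<^sub>m ?A) = char_poly ?A" if c: "c \<in> (\<lambda>g. iota (cm g a)) ` Eu" for c
  proof -
    obtain g where g: "g \<in> Eu" "c = iota (cm g a)" using c by blast
    have "c \<cdot>\<^sub>m ?A = \<phi> (emb (g * a * iv g))"
      using scale[OF cm_Z[OF g(1) a], of a] g a by (simp add: cm_scale)
    also have "\<dots> = \<phi> (emb g) * ?A * \<phi> (emb (iv g))" by (simp add: mult emb_simps)
    finally have eq: "c \<cdot>\<^sub>m ?A = \<phi> (emb g) * ?A * \<phi> (emb (iv g))" .
    have "{c \<cdot>\<^sub>m ?A, ?A, \<phi> (emb g), \<phi> (emb (iv g))} \<subseteq> carrier_mat n n" using car by simp
    then have "similar_mat (c \<cdot>\<^sub>m ?A) ?A" using inv[OF g(1)] eq by (rule similar_matI)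
    then show ?thesis by (rule char_poly_similar)
  qed
  have ord: "?k dvd j" if j: "\<And>c. c \<in> (\<lambda>g. iota (cm g a)) ` Eu \<Longrightarrow> c ^ j = 1" for j
  proof (rule central_order_dvd[OF a])
    have "cm g (a ^ j) = 1" if g: "g \<in> Eu" for g
    proof -
      have "iota (cm g a ^ j) = iota 1" using j[of "iota (cm g a)"] g a by (simp add: iota_power)
      then have "cm g a ^ j = 1" using g a by (subst (asm) iota_eq_iff) (auto simp: central_closed)
      then show ?thesis using g a by (simp add: cm_power_right)
    qed
    then show "a ^ j \<in> Z" using Z_iff_cm[of "a ^ j"] a U_power by blast
  qed
  have root: "x ^ ?k = iota (a ^ ?k)" if x: "eigenvalue ?A x" for x
  proof -
    obtain v where "eigenvector ?A v x" using x unfolding eigenvalue_def by blast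
    then have v: "v \<in> carrier_vec n" "v \<noteq> 0\<^sub>v n" "?A *\<^sub>v v = x \<cdot>\<^sub>v v"
      using car[of "emb a"] unfolding eigenvector_def by auto
    have pw: "\<phi> (emb (a ^ j)) *\<^sub>v v = x ^ j \<cdot>\<^sub>v v" for j
    proof (induction j)
      case 0
      then show ?case using v by (simp add: one)
    next
      case (Suc j)
      have "\<phi> (emb (a ^ Suc j)) *\<^sub>v v = (\<phi> (emb (a ^ j)) * ?A) *\<^sub>v v"
        by (simp only: power_Suc2 emb_simps mult)
      also have "\<dots> = \<phi> (emb (a ^ j)) *\<^sub>v (?A *\<^sub>v v)"
        by (rule assoc_mult_mat_vec[OF car car v(1)])
      also have "\<dots> = x \<cdot>\<^sub>v (\<phi> (emb (a ^ j)) *\<^sub>v v)"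
        unfolding v(3) by (rule mult_mat_vec[OF car v(1)])
      also have "\<dots> = x ^ Suc j \<cdot>\<^sub>v v" by (simp add: Suc smult_smult_assoc)
      finally show ?case .
    qed
    have "\<phi> (emb (a ^ ?k)) = iota (a ^ ?k) \<cdot>\<^sub>m 1\<^sub>m n"
      using scale[OF central_order_power[OF a], of 1] by (simp add: one)
    moreover have "(c \<cdot>\<^sub>m 1\<^sub>m n) *\<^sub>v v = c \<cdot>\<^sub>v v" for c
      using v(1) by (intro eq_vecI) (simp_all add: row_smult)
    ultimately have sv: "iota (a ^ ?k) \<cdot>\<^sub>v v = x ^ ?k \<cdot>\<^sub>v v" using pw[of ?k] by simp
    have "\<exists>i<n. v $ i \<noteq> 0"
    proof (rule ccontr)
      assume "\<not> ?thesis"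
      then have "v = 0\<^sub>v n" using v(1) by (intro eq_vecI) simp_all
      then show False using v(2) by simp
    qed
    then obtain i where i: "i < n" "v $ i \<noteq> 0" by blast
    from arg_cong[OF sv, of "\<lambda>w. vec_index w i"] have "iota (a ^ ?k) * v $ i = x ^ ?k * v $ i"
      using v(1) i(1) by simp
    then show ?thesis using i by simp
  qed
  note inst = det_scaling_invariant[where A = ?A and n = n and k = ?k and \<theta> = "iota (a ^ ?k)"
      and C = "(\<lambda>g. iota (cm g a)) ` Eu"]
  show "?k dvd n"
    by (rule inst(1), fact car, fact nz, fact central_order_pos[OF a], fact C0, fact sim,
        fact ord, fact root)
  have "det ?A = (- 1) ^ n * (- iota (a ^ ?k)) ^ (n div ?k)"
    by (rule inst(2), fact car, fact nz, fact central_order_pos[OF a], fact C0, fact sim,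
        fact ord, fact root)
  also have "\<dots> = iota (nrd a)"
  proof -
    have k: "a ^ ?k \<in> range of_center" using central_order_power[OF a] by simp
    have "iota ((- 1) ^ n) = (- 1 :: 'a closure) ^ n"
      using iota_power[OF central_closed(5)[OF central_closed(2)], where 'a = 'a]
        iota_uminus[OF central_closed(2), where 'a = 'a] by simp
    moreover have "iota ((- (a ^ ?k)) ^ (n div ?k)) = (- iota (a ^ ?k)) ^ (n div ?k)"
      using iota_power[OF central_closed(5)[OF k]] iota_uminus[OF k] by simp
    moreover have "iota (nrd a) = iota ((- 1) ^ n) * iota ((- (a ^ ?k)) ^ (n div ?k))"
      unfolding nrd_def
      by (rule iota_mult) (intro central_closed(6) central_closed(5) central_closed(2) k)+
    ultimately show ?thesis by simp
  qed
  finally show "det ?A = iota (nrd a)" .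
qed

text \<open>\<open>splitting_det\<close> holds in an arbitrary splitting and so yields uniqueness in
  the definite description; \<open>splitting_exists\<close> yields existence.\<close>

lemma Nrd_homogeneous:
  assumes "a \<in> Eu"
  shows "Nrd a = tf (nrd a)"
  unfolding Nrd_def reduced_norm_def emb_def[symmetric]
proof (rule the_equality)
  obtain \<phi> where \<phi>: "splitting n (\<phi> :: 'a quotient_ring \<Rightarrow> _)" using splitting_exists by blast
  then show "\<exists>m \<phi>. splitting m \<phi> \<and> det (\<phi> (emb a)) = to_ac (tf (nrd a))"
    using splitting_det(2)[OF \<phi> assms] by (auto simp: iota_def)
  fix c assume "\<exists>m \<phi>. splitting m \<phi> \<and> det (\<phi> (emb a)) = to_ac c"
  then obtain m \<phi> where \<phi>: "splitting m \<phi>" "det (\<phi> (emb a)) = to_ac c" by blast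
  then show "c = tf (nrd a)" using splitting_det(2)[OF \<phi>(1) assms] by (simp add: iota_def)
qed

lemma central_order_dvd_index: "a \<in> Eu \<Longrightarrow> central_order a dvd n"
  using splitting_exists splitting_det(1) by blast

lemma power_index_Z: 
  assumes "a \<in> Eu" shows "a ^ n \<in> Z"
proof -
  have "a ^ n = (a ^ central_order a) ^ (n div central_order a)"
    using central_order_dvd_index[OF assms] by (simp add: power_mult[symmetric])
  then show ?thesis using Z_power central_order_power[OF assms] by simp
qed

text \<open>The sign can stay open: the condition that the norm lie in R^* does not see it, and
  \<open>nrd_central\<close> settles it for central elements.\<close>

lemma nrd_sign: 
  assumes "a \<in> Eu" 
  shows "nrd a = a ^ n \<or> nrd a = - (a ^ n)"
proof -
  have "(- (a ^ central_order a)) ^ (n div central_order a)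
      = (- 1) ^ (n div central_order a) * a ^ n"
    using central_order_dvd_index[OF assms] by (subst power_minus) (simp add: power_mult[symmetric])
  then show ?thesis by (simp add: nrd_def minus_one_power_iff)
qed

lemma nrd_central: "z \<in> Z \<Longrightarrow> nrd z = z ^ n"
  by (simp add: nrd_def central_order_Z power_minus[of z] minus_one_power_iff)

end

section \<open>The exponent and the commutator group\<close>

lemma (in group) rcos_eq_iff:
  assumes "subgroup H G" "x \<in> carrier G" "y \<in> carrier G"
  shows "H #> x = H #> y \<longleftrightarrow> x \<otimes> inv y \<in> H"
proof
  assume "H #> x = H #> y"
  then have "x \<in> H #> y" using rcos_self[OF assms(2,1)] by simp
  then show "x \<otimes> inv y \<in> H" using subgroup.rcos_module_imp[OF assms(1) is_group assms(3)] by blast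
next
  assume "x \<otimes> inv y \<in> H"
  then have "x \<in> H #> y" using subgroup.rcos_module_rev[OF assms(1) is_group assms(3,2)] by blast
  then show "H #> x = H #> y" using repr_independence[OF _ assms(3,1)] by simp
qed

locale totally_ramified_exponent = totally_ramified_basis \<Gamma> E B n
  for \<Gamma> :: "('g, 'h) monoid_scheme" (structure) and E :: "'g \<Rightarrow> 'a::ring_1_no_zero_divisors set"
    and B :: "'a set" and n :: nat +
  fixes e :: nat
  assumes e_def: "e = group_exponent ((\<Gamma> \<restriction> degrees \<Gamma> E) Mod degrees \<Gamma> (central_part E))"
begin

lemma degrees_iff: "\<gamma> \<in> degrees \<Gamma> E \<longleftrightarrow> \<gamma> \<in> carrier \<Gamma> \<and> (\<exists>a\<in>Eu. a \<in> E \<gamma>)"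
proof -
  have "E \<gamma> \<noteq> {0} \<longleftrightarrow> (\<exists>a\<in>E \<gamma>. a \<noteq> 0)" if "\<gamma> \<in> carrier \<Gamma>"
    using component_zero[OF that] by blast
  moreover have "(\<exists>a\<in>E \<gamma>. a \<noteq> 0) \<longleftrightarrow> (\<exists>a\<in>Eu. a \<in> E \<gamma>)" if "\<gamma> \<in> carrier \<Gamma>"
    using unit_groupI that U_nonzero by blast
  ultimately show ?thesis by (auto simp: degrees_def)
qed

lemma Z_mem: "z \<in> Z \<longleftrightarrow> z \<noteq> 0 \<and> (\<exists>\<gamma>\<in>carrier \<Gamma>. z \<in> central_part E \<gamma>)"
  by (auto simp: Z_def mem_U central_part_def)

lemma degrees_central_iff: "\<gamma> \<in> degrees \<Gamma> (central_part E) \<longleftrightarrow> \<gamma> \<in> carrier \<Gamma> \<and> (\<exists>z\<in>Z. z \<in> E \<gamma>)"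
proof -
  have "0 \<in> central_part E \<gamma>" if "\<gamma> \<in> carrier \<Gamma>"
    using component_zero[OF that] central_closed(1) by (simp add: central_part_def)
  then have "central_part E \<gamma> \<noteq> {0} \<longleftrightarrow> (\<exists>z\<in>central_part E \<gamma>. z \<noteq> 0)" if "\<gamma> \<in> carrier \<Gamma>"
    using that by blast
  moreover have "(\<exists>z\<in>central_part E \<gamma>. z \<noteq> 0) \<longleftrightarrow> (\<exists>z\<in>Z. z \<in> E \<gamma>)" if "\<gamma> \<in> carrier \<Gamma>"
    using that unit_groupI Z_U[THEN U_nonzero] unfolding Z_def central_part_def by blast
  ultimately show ?thesis by (auto simp: degrees_def)
qed

lemma mem_power: "\<gamma> \<in> carrier \<Gamma> \<Longrightarrow> a \<in> E \<gamma> \<Longrightarrow> a ^ k \<in> E (\<gamma> [^] (k::nat))"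
proof (induction k)
  case 0
  then show ?case using one_mem by simp
next
  case (Suc k)
  then show ?case
    using component_mult[of "\<gamma> [^] k" \<gamma> "a ^ k" a] by (simp add: power_Suc2 del: power_Suc)
qed

lemma subgroup_degrees_of:
  assumes S: "subgroup S U"
  shows "subgroup {\<gamma> \<in> carrier \<Gamma>. \<exists>a\<in>S. a \<in> E \<gamma>} \<Gamma>"
proof
  show "deg0 \<in> {\<gamma> \<in> carrier \<Gamma>. \<exists>a\<in>S. a \<in> E \<gamma>}"
    using one_mem subgroup.one_closed[OF S] by (auto simp: U_one)
  fix \<gamma> assume "\<gamma> \<in> {\<gamma> \<in> carrier \<Gamma>. \<exists>a\<in>S. a \<in> E \<gamma>}"
  then obtain a where a: "\<gamma> \<in> carrier \<Gamma>" "a \<in> S" "a \<in> E \<gamma>" by blast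
  have "iv a \<in> E (inv \<gamma>)"
    using a subgroup.subset[OF S] U_nonzero by (intro iv_mem) auto
  then show "inv \<gamma> \<in> {\<gamma> \<in> carrier \<Gamma>. \<exists>a\<in>S. a \<in> E \<gamma>}"
    using a subgroup.m_inv_closed[OF S a(2)] by auto
  fix \<delta> assume "\<delta> \<in> {\<gamma> \<in> carrier \<Gamma>. \<exists>a\<in>S. a \<in> E \<gamma>}"
  then obtain b where b: "\<delta> \<in> carrier \<Gamma>" "b \<in> S" "b \<in> E \<delta>" by blast
  have "a * b \<in> S" using subgroup.m_closed[OF S a(2) b(2)] by (simp add: U_mult)
  then show "\<gamma> \<otimes> \<delta> \<in> {\<gamma> \<in> carrier \<Gamma>. \<exists>a\<in>S. a \<in> E \<gamma>}"
    using a(1) b(1) component_mult[OF a(1) b(1) a(3) b(3)] by auto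
qed auto

lemma subgroup_degrees: "subgroup (degrees \<Gamma> E) \<Gamma>"
proof -
  have "degrees \<Gamma> E = {\<gamma> \<in> carrier \<Gamma>. \<exists>a\<in>Eu. a \<in> E \<gamma>}" using degrees_iff by blast
  then show ?thesis using subgroup_degrees_of[OF group.subgroup_self[OF group_U]] by simp
qed

lemma subgroup_degrees_central: "subgroup (degrees \<Gamma> (central_part E)) \<Gamma>"
proof -
  have "degrees \<Gamma> (central_part E) = {\<gamma> \<in> carrier \<Gamma>. \<exists>a\<in>Z. a \<in> E \<gamma>}"
    using degrees_central_iff by blast
  then show ?thesis using subgroup_degrees_of[OF subgroup_Z] by simp
qed

text \<open>If a central \<open>z\<close> has the degree of \<open>a ^ k\<close>, their quotient has
  degree 0 and is central by total ramification.\<close>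

lemma power_degree_central_iff:
  assumes "a \<in> Eu" "a \<in> E \<gamma>" "\<gamma> \<in> carrier \<Gamma>"
  shows "\<gamma> [^] (k::nat) \<in> degrees \<Gamma> (central_part E) \<longleftrightarrow> a ^ k \<in> Z"
proof
  assume "a ^ k \<in> Z"
  then show "\<gamma> [^] k \<in> degrees \<Gamma> (central_part E)"
    using mem_power[OF assms(3,2), of k] assms(3) by (auto simp: degrees_central_iff)
next
  assume "\<gamma> [^] k \<in> degrees \<Gamma> (central_part E)"
  then obtain z where z: "z \<in> Z" "z \<in> E (\<gamma> [^] k)" by (auto simp: degrees_central_iff)
  have aU: "a ^ k \<in> Eu" by (rule U_power[OF assms(1)])
  have "a ^ k * iv z \<in> E deg0"
    by (rule same_degree_quotient[OF _ mem_power[OF assms(3,2)] z(2) U_nonzero[OF Z_U[OF z(1)]]])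
      (use assms(3) in simp)
  moreover have "a ^ k * iv z \<in> Eu" using aU z by (simp add: Z_U)
  ultimately have "a ^ k * iv z \<in> Z" using degree0_Z U_nonzero by blast
  then have "a ^ k * iv z * z \<in> Z" using z(1) by (rule Z_mult)
  then show "a ^ k \<in> Z" using z by (simp add: Z_U)
qed

text \<open>The degree map identifies E^*/T^* with the quotient of the degree groups, because units
  of degree 0 are central; so the two exponents agree. The equivalence is stated for each
  \<open>k\<close> so that the \<open>LEAST\<close> in \<open>group_exponent\<close> can be
  rewritten under its binder.\<close>

lemma exponent_characterization:
  "(\<forall>x\<in>carrier ((\<Gamma> \<restriction> degrees \<Gamma> E) Mod degrees \<Gamma> (central_part E)).
      x [^]\<^bsub>(\<Gamma> \<restriction> degrees \<Gamma> E) Mod degrees \<Gamma> (central_part E)\<^esub> (k::nat)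
        = \<one>\<^bsub>(\<Gamma> \<restriction> degrees \<Gamma> E) Mod degrees \<Gamma> (central_part E)\<^esub>)
    \<longleftrightarrow> (\<forall>a\<in>Eu. a ^ k \<in> Z)"
proof -
  let ?D = "degrees \<Gamma> E" and ?N = "degrees \<Gamma> (central_part E)"
  let ?G = "\<Gamma> \<restriction> ?D"
  interpret D: comm_group ?G
    by (rule group.group_comm_groupI[OF grading.subgroup_imp_group[OF subgroup_degrees]])
      (simp add: grading.m_comm degrees_def)
  have "?N \<subseteq> ?D" using Z_U unfolding degrees_iff degrees_central_iff subset_iff by blast
  then have sub: "subgroup ?N ?G"
    using grading.subgroup_incl[OF subgroup_degrees_central subgroup_degrees] by simp
  then have normal: "?N \<lhd> ?G" by (simp add: D.normal_iff_subgroup)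
  have pow: "\<gamma> [^]\<^bsub>?G\<^esub> k = \<gamma> [^] k" for \<gamma>
    using grading.nat_pow_consistent[of \<gamma> k ?D] by simp
  have "(?N #>\<^bsub>?G\<^esub> \<gamma>) [^]\<^bsub>?G Mod ?N\<^esub> k = \<one>\<^bsub>?G Mod ?N\<^esub> \<longleftrightarrow> \<gamma> [^] k \<in> ?N"
    if g: "\<gamma> \<in> ?D" for \<gamma>
  proof -
    have gc: "\<gamma> [^]\<^bsub>?G\<^esub> k \<in> carrier ?G" using g by (intro D.nat_pow_closed) simp
    have "(?N #>\<^bsub>?G\<^esub> \<gamma>) [^]\<^bsub>?G Mod ?N\<^esub> k = ?N #>\<^bsub>?G\<^esub> (\<gamma> [^]\<^bsub>?G\<^esub> k)"
      using g by (intro normal.FactGroup_pow[OF normal]) simp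
    moreover have "?N #>\<^bsub>?G\<^esub> (\<gamma> [^]\<^bsub>?G\<^esub> k) = ?N \<longleftrightarrow> \<gamma> [^]\<^bsub>?G\<^esub> k \<in> ?N"
      using D.coset_join1[OF _ gc sub] D.coset_join2[OF gc sub] by blast
    ultimately show ?thesis by (simp add: pow)
  qed
  then have "(\<forall>x\<in>carrier (?G Mod ?N). x [^]\<^bsub>?G Mod ?N\<^esub> k = \<one>\<^bsub>?G Mod ?N\<^esub>) \<longleftrightarrow> (\<forall>\<gamma>\<in>?D. \<gamma> [^] k \<in> ?N)"
    unfolding carrier_FactGroup by auto
  also have "\<dots> \<longleftrightarrow> (\<forall>a\<in>Eu. a ^ k \<in> Z)"
  proof
    assume l: "\<forall>\<gamma>\<in>?D. \<gamma> [^] k \<in> ?N"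
    show "\<forall>a\<in>Eu. a ^ k \<in> Z"
    proof
      fix a assume a: "a \<in> Eu"
      then obtain \<gamma> where g: "\<gamma> \<in> carrier \<Gamma>" "a \<in> E \<gamma>" by (auto simp: mem_U)
      then have "\<gamma> \<in> ?D" using a degrees_iff by blast
      then show "a ^ k \<in> Z" using l power_degree_central_iff[OF a g(2,1)] by blast
    qed
  next
    assume r: "\<forall>a\<in>Eu. a ^ k \<in> Z"
    show "\<forall>\<gamma>\<in>?D. \<gamma> [^] k \<in> ?N"
    proof
      fix \<gamma> assume "\<gamma> \<in> ?D"
      then obtain a where "\<gamma> \<in> carrier \<Gamma>" "a \<in> Eu" "a \<in> E \<gamma>" by (auto simp: degrees_iff)
      then show "\<gamma> [^] k \<in> ?N" using r power_degree_central_iff by blast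
    qed
  qed
  finally show ?thesis .
qed

lemma e_Least: "e = (LEAST k. 0 < k \<and> (\<forall>a\<in>Eu. a ^ k \<in> Z))"
  unfolding e_def group_exponent_def exponent_characterization ..

lemma e_pos: "e > 0" and power_e_Z: "a \<in> Eu \<Longrightarrow> a ^ e \<in> Z"
proof -
  \<comment> \<open>A \<open>LEAST\<close> says nothing unless some \<open>k\<close> qualifies;
    \<open>n\<close> does.\<close>
  have "0 < n \<and> (\<forall>a\<in>Eu. a ^ n \<in> Z)" using n_pos power_index_Z by blast
  from LeastI[where P = "\<lambda>k. 0 < k \<and> (\<forall>a\<in>Eu. a ^ k \<in> Z)", OF this]
  show "e > 0" "a \<in> Eu \<Longrightarrow> a ^ e \<in> Z" unfolding e_Least by blast+
qed

lemma e_le: "0 < k \<Longrightarrow> (\<And>a. a \<in> Eu \<Longrightarrow> a ^ k \<in> Z) \<Longrightarrow> e \<le> k"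
  unfolding e_Least by (rule Least_le) blast

lemma e_dvd_n: "e dvd n"
proof -
  have Zp: "a ^ (n mod e) \<in> Z" if a: "a \<in> Eu" for a
  proof -
    have "a ^ n = (a ^ e) ^ (n div e) * a ^ (n mod e)"
      unfolding power_mult[symmetric] power_add[symmetric] by simp
    then have "iv ((a ^ e) ^ (n div e)) * a ^ n = a ^ (n mod e)"
      using a by (simp add: U_power)
    moreover have "iv ((a ^ e) ^ (n div e)) * a ^ n \<in> Z"
      by (rule Z_mult[OF Z_inverse[OF Z_power[OF power_e_Z[OF a]]] power_index_Z[OF a]])
    ultimately show ?thesis by simp
  qed
  have "e \<le> n mod e" if "0 < n mod e" by (rule e_le[OF that Zp])
  then have "n mod e = 0" using mod_less_divisor[OF e_pos, of n] by linarith
  then show ?thesis by auto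
qed

lemma normal_Z: "Z \<lhd> U"
proof (rule group.normal_invI[OF group_U subgroup_Z])
  fix x h assume "x \<in> Eu" "h \<in> Z"
  moreover from this have "x * h * iv x = h" by (simp add: Z_commute[symmetric] mult.assoc)
  ultimately show "x \<otimes>\<^bsub>U\<^esub> h \<otimes>\<^bsub>U\<^esub> iv x \<in> Z" by (simp add: U_mult)
qed

text \<open>By \<open>basis_representative\<close> and \<open>basis_inequivalent\<close>,
  \<open>B\<close> is a transversal of T^* in E^*.\<close>

lemma order_quotient_Z: "Coset.order (U Mod Z) = n\<^sup>2"
proof -
  have eq: "carrier (U Mod Z) = (\<lambda>x. Z #>\<^bsub>U\<^esub> x) ` B"
    unfolding carrier_FactGroup
  proof (intro equalityI subsetI)
    fix C assume "C \<in> (\<lambda>x. Z #>\<^bsub>U\<^esub> x) ` Eu"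
    then obtain u where u: "u \<in> Eu" "C = Z #>\<^bsub>U\<^esub> u" by blast
    obtain b where b: "b \<in> B" "u * iv b \<in> Z" using basis_representative[OF u(1)] by blast
    then have "C = Z #>\<^bsub>U\<^esub> b" using u units.rcos_eq_iff[OF subgroup_Z u(1) B_U[OF b(1)]] by simp
    then show "C \<in> (\<lambda>x. Z #>\<^bsub>U\<^esub> x) ` B" using b by blast
  qed (use B_U in blast)
  have "inj_on (\<lambda>x. Z #>\<^bsub>U\<^esub> x) B"
  proof (rule inj_onI)
    fix b b' assume b: "b \<in> B" "b' \<in> B" "Z #>\<^bsub>U\<^esub> b = Z #>\<^bsub>U\<^esub> b'"
    then have "b * iv b' \<in> Z" using units.rcos_eq_iff[OF subgroup_Z B_U B_U] by blast
    moreover have "b = (b * iv b') * b'" using B_U[OF b(2)] by simp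
    ultimately show "b = b'" using basis_inequivalent b by blast
  qed
  then show ?thesis unfolding Coset.order_def eq by (simp add: card_image B_card)
qed

text \<open>Cauchy's theorem for E^*/T^*, of order n^2, taken from Sylow's theorem with exponent 1:
  there is an element of order \<open>p\<close>, and its order divides \<open>e\<close>. It serves
  the case of odd \<open>e\<close>.\<close>

lemma prime_dvd_exponent:
  assumes p: "prime p" "p dvd n"
  shows "p dvd e"
proof -
  let ?Q = "U Mod Z"
  interpret Q: group ?Q by (rule normal.factorgroup_is_group[OF normal_Z])
  obtain r where "n = p * r" using p by blast
  then have "Coset.order ?Q = p ^ 1 * (r * n)" by (simp add: order_quotient_Z power2_eq_square)
  moreover have "finite (carrier ?Q)"
    using order_quotient_Z n_pos by (metis card.infinite Coset.order_def power_not_zero neq0_conv)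
  ultimately obtain H where H: "subgroup H ?Q" "card H = p ^ 1"
    using sylow_thm[OF p(1) Q.is_group] by blast
  have "H \<noteq> {\<one>\<^bsub>?Q\<^esub>}" using H p(1) prime_gt_1_nat[of p] by auto
  then obtain x where x: "x \<in> H" "x \<noteq> \<one>\<^bsub>?Q\<^esub>" using subgroup.one_closed[OF H(1)] by blast
  have xQ: "x \<in> carrier ?Q" using x H(1) subgroup.subset by blast
  interpret H: group "?Q\<lparr>carrier := H\<rparr>" by (rule Q.subgroup_imp_group[OF H(1)])
  have "x [^]\<^bsub>?Q\<^esub> p = \<one>\<^bsub>?Q\<^esub>"
    using H.pow_order_eq_1[of x] x H(2) Q.nat_pow_consistent[of x p H]
    by (simp add: Coset.order_def del: one_FactGroup)
  then have "Q.ord x dvd p" using Q.pow_eq_id[OF xQ] by simp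
  moreover have "Q.ord x \<noteq> 1" using Q.ord_eq_1[OF xQ] x(2) by simp
  ultimately have "Q.ord x = p" using p(1) by (metis prime_nat_iff)
  moreover have "x [^]\<^bsub>?Q\<^esub> e = \<one>\<^bsub>?Q\<^esub>"
  proof -
    obtain u where u: "u \<in> Eu" "x = Z #>\<^bsub>U\<^esub> u" using xQ by (auto simp: carrier_FactGroup)
    have "x [^]\<^bsub>?Q\<^esub> e = Z #>\<^bsub>U\<^esub> (u ^ e)"
      unfolding u(2) using normal.FactGroup_pow[OF normal_Z u(1), of e] by (simp add: U_pow)
    also have "\<dots> = Z"
      using units.coset_join2[OF U_power[OF u(1)] subgroup_Z power_e_Z[OF u(1)]] .
    finally show ?thesis by simp
  qed
  ultimately show ?thesis using Q.pow_eq_id[OF xQ] by simp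
qed

section \<open>Roots of unity and the commutator group\<close>

abbreviation "mu \<equiv> mu_T0 \<Gamma> E"
abbreviation "CM \<equiv> commutators \<Gamma> E"

lemma iota_center: "center_to_closure t = iota (of_center t)"
  by (simp add: center_to_closure_def iota_def tf_def)

lemma iota_power_eq_1_iff: "x \<in> range of_center \<Longrightarrow> iota x ^ k = 1 \<longleftrightarrow> x ^ k = 1"
  using iota_eq_iff[of "x ^ k" 1] iota_power[of x k] by (simp add: central_closed)

lemma mu_T0_eq: "mu k = {x \<in> E deg0. x \<noteq> 0 \<and> x ^ k = 1}"
proof (intro equalityI subsetI)
  fix x assume "x \<in> mu k"
  then show "x \<in> {x \<in> E deg0. x \<noteq> 0 \<and> x ^ k = 1}"
    by (auto simp: mu_T0_def roots_of_unity_def iota_center iota_power_eq_1_iff central_part_degree0)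
next
  fix x assume x: "x \<in> {x \<in> E deg0. x \<noteq> 0 \<and> x ^ k = 1}"
  then have r: "x \<in> range of_center" using degree0_central by blast
  then obtain t where t: "x = of_center t" by blast
  have "iota x ^ k = 1" using x iota_power_eq_1_iff[OF r] by simp
  then show "x \<in> mu k"
    using x unfolding t mu_T0_def roots_of_unity_def by (auto simp: iota_center central_part_degree0)
qed

lemma mu_Z: "x \<in> mu k \<Longrightarrow> x \<in> Z"
  by (auto simp: mu_T0_eq intro: degree0_Z)

lemma E0_mult: "x \<in> E deg0 \<Longrightarrow> y \<in> E deg0 \<Longrightarrow> x * y \<in> E deg0"
  using component_mult[of deg0 deg0 x y] by simp

lemma E0_inverse: "x \<in> E deg0 \<Longrightarrow> x \<noteq> 0 \<Longrightarrow> iv x \<in> E deg0"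
  using iv_mem[of deg0 x] by simp

lemma mu_mult:
  assumes "x \<in> mu k" "y \<in> mu k"
  shows "x * y \<in> mu k"
  using assms Z_power_mult[OF mu_Z[OF assms(1)], of y k] by (auto simp: mu_T0_eq E0_mult)

lemma mu_inverse:
  assumes "x \<in> mu k"
  shows "iv x \<in> mu k"
proof -
  have xU: "x \<in> Eu" using mu_Z[OF assms] by (rule Z_U)
  have "iv x \<in> E deg0" using assms E0_inverse by (auto simp: mu_T0_eq)
  moreover have "iv x \<noteq> 0" using xU U_nonzero units.inv_closed by blast
  moreover have "iv x ^ k = 1" using assms iv_power[OF xU, of k] by (simp add: mu_T0_eq)
  ultimately show ?thesis by (simp add: mu_T0_eq)
qed

lemma subgroup_mu: "subgroup (mu k) U"
  by unfold_locales
    (auto simp: U_mult U_one mu_mult mu_inverse Z_U mu_Z, auto simp: mu_T0_eq one_mem)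

lemma cm_mu: 
  assumes "g \<in> Eu" "h \<in> Eu"
  shows "cm g h \<in> mu e"
proof -
  have "cm g h ^ e = cm g (h ^ e)" using assms by (simp add: cm_power_right)
  also have "\<dots> = 1" using power_e_Z assms by (simp add: cm_Z_right)
  finally show ?thesis using cm_degree assms U_nonzero[OF cm_U] by (simp add: mu_T0_eq)
qed

lemma commutators_generate: "CM = generate U {cm g h |g h. g \<in> Eu \<and> h \<in> Eu}"
proof -
  have "derived_set U (Eu) = {cm g h |g h. g \<in> Eu \<and> h \<in> Eu}"
    by (auto simp: cm_def U_mult)
  then show ?thesis by (simp add: commutators_def derived_def)
qed

lemma subgroup_commutators: "subgroup (CM) U"
  unfolding commutators_def by (rule group.derived_is_subgroup[OF group_U]) simp

lemma commutators_subset_mu: "CM \<subseteq> mu e"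
proof
  fix x assume "x \<in> CM"
  then show "x \<in> mu e"
    unfolding commutators_generate
  proof (induction rule: generate.induct)
    case one
    then show ?case using subgroup.one_closed[OF subgroup_mu] by simp
  next
    case (incl h)
    then show ?case using cm_mu by blast
  next
    case (inv h)
    then show ?case using cm_mu mu_inverse by blast
  next
    case (eng h1 h2)
    then show ?case using mu_mult by (simp add: U_mult)
  qed
qed

lemma roots_of_unity_bound:
  "finite (roots_of_unity e :: 'a closure set)"
  "card (roots_of_unity e :: 'a closure set) \<le> e"
proof -
  let ?p = "monom 1 e - 1 :: 'a closure poly"
  have "coeff ?p e = 1" using e_pos by simp
  then have nz: "?p \<noteq> 0" by (metis coeff_0 zero_neq_one)
  have eq: "roots_of_unity e = {z. poly ?p z = 0}" by (simp add: roots_of_unity_def poly_monom)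
  have "degree ?p \<le> e" by (rule degree_diff_le) (auto simp: degree_monom_le)
  moreover have "card {z. poly ?p z = 0} \<le> degree ?p" by (rule card_poly_roots_bound[OF nz])
  ultimately show "card (roots_of_unity e :: 'a closure set) \<le> e" unfolding eq by simp
  show "finite (roots_of_unity e :: 'a closure set)"
    unfolding eq by (rule poly_roots_finite[OF nz])
qed

lemma iota_mu: "iota ` mu e \<subseteq> roots_of_unity e"
proof
  fix y assume "y \<in> iota ` mu e"
  then obtain x where x: "x \<in> mu e" "y = iota x" by blast
  then have "iota x ^ e = 1"
    using iota_power_eq_1_iff[OF Z_range[OF mu_Z[OF x(1)]]] by (simp add: mu_T0_eq)
  then show "y \<in> roots_of_unity e" using x by (simp add: roots_of_unity_def)
qed

lemma inj_iota_mu: "inj_on iota (mu e)"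
  using mu_Z Z_range by (intro inj_onI) (metis iota_eq_iff)

lemma finite_mu: "finite (mu e)"
  using finite_subset[OF iota_mu roots_of_unity_bound(1)] inj_iota_mu by (rule finite_imageD)

text \<open>By Lagrange, every commutator has order dividing \<open>|E'|\<close>.\<close>

lemma e_le_card_commutators: "e \<le> card (CM)"
proof (rule e_le)
  let ?C = "CM"
  interpret C: group "U\<lparr>carrier := ?C\<rparr>" by (rule units.subgroup_imp_group[OF subgroup_commutators])
  have pow: "x ^ card ?C = 1" if "x \<in> ?C" for x
    using C.pow_order_eq_1[of x] that monoid.nat_pow_consistent[OF group.is_monoid[OF group_U], of x "card ?C" ?C]
    by (simp add: Coset.order_def U_pow U_one)
  have "finite ?C" using commutators_subset_mu finite_mu by (rule finite_subset)
  then show "card ?C > 0" using subgroup.one_closed[OF subgroup_commutators] by (auto simp: card_gt_0_iff)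
  fix a assume a: "a \<in> Eu"
  have "cm g (a ^ card ?C) = 1" if g: "g \<in> Eu" for g
  proof -
    have "cm g a \<in> ?C" unfolding commutators_generate using g a by (intro generate.incl) blast
    then show ?thesis using pow g a by (simp add: cm_power_right)
  qed
  then show "a ^ card ?C \<in> Z" using Z_iff_cm[of "a ^ card ?C"] a U_power by blast
qed

lemma card_mu_le: "card (mu e) \<le> e"
  using card_mono[OF roots_of_unity_bound(1) iota_mu] roots_of_unity_bound(2)
  by (simp add: card_image[OF inj_iota_mu])

text \<open>A squeeze: \<open>e\<close> is at most the order of E', which lies in
  \<open>mu e\<close>, and \<open>mu e\<close> embeds into the at most \<open>e\<close> roots of X^e
  - 1. The same count gives \<open>card_mu\<close> and \<open>roots_of_unity_eq\<close>; in
  particular X^e - 1 has \<open>e\<close> distinct roots.\<close>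

lemma commutators_eq_mu: "CM = mu e"
  using card_mu_le e_le_card_commutators by (intro card_seteq[OF finite_mu commutators_subset_mu]) simp

lemma card_mu: "card (mu e) = e"
  using card_mu_le e_le_card_commutators by (simp add: commutators_eq_mu)

lemma roots_of_unity_eq: "roots_of_unity e = iota ` mu e"
  using card_seteq[OF roots_of_unity_bound(1) iota_mu] roots_of_unity_bound(2)
  by (simp add: card_image[OF inj_iota_mu] card_mu)

lemma roots_of_unity_subset:
  "roots_of_unity e \<subseteq> center_to_closure ` {t. of_center t \<in> central_part E deg0}"
proof
  fix y :: "'a closure" assume "y \<in> roots_of_unity e"
  then obtain x where x: "x \<in> mu e" "y = iota x" using roots_of_unity_eq by blast
  then obtain t where t: "x = of_center t" using Z_range[OF mu_Z] by blast
  then show "y \<in> center_to_closure ` {t. of_center t \<in> central_part E deg0}"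
    using x by (auto simp: iota_center central_part_degree0 mu_T0_eq)
qed

text \<open>From \<open>nrd a = 1\<close> follows that a^n is 1 or -1, an element of degree 0. As
  \<open>\<Gamma>\<close> is torsion-free, \<open>a\<close> itself has degree 0, hence is central,
  and there the norm is a^n without a sign.\<close>

lemma Nrd_one_eq: "Nrd_one \<Gamma> E = mu n"
proof (intro equalityI subsetI)
  fix a assume "a \<in> Nrd_one \<Gamma> E"
  then have a: "a \<in> Eu" "Nrd a = 1" by (auto simp: Nrd_one_def)
  then have "tf (nrd a) = tf 1" by (simp add: Nrd_homogeneous)
  then have 1: "nrd a = 1" using tf_eq_iff[OF Z_range[OF nrd_Z[OF a(1)]] central_closed(2)] by simp
  have "a ^ n = 1 \<or> a ^ n = - 1" using nrd_sign[OF a(1)] 1 by (metis minus_minus)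
  moreover have "- 1 \<in> E deg0" using component_minus[OF _ one_mem] by simp
  ultimately have an: "a ^ n \<in> E deg0" using one_mem by auto
  have an0: "a ^ n \<noteq> 0" using U_nonzero[OF U_power[OF a(1)]] .
  obtain \<gamma> where g: "\<gamma> \<in> carrier \<Gamma>" "a \<in> E \<gamma>" using a by (auto simp: mem_U)
  have "\<gamma> [^] n = deg0" using degree_unique[OF _ _ mem_power[OF g] an an0] g by simp
  then have "\<gamma> = deg0" using torsion_free[OF g(1) n_pos] by simp
  then have a0: "a \<in> E deg0" "a \<noteq> 0" using g U_nonzero[OF a(1)] by auto
  then have "a ^ n = 1" using nrd_central[OF degree0_Z[OF a0]] 1 by simp
  then show "a \<in> mu n" using a0 by (simp add: mu_T0_eq)
next
  fix a assume a: "a \<in> mu n"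
  have "nrd a = 1" using nrd_central[OF mu_Z[OF a]] a by (simp add: mu_T0_eq)
  then show "a \<in> Nrd_one \<Gamma> E" using Z_U[OF mu_Z[OF a]] by (simp add: Nrd_one_def Nrd_homogeneous)
qed

lemma mu_e_subset_n: "mu e \<subseteq> mu n"
  using e_dvd_n by (auto simp: mu_T0_eq power_mult)

end

section \<open>The involution\<close>

locale ramified_unitary_involution = totally_ramified_exponent \<Gamma> E B n e
  for \<Gamma> :: "('g, 'h) monoid_scheme" (structure) and E :: "'g \<Rightarrow> 'a::ring_1_no_zero_divisors set"
    and B :: "'a set" and n e :: nat +
  fixes \<tau> :: "'a \<Rightarrow> 'a"
  assumes involution: "graded_involution \<Gamma> E \<tau>"
    and unitary: "unitary \<tau>"
    and unramified: "degrees \<Gamma> (central_part E) = degrees \<Gamma> (fixed_part E \<tau>)"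
begin

lemma tau_add: "\<tau> (x + y) = \<tau> x + \<tau> y"
  and tau_mult: "\<tau> (x * y) = \<tau> y * \<tau> x"
  and tau_tau [simp]: "\<tau> (\<tau> x) = x"
  and tau_image: "\<gamma> \<in> carrier \<Gamma> \<Longrightarrow> \<tau> ` E \<gamma> = E \<gamma>"
  using involution by (auto simp: graded_involution_def)

lemma tau_mem: "\<gamma> \<in> carrier \<Gamma> \<Longrightarrow> x \<in> E \<gamma> \<Longrightarrow> \<tau> x \<in> E \<gamma>"
  using tau_image by blast

lemma tau_E0: "x \<in> E deg0 \<Longrightarrow> \<tau> x \<in> E deg0"
  by (rule tau_mem) simp_all

lemma tau_0 [simp]: "\<tau> 0 = 0"
  using tau_add[of 0 0] by simp

lemma tau_eq_0_iff [simp]: "\<tau> x = 0 \<longleftrightarrow> x = 0"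
  by (metis tau_tau tau_0)

lemma tau_1 [simp]: "\<tau> 1 = 1"
  using tau_mult[of "\<tau> 1" 1] by simp

lemma tau_uminus: "\<tau> (- x) = - \<tau> x"
  using tau_add[of x "- x"] by (simp add: eq_neg_iff_add_eq_0 add.commute)

lemma tau_diff: "\<tau> (x - y) = \<tau> x - \<tau> y"
  using tau_add[of x "- y"] by (simp add: tau_uminus)

lemma tau_sum: "\<tau> (sum f A) = (\<Sum>i\<in>A. \<tau> (f i))"
  by (induction A rule: infinite_finite_induct) (simp_all add: tau_add)

lemma tau_power: "\<tau> (x ^ k) = \<tau> x ^ k"
  by (induction k) (simp_all add: tau_mult power_commutes)

lemma tau_U: "x \<in> Eu \<Longrightarrow> \<tau> x \<in> Eu"
  unfolding mem_U using tau_mem by auto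

lemma tau_inverse:
  assumes "x \<in> Eu"
  shows "\<tau> (iv x) = iv (\<tau> x)"
proof -
  have "\<tau> x * \<tau> (iv x) = \<tau> (iv x * x)" by (simp add: tau_mult)
  also have "\<dots> = 1" using assms by simp
  finally show ?thesis using iv_eqI[OF tau_U[OF assms]] by simp
qed

lemma tau_central: "x \<in> range of_center \<Longrightarrow> \<tau> x \<in> range of_center"
  unfolding central_iff by (metis tau_mult tau_tau)

lemma tau_Z: "z \<in> Z \<Longrightarrow> \<tau> z \<in> Z"
  by (simp add: Z_def tau_U tau_central)

lemma fixed_part_nonzero:
  assumes "\<gamma> \<in> degrees \<Gamma> (fixed_part E \<tau>)"
  obtains r where "r \<in> fixed_part E \<tau> \<gamma>" "r \<noteq> 0"
proof -
  have g: "\<gamma> \<in> carrier \<Gamma>" "fixed_part E \<tau> \<gamma> \<noteq> {0}" using assms by (auto simp: degrees_def)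
  have "0 \<in> fixed_part E \<tau> \<gamma>"
    using component_zero[OF g(1)] central_closed(1) by (simp add: fixed_part_def central_part_def)
  then show thesis using g that by blast
qed

text \<open>As T is unramified over R, every degree of T carries a nonzero
  \<open>\<tau>\<close>-fixed central element. A homogeneous component of a central element is such
  an element times one of T_0; were \<open>\<tau>\<close> trivial on T_0, all components would be
  fixed and \<open>\<tau>\<close> would be trivial on T.\<close>

lemma tau_nontrivial: "\<exists>t\<in>E deg0. \<tau> t \<noteq> t"
proof (rule ccontr)
  assume "\<not> ?thesis"
  then have triv: "\<tau> t = t" if "t \<in> E deg0" for t using that by blast
  have "\<tau> t = t" if t: "t \<in> range of_center" for t
  proof -
    have "\<tau> (cpt t \<gamma>) = cpt t \<gamma>" for \<gamma>
    proof (cases "cpt t \<gamma> = 0")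
      case False
      then have g: "\<gamma> \<in> carrier \<Gamma>" using cpt_outside by blast
      have c: "cpt t \<gamma> \<in> E \<gamma>" by (rule cpt_mem[OF g])
      have "cpt t \<gamma> \<in> Z"
        using cpt_central[OF t, of \<gamma>] unit_groupI[OF False g c] by (simp add: Z_def)
      then have "\<gamma> \<in> degrees \<Gamma> (fixed_part E \<tau>)"
        using unramified c g degrees_central_iff by blast
      then obtain r where r: "r \<in> fixed_part E \<tau> \<gamma>" "r \<noteq> 0" by (rule fixed_part_nonzero)
      then have r': "r \<in> E \<gamma>" "r \<in> range of_center" "\<tau> r = r"
        by (auto simp: fixed_part_def central_part_def)
      have rU: "r \<in> Eu" by (rule unit_groupI[OF r(2) g r'(1)])
      define u where "u = cpt t \<gamma> * iv r"
      have "\<tau> u = u" unfolding u_def by (rule triv[OF same_degree_quotient[OF g c r'(1) r(2)]])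
      moreover have "cpt t \<gamma> = u * r" using rU by (simp add: u_def)
      moreover have "r * u = u * r" using r'(2) by (simp add: central_iff)
      ultimately show ?thesis using r'(3) by (simp add: tau_mult)
    qed simp
    then have "\<tau> (\<Sum>\<gamma> | cpt t \<gamma> \<noteq> 0. cpt t \<gamma>) = (\<Sum>\<gamma> | cpt t \<gamma> \<noteq> 0. cpt t \<gamma>)"
      by (simp add: tau_sum)
    then show ?thesis by (simp only: sum_cpt)
  qed
  then show False using unitary by (auto simp: unitary_def)
qed

lemma E0_commute: "x \<in> E deg0 \<Longrightarrow> x * y = y * x"
  using degree0_central central_iff by blast

lemma E0_diff: "x \<in> E deg0 \<Longrightarrow> y \<in> E deg0 \<Longrightarrow> x - y \<in> E deg0"
  using component_add[of deg0 x "- y"] component_minus[of deg0 y] by simp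

lemma E0_add: "x \<in> E deg0 \<Longrightarrow> y \<in> E deg0 \<Longrightarrow> x + y \<in> E deg0"
  using component_add[of deg0 x y] by simp

text \<open>The trace \<open>x + \<tau> x\<close> is symmetric. When it vanishes,
  \<open>\<tau> x = - x\<close>, and multiplying by \<open>t - \<tau> t\<close>, which is also sent
  to its negative, gives a symmetric element without dividing by 2.\<close>

lemma symmetric_exists:
  assumes g: "\<gamma> \<in> carrier \<Gamma>" "x \<in> E \<gamma>" "x \<noteq> 0"
  shows "\<exists>s\<in>E \<gamma>. s \<noteq> 0 \<and> \<tau> s = s"
proof (cases "x + \<tau> x = 0")
  case False
  have "\<tau> (x + \<tau> x) = x + \<tau> x" by (simp add: tau_add add.commute)
  moreover have "x + \<tau> x \<in> E \<gamma>" using g by (intro component_add tau_mem)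
  ultimately show ?thesis using False by blast
next
  case True
  then have tx: "\<tau> x = - x" by (simp add: eq_neg_iff_add_eq_0 add.commute)
  obtain t where t: "t \<in> E deg0" "\<tau> t \<noteq> t" using tau_nontrivial by blast
  let ?s = "(t - \<tau> t) * x"
  have d: "t - \<tau> t \<in> E deg0" using t(1) tau_E0 E0_diff by blast
  have "\<tau> ?s = - x * (\<tau> t - t)" by (simp add: tau_mult tau_diff tx)
  also have "\<dots> = x * (t - \<tau> t)" by (simp add: algebra_simps)
  also have "\<dots> = ?s" by (rule E0_commute[OF d, symmetric])
  finally have "\<tau> ?s = ?s" .
  moreover have "?s \<in> E \<gamma>" using component_mult[of deg0 \<gamma> "t - \<tau> t" x] d g by simp
  moreover have "?s \<noteq> 0" using t g by simp
  ultimately show ?thesis by blast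
qed

lemma symmetric_decomposition:
  assumes "a \<in> Eu"
  obtains t s where "t \<in> E deg0" "t \<noteq> 0" "s \<in> Eu" "\<tau> s = s" "a = t * s"
proof -
  obtain \<gamma> where g: "\<gamma> \<in> carrier \<Gamma>" "a \<in> E \<gamma>" "a \<noteq> 0" using assms by (auto simp: mem_U)
  then obtain s where s: "s \<in> E \<gamma>" "s \<noteq> 0" "\<tau> s = s" using symmetric_exists by blast
  have sU: "s \<in> Eu" by (rule unit_groupI[OF s(2) g(1) s(1)])
  show thesis
  proof (rule that)
    show "a * iv s \<in> E deg0" by (rule same_degree_quotient[OF g(1,2) s(1,2)])
    show "a * iv s \<noteq> 0" using assms sU U_nonzero[of "a * iv s"] by simp
    show "a = a * iv s * s" using sU by simp
  qed (fact sU s(3))+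
qed

section \<open>The map a -> a^(1-tau) and Hilbert 90\<close>

abbreviation om :: "'a \<Rightarrow> 'a" where
  "om a \<equiv> one_minus \<Gamma> E \<tau> a"

lemma om_eq: "om a = a * iv (\<tau> a)"
  by (simp add: one_minus_def U_mult)

lemma om_U: "a \<in> Eu \<Longrightarrow> om a \<in> Eu"
  by (simp add: om_eq tau_U)

lemma om_symmetric_factor:
  assumes "t \<in> E deg0" "t \<noteq> 0" "s \<in> Eu" "\<tau> s = s"
  shows "om (t * s) = om t"
proof -
  have tU: "t \<in> Eu" using degree0_Z[OF assms(1,2)] by (rule Z_U)
  have "\<tau> (t * s) = \<tau> t * s" using E0_commute[OF tau_E0[OF assms(1)], of s] assms(4) by (simp add: tau_mult)
  then show ?thesis
    using assms(3) tU tau_U[OF tU] by (simp add: om_eq units.inv_mult_group mult.assoc)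
qed

text \<open>An inverse-free test by which the values of \<open>om\<close> on T_0 are
  identified.\<close>

lemma om_eqI:
  assumes "t \<in> E deg0" "t \<noteq> 0" "t = c * \<tau> t"
  shows "om t = c"
proof -
  have "\<tau> t \<in> Eu" using Z_U[OF degree0_Z[OF assms(1,2)]] by (rule tau_U)
  then show ?thesis using assms(3) by (metis om_eq iv_cancel(3))
qed

lemma om_E0:
  assumes "t \<in> E deg0" "t \<noteq> 0"
  shows "om t \<in> E deg0" "om t \<noteq> 0" "t = om t * \<tau> t"
proof -
  have U: "t \<in> Eu" "\<tau> t \<in> Eu" using Z_U[OF degree0_Z[OF assms]] tau_U by blast+
  show "om t \<in> E deg0"
    unfolding om_eq by (rule same_degree_quotient) (use assms tau_E0 in auto)
  show "om t \<noteq> 0" using U_nonzero om_U[OF U(1)] by blast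
  show "t = om t * \<tau> t" using U by (simp add: om_eq)
qed

lemma om_mult:
  assumes "t \<in> E deg0" "t \<noteq> 0" "u \<in> E deg0" "u \<noteq> 0"
  shows "om (t * u) = om t * om u"
proof (rule om_eqI)
  have "t * u = (om t * \<tau> t) * (om u * \<tau> u)"
    using om_E0(3)[OF assms(1,2)] om_E0(3)[OF assms(3,4)] by simp
  also have "\<dots> = om t * (om u * (\<tau> t * \<tau> u))"
    using E0_commute[OF tau_E0[OF assms(1)], of "om u"] by (metis mult.assoc)
  also have "\<tau> t * \<tau> u = \<tau> (t * u)"
    using E0_commute[OF tau_E0[OF assms(1)], of "\<tau> u"] by (simp add: tau_mult)
  finally show "t * u = om t * om u * \<tau> (t * u)" by (simp add: mult.assoc)
qed (use assms E0_mult in auto)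

lemma om_inverse:
  assumes "t \<in> E deg0" "t \<noteq> 0"
  shows "om (iv t) = iv (om t)"
proof -
  have tU: "t \<in> Eu" using degree0_Z[OF assms] by (rule Z_U)
  have i: "iv t \<in> E deg0" "iv t \<noteq> 0"
    using E0_inverse[OF assms] U_nonzero[OF units.inv_closed[OF tU]] by auto
  have "om 1 = 1" by (rule om_eqI) (use one_mem in auto)
  then have "om t * om (iv t) = 1" using om_mult[OF assms i] tU by simp
  then show ?thesis using iv_eqI[OF om_U[OF tU]] by simp
qed

lemma tau_om:
  assumes "a \<in> E deg0" "a \<noteq> 0"
  shows "\<tau> (om a) = iv (om a)"
proof -
  have U: "a \<in> Eu" "\<tau> a \<in> Eu" using Z_U[OF degree0_Z[OF assms]] tau_U by blast+
  have "\<tau> (om a) = iv a * \<tau> a" using U by (simp add: om_eq tau_mult tau_inverse)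
  also have "\<dots> = \<tau> a * iv a" by (rule E0_commute[OF E0_inverse[OF assms]])
  finally show ?thesis using U by (simp add: om_eq units.inv_mult_group)
qed

text \<open>The hypothesis gives \<open>1 + \<omega> = \<omega> * \<tau> (1 + \<omega>)\<close>.
  This element vanishes only for \<open>\<omega> = - 1\<close>, where \<open>t - \<tau> t\<close>
  serves instead.\<close>

lemma Hilbert90:
  assumes w: "\<omega> \<in> E deg0" "\<omega> * \<tau> \<omega> = 1"
  obtains t where "t \<in> E deg0" "t \<noteq> 0" "om t = \<omega>"
proof (cases "1 + \<omega> = 0")
  case False
  show thesis
  proof (rule that)
    show t: "1 + \<omega> \<in> E deg0" using one_mem w E0_add by blast
    show "om (1 + \<omega>) = \<omega>"
      by (rule om_eqI[OF t False]) (simp add: tau_add distrib_left w add.commute)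
  qed (rule False)
next
  case True
  then have w1: "\<omega> = - 1" by (simp add: eq_neg_iff_add_eq_0 add.commute)
  obtain t where t: "t \<in> E deg0" "\<tau> t \<noteq> t" using tau_nontrivial by blast
  have d: "t - \<tau> t \<in> E deg0" using t(1) tau_E0 E0_diff by blast
  have nz: "t - \<tau> t \<noteq> 0" using t by simp
  show thesis
    by (rule that[OF d nz], rule om_eqI[OF d nz]) (simp add: tau_diff w1)
qed

abbreviation "PR \<equiv> power_in_R0 \<Gamma> E \<tau>"

lemma PR_eq: "PR k = {a \<in> E deg0. a \<noteq> 0 \<and> \<tau> (a ^ k) = a ^ k}"
proof -
  have "a ^ k \<in> central_part E deg0" if "a \<in> E deg0" for a
  proof -
    have "a ^ k \<in> E deg0" by (induction k) (use that one_mem E0_mult in auto)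
    then show ?thesis by (simp add: central_part_degree0)
  qed
  then show ?thesis
    by (auto simp: power_in_R0_def fixed_part_def central_part_degree0)
qed

text \<open>Raising \<open>t = om t * \<tau> t\<close> to the k-th power gives
  \<open>t ^ k = om t ^ k * \<tau> (t ^ k)\<close>. With \<open>k = n\<close> and
  \<open>k = e\<close>, and with \<open>Hilbert90\<close>, this yields the second isomorphism of the
  theorem.\<close>

lemma PR_iff_mu:
  assumes "t \<in> E deg0" "t \<noteq> 0"
  shows "t \<in> PR k \<longleftrightarrow> om t \<in> mu k"
proof -
  have "t ^ k = (om t * \<tau> t) ^ k" using om_E0(3)[OF assms] by simp
  also have "\<dots> = om t ^ k * \<tau> (t ^ k)"
    using Z_power_mult[OF degree0_Z[OF om_E0(1,2)[OF assms]]] by (simp add: tau_power)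
  finally have eq: "t ^ k = om t ^ k * \<tau> (t ^ k)" .
  have nz: "\<tau> (t ^ k) \<noteq> 0" using assms(2) by simp
  have "\<tau> (t ^ k) = t ^ k \<longleftrightarrow> om t ^ k = 1"
  proof
    assume "\<tau> (t ^ k) = t ^ k"
    then have "1 * \<tau> (t ^ k) = om t ^ k * \<tau> (t ^ k)" using eq by simp
    then show "om t ^ k = 1" using nz by (simp only: mult_cancel_right) simp
  next
    assume "om t ^ k = 1"
    then show "\<tau> (t ^ k) = t ^ k" using eq by simp
  qed
  then show ?thesis using assms om_E0[OF assms] by (simp add: PR_eq mu_T0_eq)
qed

lemma PRD:
  assumes "t \<in> PR k"
  shows "t \<in> E deg0" "t \<noteq> 0" "t \<in> Z" "t \<in> Eu"
  using assms degree0_Z Z_U by (auto simp: PR_eq)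

lemma subgroup_PR: "subgroup (PR k) U"
proof
  show "PR k \<subseteq> Eu" using PRD by blast
  show "\<one>\<^bsub>U\<^esub> \<in> PR k" by (simp add: U_one PR_eq one_mem)
  fix x assume x: "x \<in> PR k"
  note xD = PRD[OF x]
  have nz: "iv x \<noteq> 0" using U_nonzero[OF units.inv_closed[OF xD(4)]] .
  have i: "iv x \<in> E deg0" by (rule E0_inverse[OF xD(1,2)])
  have "om (iv x) \<in> mu k"
    using om_inverse[OF xD(1,2)] mu_inverse PR_iff_mu[OF xD(1,2)] x by simp
  then show "iv x \<in> PR k" using PR_iff_mu[OF i nz] by blast
  fix y assume y: "y \<in> PR k"
  note yD = PRD[OF y]
  have "om (x * y) \<in> mu k"
    using om_mult[OF xD(1,2) yD(1,2)] mu_mult PR_iff_mu[OF xD(1,2), of k]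
      PR_iff_mu[OF yD(1,2), of k] x y by simp
  then show "x \<otimes>\<^bsub>U\<^esub> y \<in> PR k"
    using PR_iff_mu[OF E0_mult[OF xD(1) yD(1)]] xD yD by (simp add: U_mult)
qed

section \<open>The group generated by the symmetric units\<close>

abbreviation "\<Sigma> \<equiv> Sigma_sym \<Gamma> E \<tau>"

lemma subgroup_Sigma: "subgroup \<Sigma> U"
  unfolding Sigma_sym_def by (rule group.generate_is_subgroup[OF group_U]) auto

lemma Sigma_U: "x \<in> \<Sigma> \<Longrightarrow> x \<in> Eu"
  using subgroup.subset[OF subgroup_Sigma] by blast

lemma Sigma_mult: "x \<in> \<Sigma> \<Longrightarrow> y \<in> \<Sigma> \<Longrightarrow> x * y \<in> \<Sigma>"
  using subgroup.m_closed[OF subgroup_Sigma] by (simp add: U_mult)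

lemma Sigma_inverse: "x \<in> \<Sigma> \<Longrightarrow> iv x \<in> \<Sigma>"
  using subgroup.m_inv_closed[OF subgroup_Sigma] by simp

lemma Sigma_symmetric: "s \<in> Eu \<Longrightarrow> \<tau> s = s \<Longrightarrow> s \<in> \<Sigma>"
  unfolding Sigma_sym_def by (rule generate.incl) simp

text \<open>Apply \<open>\<tau>\<close> to \<open>s * s' = u * r\<close>: the left side becomes
  \<open>s' * s\<close>, the right side \<open>\<tau> u * r\<close>, and comparing the two equations
  gives \<open>u = cm s s' * \<tau> u\<close>. Membership of \<open>u\<close> in
  \<open>\<Sigma>\<close> follows from \<open>u = s * s' * iv r\<close>.\<close>

lemma symmetric_mult:
  assumes "s \<in> Eu" "\<tau> s = s" "s' \<in> Eu" "\<tau> s' = s'"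
  obtains u s'' where "u \<in> E deg0" "u \<noteq> 0" "s'' \<in> Eu" "\<tau> s'' = s''"
    "s * s' = u * s''" "om u = cm s s'" "u \<in> \<Sigma>"
proof -
  obtain u r where u: "u \<in> E deg0" "u \<noteq> 0" "r \<in> Eu" "\<tau> r = r" "s * s' = u * r"
    using symmetric_decomposition[of "s * s'"] assms by auto
  have "s' * s = \<tau> (u * r)" using u(5) assms by (metis tau_mult)
  also have "\<dots> = \<tau> u * r" using E0_commute[OF tau_E0[OF u(1)], of r] u(4) by (simp add: tau_mult)
  finally have "u * r = cm s s' * (\<tau> u * r)" using cm_swap[OF assms(1,3)] u(5) by simp
  then have "u * r = (cm s s' * \<tau> u) * r" by (simp add: mult.assoc)
  then have "u = cm s s' * \<tau> u" using U_nonzero[OF u(3)] by simp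
  then have om: "om u = cm s s'" by (rule om_eqI[OF u(1,2)])
  have "s * s' * iv r = u" using u(3,5) by simp
  moreover have "s * s' * iv r \<in> \<Sigma>"
    by (intro Sigma_mult Sigma_inverse Sigma_symmetric assms u)
  ultimately have "u \<in> \<Sigma>" by simp
  with u om that show thesis by blast
qed

lemma decomposition_mult:
  assumes "u \<in> E deg0" "u \<noteq> 0" "s \<in> Eu" "\<tau> s = s"
    and "v \<in> E deg0" "v \<noteq> 0" "r \<in> Eu" "\<tau> r = r"
  obtains w q where "w \<in> E deg0" "w \<noteq> 0" "q \<in> Eu" "\<tau> q = q"
    "(u * s) * (v * r) = (u * v * w) * q" "om w = cm s r"
proof -
  obtain w q where w: "w \<in> E deg0" "w \<noteq> 0" "q \<in> Eu" "\<tau> q = q" "s * r = w * q" "om w = cm s r"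
    by (rule symmetric_mult[OF assms(3,4,7,8)])
  have "(u * s) * (v * r) = u * (v * (s * r))"
    using Z_left_commute[OF degree0_Z[OF assms(5,6)], of s r] by (simp add: mult.assoc)
  also have "\<dots> = (u * v * w) * q" using w(5) by (simp add: mult.assoc)
  finally show thesis using that w by blast
qed

lemma cm_E0_left: 
  assumes "t \<in> E deg0" "t \<noteq> 0" "s \<in> Eu" "g \<in> Eu"
  shows "cm (t * s) g = cm s g" "cm g (t * s) = cm g s"
  using assms degree0_Z[OF assms(1,2)]
  by (simp_all add: cm_mult_left cm_mult_right Z_U cm_Z_left cm_Z_right)

text \<open>Factors from T_0 drop out of commutators, so \<open>g\<close> and \<open>h\<close> may
  be replaced by their symmetric parts.\<close>

lemma cm_eq_om:
  assumes "g \<in> Eu" "h \<in> Eu"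
  obtains u where "u \<in> E deg0" "u \<noteq> 0" "u \<in> \<Sigma>" "om u = cm g h"
proof -
  obtain t s where ts: "t \<in> E deg0" "t \<noteq> 0" "s \<in> Eu" "\<tau> s = s" "g = t * s"
    by (rule symmetric_decomposition[OF assms(1)])
  obtain t' s' where ts': "t' \<in> E deg0" "t' \<noteq> 0" "s' \<in> Eu" "\<tau> s' = s'" "h = t' * s'"
    by (rule symmetric_decomposition[OF assms(2)])
  have "cm g h = cm s s'"
    using cm_E0_left(1)[OF ts(1-3) assms(2)] cm_E0_left(2)[OF ts'(1-3) ts(3)] ts(5) ts'(5) by simp
  then show thesis
    using symmetric_mult[OF ts(3,4) ts'(3,4)] that by metis
qed

text \<open>The values of \<open>om\<close> on the degree-0 part of \<open>\<Sigma>\<close> form a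
  group containing all commutators, and these generate \<open>mu e\<close>. That \<open>u\<close>
  can be taken in \<open>\<Sigma>\<close> is the point for \<open>PR_subset_Sigma\<close>.\<close>

lemma mu_eq_om:
  assumes "\<omega> \<in> mu e"
  shows "\<exists>u\<in>\<Sigma>. u \<in> E deg0 \<and> u \<noteq> 0 \<and> om u = \<omega>"
proof -
  have "\<omega> \<in> generate U {cm g h |g h. g \<in> Eu \<and> h \<in> Eu}"
    using assms commutators_eq_mu commutators_generate by simp
  then show ?thesis
  proof (induction rule: generate.induct)
    case one
    have "om 1 = 1" by (rule om_eqI) (use one_mem in auto)
    then show ?case using subgroup.one_closed[OF subgroup_Sigma] one_mem
      by (intro bexI[of _ 1]) (auto simp: U_one)
  next
    case (incl c)
    then obtain g h where "g \<in> Eu" "h \<in> Eu" "c = cm g h" by blast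
    then show ?case using cm_eq_om[of g h] by metis
  next
    case (inv c)
    then obtain g h where gh: "g \<in> Eu" "h \<in> Eu" "c = cm g h" by blast
    obtain u where u: "u \<in> E deg0" "u \<noteq> 0" "u \<in> \<Sigma>" "om u = cm g h" by (rule cm_eq_om[OF gh(1,2)])
    have "iv u \<noteq> 0" using U_nonzero[OF units.inv_closed[OF Sigma_U[OF u(3)]]] .
    moreover have "om (iv u) = iv c" using om_inverse[OF u(1,2)] u(4) gh(3) by simp
    ultimately show ?case using Sigma_inverse[OF u(3)] E0_inverse[OF u(1,2)] by blast
  next
    case (eng c d)
    then obtain u v where uv: "u \<in> \<Sigma>" "u \<in> E deg0" "u \<noteq> 0" "om u = c" "v \<in> \<Sigma>" "v \<in> E deg0" "v \<noteq> 0" "om v = d"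
      by blast
    have "om (u * v) = c \<otimes>\<^bsub>U\<^esub> d" using om_mult[OF uv(2,3,6,7)] uv by (simp add: U_mult)
    moreover have "u * v \<noteq> 0" using uv by simp
    ultimately show ?case using Sigma_mult[OF uv(1,5)] E0_mult[OF uv(2,6)] by blast
  qed
qed

text \<open>\<open>\<omega>\<close> is a value of \<open>om\<close> on T_0, and T_0 is commutative,
  so \<open>\<tau>\<close> interchanges numerator and denominator.\<close>

lemma tau_mu: "\<omega> \<in> mu e \<Longrightarrow> \<tau> \<omega> = iv \<omega>"
  using mu_eq_om tau_om by blast

text \<open>\<open>om u\<close> lies in \<open>mu e\<close>, hence equals \<open>om w\<close> for
  some \<open>w\<close> in \<open>\<Sigma>\<close> of degree 0; then \<open>u * iv w\<close> is
  symmetric.\<close>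

lemma PR_subset_Sigma:
  assumes "u \<in> PR e"
  shows "u \<in> \<Sigma>"
proof -
  note uD = PRD[OF assms]
  have "om u \<in> mu e" using assms PR_iff_mu[OF uD(1,2)] by blast
  then obtain w where w: "w \<in> \<Sigma>" "w \<in> E deg0" "w \<noteq> 0" "om w = om u" using mu_eq_om by blast
  have wU: "w \<in> Eu" by (rule Sigma_U[OF w(1)])
  have i: "iv w \<in> E deg0" "iv w \<noteq> 0"
    using E0_inverse[OF w(2,3)] U_nonzero[OF units.inv_closed[OF wU]] by auto
  have nz: "u * iv w \<noteq> 0" using uD i by simp
  have "om (u * iv w) = 1"
    using om_mult[OF uD(1,2) i] om_inverse[OF w(2,3)] w(4) om_U[OF uD(4)] by simp
  then have "u * iv w = \<tau> (u * iv w)"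
    using om_E0(3)[OF E0_mult[OF uD(1) i(1)] nz] by simp
  then have "u * iv w \<in> \<Sigma>" using uD wU by (intro Sigma_symmetric) auto
  then have "u * iv w * w \<in> \<Sigma>" using w(1) by (rule Sigma_mult)
  then show ?thesis using wU by simp
qed

text \<open>Multiplying two such products leaves an extra \<open>w\<close> in T_0 with
  \<open>om w\<close> a commutator; \<open>PR_iff_mu\<close> puts \<open>w\<close> into
  \<open>PR e\<close>, so the form persists.\<close>

lemma Sigma_form:
  assumes "x \<in> \<Sigma>"
  shows "\<exists>u s. u \<in> PR e \<and> s \<in> Eu \<and> \<tau> s = s \<and> x = u * s"
proof -
  have one: "1 \<in> PR e" using subgroup.one_closed[OF subgroup_PR] by (simp add: U_one)
  have "x \<in> generate U {a \<in> Eu. \<tau> a = a}" using assms by (simp add: Sigma_sym_def)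
  then show ?thesis
  proof (induction rule: generate.induct)
    case one
    show ?case using \<open>1 \<in> PR e\<close> by (intro exI[of _ 1]) (simp add: U_one)
  next
    case (incl h)
    then show ?case using one by (intro exI[of _ 1] exI[of _ h]) simp
  next
    case (inv h)
    then show ?case using one by (intro exI[of _ 1] exI[of _ "iv h"]) (simp add: tau_inverse)
  next
    case (eng x y)
    then obtain u s v r where us: "u \<in> PR e" "s \<in> Eu" "\<tau> s = s" "x = u * s"
      and vr: "v \<in> PR e" "r \<in> Eu" "\<tau> r = r" "y = v * r" by blast
    obtain w q where w: "w \<in> E deg0" "w \<noteq> 0" "q \<in> Eu" "\<tau> q = q"
      "(u * s) * (v * r) = (u * v * w) * q" "om w = cm s r"
      by (rule decomposition_mult[OF PRD(1,2)[OF us(1)] us(2,3) PRD(1,2)[OF vr(1)] vr(2,3)])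
    have wP: "w \<in> PR e"
      using PR_iff_mu[OF w(1,2)] w(6) cm_mu[OF us(2) vr(2)] by simp
    have "x \<otimes>\<^bsub>U\<^esub> y = (u * v * w) * q" using w(5) us(4) vr(4) by (simp add: U_mult)
    moreover have "u * v * w \<in> PR e"
      using subgroup.m_closed[OF subgroup_PR] us(1) vr(1) wP by (metis U_mult)
    ultimately show ?case using w by blast
  qed
qed

text \<open>In degree 0 the symmetric factor from \<open>Sigma_form\<close> lies in R_0, so it
  belongs to \<open>PR e\<close> too. Together with \<open>PR_subset_Sigma\<close>,
  \<open>\<Sigma>\<close> meets T_0 in exactly \<open>PR e\<close>.\<close>

lemma Sigma_degree0:
  assumes "x \<in> \<Sigma>" "x \<in> E deg0"
  shows "x \<in> PR e"
proof -
  obtain u s where us: "u \<in> PR e" "s \<in> Eu" "\<tau> s = s" "x = u * s"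
    using Sigma_form[OF assms(1)] by blast
  note uD = PRD[OF us(1)]
  have "s = iv u * x" using us uD by simp
  then have "s \<in> E deg0" using E0_mult[OF E0_inverse[OF uD(1,2)] assms(2)] by simp
  then have "s \<in> PR e"
    using us(2,3) U_nonzero by (simp add: PR_eq tau_power)
  then show ?thesis
    using subgroup.m_closed[OF subgroup_PR us(1)] us(4) by (simp add: U_mult)
qed

lemma mu_subset_Sigma: 
  assumes "\<omega> \<in> mu e" shows "\<omega> \<in> \<Sigma>"
  using assms by (intro PR_subset_Sigma) (auto simp: mu_T0_eq PR_eq)

text \<open>Conjugation changes \<open>h\<close> by the factor \<open>cm x h\<close>, an element of
  \<open>mu e\<close> and so of \<open>\<Sigma>\<close>.\<close>

lemma normal_Sigma: "\<Sigma> \<lhd> U"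
proof (rule group.normal_invI[OF group_U subgroup_Sigma])
  fix x h assume x: "x \<in> Eu" and h: "h \<in> \<Sigma>"
  have "x * h * iv x = cm x h * h" using x Sigma_U[OF h] by (simp add: cm_def)
  moreover have "cm x h * h \<in> \<Sigma>"
    using mu_subset_Sigma[OF cm_mu[OF x Sigma_U[OF h]]] h by (rule Sigma_mult)
  ultimately show "x \<otimes>\<^bsub>U\<^esub> h \<otimes>\<^bsub>U\<^esub> iv x \<in> \<Sigma>" by (simp add: U_mult)
qed

text \<open>\<open>nrd a\<close> is \<open>a ^ n\<close> up to sign, and \<open>\<tau>\<close> fixes
  an element iff it fixes its negative. Since T embeds into q(T), the only candidate for
  \<open>r\<close> is \<open>nrd a\<close>.\<close>

lemma Sigma_Nrd_eq: "Sigma_Nrd \<Gamma> E \<tau> = {a \<in> Eu. \<tau> (a ^ n) = a ^ n}"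
proof -
  have "(\<exists>r. of_center r \<in> carrier (unit_group \<Gamma> (fixed_part E \<tau>)) \<and> Nrd a = to_fract r)
      \<longleftrightarrow> \<tau> (a ^ n) = a ^ n" if a: "a \<in> Eu" for a
  proof -
    have nZ: "nrd a \<in> Z" by (rule nrd_Z[OF a])
    obtain s where s: "nrd a = of_center s" using Z_range[OF nZ] by blast
    have N: "Nrd a = to_fract s" by (simp add: Nrd_homogeneous[OF a] s tf_def)
    have "(\<exists>r. of_center r \<in> carrier (unit_group \<Gamma> (fixed_part E \<tau>)) \<and> Nrd a = to_fract r)
        \<longleftrightarrow> nrd a \<in> carrier (unit_group \<Gamma> (fixed_part E \<tau>))"
      by (auto simp: N s)
    also have "\<dots> \<longleftrightarrow> \<tau> (nrd a) = nrd a"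
      using nZ by (auto simp: unit_group_def homogeneous_def fixed_part_def Z_mem)
    also have "\<dots> \<longleftrightarrow> \<tau> (a ^ n) = a ^ n"
      using nrd_sign[OF a] by (auto simp: tau_uminus)
    finally show ?thesis .
  qed
  then show ?thesis by (auto simp: Sigma_Nrd_def)
qed

abbreviation "SN \<equiv> Sigma_Nrd \<Gamma> E \<tau>"

lemma SN_iff:
  assumes "t \<in> E deg0" "t \<noteq> 0" "s \<in> Eu" "\<tau> s = s"
  shows "t * s \<in> SN \<longleftrightarrow> t \<in> PR n"
proof -
  have tZ: "t \<in> Z" by (rule degree0_Z[OF assms(1,2)])
  have p: "(t * s) ^ n = t ^ n * s ^ n" by (rule Z_power_mult[OF tZ])
  have "\<tau> ((t * s) ^ n) = s ^ n * \<tau> (t ^ n)" unfolding p by (simp add: tau_mult tau_power assms(4))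
  also have "\<dots> = \<tau> (t ^ n) * s ^ n" by (rule Z_commute[OF tau_Z[OF Z_power[OF tZ]], symmetric])
  finally have "\<tau> ((t * s) ^ n) = (t * s) ^ n \<longleftrightarrow> \<tau> (t ^ n) * s ^ n = t ^ n * s ^ n" by (simp only: p)
  also have "\<dots> \<longleftrightarrow> \<tau> (t ^ n) = t ^ n" using U_nonzero[OF U_power[OF assms(3)], of n] by (metis mult_cancel_right)
  finally show ?thesis
    using assms tZ by (simp add: Sigma_Nrd_eq PR_eq Z_U)
qed

lemma PR_mono: "PR e \<subseteq> PR n"
proof
  fix t assume t: "t \<in> PR e"
  note tD = PRD[OF t]
  show "t \<in> PR n"
    using t PR_iff_mu[OF tD(1,2)] mu_e_subset_n by blast
qed

lemma PR_subset_SN: "PR n \<subseteq> SN"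
proof
  fix t assume t: "t \<in> PR n"
  show "t \<in> SN" using PRD(4)[OF t] t by (simp add: Sigma_Nrd_eq PR_eq)
qed

text \<open>\<open>a ^ n\<close> need not be multiplicative in \<open>a\<close>, so closure under
  products goes through the decompositions: the extra factor \<open>w\<close> lies in
  \<open>PR e\<close> and hence in \<open>PR n\<close>.\<close>

lemma subgroup_SN: "subgroup SN U"
proof
  show "SN \<subseteq> Eu" by (auto simp: Sigma_Nrd_eq)
  show "\<one>\<^bsub>U\<^esub> \<in> SN" by (simp add: Sigma_Nrd_eq U_one)
  fix x assume x: "x \<in> SN"
  then have xU: "x \<in> Eu" by (simp add: Sigma_Nrd_eq)
  show "iv x \<in> SN"
    using x tau_inverse[OF U_power[OF xU], of n] by (simp add: Sigma_Nrd_eq iv_power[symmetric])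
  fix y assume y: "y \<in> SN"
  then have yU: "y \<in> Eu" by (simp add: Sigma_Nrd_eq)
  obtain u s where us: "u \<in> E deg0" "u \<noteq> 0" "s \<in> Eu" "\<tau> s = s" "x = u * s"
    by (rule symmetric_decomposition[OF xU])
  obtain v r where vr: "v \<in> E deg0" "v \<noteq> 0" "r \<in> Eu" "\<tau> r = r" "y = v * r"
    by (rule symmetric_decomposition[OF yU])
  have uP: "u \<in> PR n" using x us SN_iff by blast
  have vP: "v \<in> PR n" using y vr SN_iff by blast
  obtain w q where w: "w \<in> E deg0" "w \<noteq> 0" "q \<in> Eu" "\<tau> q = q"
    "(u * s) * (v * r) = (u * v * w) * q" "om w = cm s r"
    by (rule decomposition_mult[OF us(1-4) vr(1-4)])
  have "w \<in> PR e"
    using PR_iff_mu[OF w(1,2)] w(6) cm_mu[OF us(3) vr(3)] by simp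
  then have wP: "w \<in> PR n" using PR_mono by blast
  have eq: "x * y = (u * v * w) * q" using w(5) us(5) vr(5) by simp
  have P: "u * v * w \<in> PR n"
    using subgroup.m_closed[OF subgroup_PR] uP vP wP by (metis U_mult)
  then show "x \<otimes>\<^bsub>U\<^esub> y \<in> SN"
    using SN_iff[OF PRD(1,2)[OF P] w(3,4)] by (simp add: U_mult eq)
qed

lemma Sigma_subset_SN: "\<Sigma> \<subseteq> SN"
proof
  fix x assume "x \<in> \<Sigma>"
  then obtain u s where us: "u \<in> PR e" "s \<in> Eu" "\<tau> s = s" "x = u * s"
    using Sigma_form by blast
  then show "x \<in> SN"
    using SN_iff[OF PRD(1,2)[OF us(1)] us(2,3)] PR_mono by blast
qed

text \<open>\<open>om\<close> is multiplicative on T_0, but on E^* only modulo E': the discrepancy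
  is \<open>om w\<close>, the commutator of the symmetric parts.\<close>

lemma om_mult_mod_commutators:
  assumes a: "a \<in> Eu" and b: "b \<in> Eu"
  shows "om (a * b) * iv (om a * om b) \<in> CM"
proof -
  obtain u s where us: "u \<in> E deg0" "u \<noteq> 0" "s \<in> Eu" "\<tau> s = s" "a = u * s"
    by (rule symmetric_decomposition[OF a])
  obtain v r where vr: "v \<in> E deg0" "v \<noteq> 0" "r \<in> Eu" "\<tau> r = r" "b = v * r"
    by (rule symmetric_decomposition[OF b])
  obtain w q where w: "w \<in> E deg0" "w \<noteq> 0" "q \<in> Eu" "\<tau> q = q"
    "(u * s) * (v * r) = (u * v * w) * q" "om w = cm s r"
    by (rule decomposition_mult[OF us(1-4) vr(1-4)])
  have eq: "a * b = (u * v * w) * q" using w(5) us(5) vr(5) by simp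
  have uv: "u * v \<in> E deg0" "u * v \<noteq> 0" using us vr E0_mult by auto
  have "om (a * b) = om (u * v * w)"
    unfolding eq by (rule om_symmetric_factor) (use uv w E0_mult in auto)
  also have "\<dots> = om (u * v) * om w" by (rule om_mult[OF uv w(1,2)])
  also have "om (u * v) = om u * om v" by (rule om_mult[OF us(1,2) vr(1,2)])
  also have "om u = om a" unfolding us(5) by (rule om_symmetric_factor[OF us(1-4), symmetric])
  also have "om v = om b" unfolding vr(5) by (rule om_symmetric_factor[OF vr(1-4), symmetric])
  also have "om a * om b * om w = om w * (om a * om b)"
    unfolding w(6) by (rule Z_commute[OF cm_Z[OF us(3) vr(3)], symmetric])
  finally have "om (a * b) = om w * (om a * om b)" .
  then have "om (a * b) * iv (om a * om b) = om w"
    using om_U[OF a] om_U[OF b] by simp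
  moreover have "om w \<in> CM"
    unfolding commutators_eq_mu w(6) by (rule cm_mu[OF us(3) vr(3)])
  ultimately show ?thesis by simp
qed

lemma mu_T0_inverted_eq: "mu_T0_inverted \<Gamma> E \<tau> k = {\<omega> \<in> mu k. \<omega> * \<tau> \<omega> = 1}"
proof -
  have "\<tau> \<omega> = iv \<omega> \<longleftrightarrow> \<omega> * \<tau> \<omega> = 1" if "\<omega> \<in> mu k" for \<omega>
    using Z_U[OF mu_Z[OF that]] iv_eqI[of \<omega> "\<tau> \<omega>"] by auto
  then show ?thesis by (auto simp: mu_T0_inverted_def)
qed

lemma om_mu_inverted:
  assumes "t \<in> PR k"
  shows "om t \<in> mu_T0_inverted \<Gamma> E \<tau> k"
  using PR_iff_mu[OF PRD(1,2)[OF assms]] tau_om[OF PRD(1,2)[OF assms]] assms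
  by (simp add: mu_T0_inverted_def)

lemma mu_inverted_om:
  assumes "\<omega> \<in> mu_T0_inverted \<Gamma> E \<tau> k"
  obtains t where "t \<in> PR k" "om t = \<omega>"
proof -
  have w: "\<omega> \<in> mu k" "\<omega> * \<tau> \<omega> = 1" using assms by (auto simp: mu_T0_inverted_eq)
  have "\<omega> \<in> E deg0" using w by (simp add: mu_T0_eq)
  then obtain t where t: "t \<in> E deg0" "t \<noteq> 0" "om t = \<omega>" by (rule Hilbert90[OF _ w(2)])
  then show thesis using that PR_iff_mu[OF t(1,2)] w(1) by blast
qed

lemma mu_e_subset_inverted: "mu e \<subseteq> mu_T0_inverted \<Gamma> E \<tau> n"
  using mu_e_subset_n tau_mu by (auto simp: mu_T0_inverted_def)

lemma subgroup_mu_inverted: "subgroup (mu_T0_inverted \<Gamma> E \<tau> n) U"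
proof
  let ?M = "mu_T0_inverted \<Gamma> E \<tau> n"
  show "?M \<subseteq> Eu" using Z_U[OF mu_Z] by (auto simp: mu_T0_inverted_def)
  show "\<one>\<^bsub>U\<^esub> \<in> ?M" by (simp add: mu_T0_inverted_eq mu_T0_eq U_one one_mem)
  fix x assume x: "x \<in> ?M"
  then obtain t where t: "t \<in> PR n" "om t = x" by (rule mu_inverted_om)
  have "iv t \<in> PR n" using subgroup.m_inv_closed[OF subgroup_PR t(1)] by simp
  then show "iv x \<in> ?M" using om_mu_inverted om_inverse[OF PRD(1,2)[OF t(1)]] t(2) by metis
  fix y assume y: "y \<in> ?M"
  then obtain u where u: "u \<in> PR n" "om u = y" by (rule mu_inverted_om)
  have "t * u \<in> PR n"
    using subgroup.m_closed[OF subgroup_PR t(1) u(1)] by (simp add: U_mult)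
  then show "x \<otimes>\<^bsub>U\<^esub> y \<in> ?M"
    using om_mu_inverted om_mult[OF PRD(1,2)[OF t(1)] PRD(1,2)[OF u(1)]] t(2) u(2)
    by (metis U_mult)
qed

text \<open>A fixed root of unity of prime order \<open>p\<close> would lie in \<open>\<mu>\<^sub>e\<close>, where \<open>\<tau>\<close> is
  inversion; so \<open>p = 2\<close>.\<close>

lemma fixed_root_of_unity:
  assumes "odd e" "\<eta> \<in> E deg0" "\<tau> \<eta> = \<eta>" "m dvd n" "\<eta> ^ m = 1"
  shows "\<eta> = 1"
  using assms(4,5)
proof (induction m rule: less_induct)
  case (less m)
  have e0: "\<eta> \<noteq> 0" using less.prems n_pos by (metis dvd_0_left_iff neq0_conv power_eq_0_iff power_0_left zero_neq_one)
  show ?case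
  proof (cases "m = 1")
    case False
    then obtain p where p: "prime p" "p dvd m" by (metis prime_factor_nat)
    then obtain j where j: "m = p * j" by blast
    have m0: "m > 0" using less.prems n_pos by (metis dvd_0_left_iff neq0_conv)
    define \<zeta> where "\<zeta> = \<eta> ^ j"
    have zp: "\<zeta> ^ p = 1" using less.prems(2) by (simp add: \<zeta>_def j power_mult[symmetric] mult.commute)
    have pe: "p dvd e" using prime_dvd_exponent[OF p(1)] p(2) less.prems(1) dvd_trans by blast
    then have "odd p" using assms(1) dvd_trans by blast
    have z0: "\<zeta> \<in> E deg0" unfolding \<zeta>_def by (induction j) (use assms(2) one_mem E0_mult in auto)
    have znz: "\<zeta> \<noteq> 0" using e0 by (simp add: \<zeta>_def)
    have "\<zeta> ^ e = 1" using pe zp by (metis dvdE power_mult power_one)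
    then have "\<tau> \<zeta> = iv \<zeta>" using tau_mu z0 znz by (simp add: mu_T0_eq)
    moreover have "\<tau> \<zeta> = \<zeta>" using assms(3) by (simp add: \<zeta>_def tau_power)
    moreover have "\<zeta> * iv \<zeta> = 1" using Z_U[OF degree0_Z[OF z0 znz]] by simp
    ultimately have "\<zeta> ^ 2 = 1" by (simp add: power2_eq_square)
    moreover obtain i where "p = 2 * i + 1" using \<open>odd p\<close> by (rule oddE)
    ultimately have "\<zeta> = 1" using zp by (simp add: power_add power_mult)
    then have "\<eta> ^ j = 1" by (simp add: \<zeta>_def)
    moreover have "1 * j < p * j"
      using j m0 prime_gt_1_nat[OF p(1)] by (intro mult_strict_right_mono) auto
    then have "j < m" by (simp add: j)
    moreover have "j dvd n" using less.prems(1) j dvd_mult_right by blast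
    ultimately show ?thesis using less.IH by blast
  qed (use less.prems in simp)
qed

text \<open>\<open>\<omega> * \<tau> \<omega>\<close> is a \<open>\<tau>\<close>-fixed n-th root of
  unity in T_0, hence 1 by \<open>fixed_root_of_unity\<close>. This will give surjectivity of
  \<open>\<alpha>\<close> for odd \<open>e\<close>.\<close>

lemma mu_inverted_odd:
  assumes "odd e"
  shows "mu_T0_inverted \<Gamma> E \<tau> n = mu n"
proof -
  have "\<omega> * \<tau> \<omega> = 1" if w: "\<omega> \<in> mu n" for \<omega>
  proof (rule fixed_root_of_unity[OF assms _ _ dvd_refl])
    have w0: "\<omega> \<in> E deg0" "\<omega> ^ n = 1" using w by (auto simp: mu_T0_eq)
    show "\<omega> * \<tau> \<omega> \<in> E deg0" using w0 tau_E0 E0_mult by blast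
    show "\<tau> (\<omega> * \<tau> \<omega>) = \<omega> * \<tau> \<omega>" by (simp add: tau_mult)
    show "(\<omega> * \<tau> \<omega>) ^ n = 1"
      using Z_power_mult[OF mu_Z[OF w], of "\<tau> \<omega>" n] w0 tau_power[of \<omega> n] by simp
  qed
  then show ?thesis by (auto simp: mu_T0_inverted_eq)
qed

end

section \<open>The quotient groups\<close>

text \<open>The first isomorphism theorem for the composite of \<open>f\<close> with the projection
  of \<open>K\<close>. Surjectivity is demanded only modulo \<open>M\<close>, so that
  \<open>f\<close> may be an inclusion of subgroups.\<close>

lemma quotient_iso:
  assumes G: "group G" and K: "group K" and N: "N \<lhd> G" and M: "M \<lhd> K"
    and f: "f \<in> hom G K"
    and ker: "\<And>x. x \<in> carrier G \<Longrightarrow> f x \<in> M \<longleftrightarrow> x \<in> N"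
    and surj: "\<And>y. y \<in> carrier K \<Longrightarrow> \<exists>x\<in>carrier G. y \<otimes>\<^bsub>K\<^esub> inv\<^bsub>K\<^esub> f x \<in> M"
  shows "G Mod N \<cong> K Mod M"
proof -
  interpret K: group K by (rule K)
  have sub: "subgroup M K" by (rule normal_imp_subgroup[OF M])
  have fK: "f x \<in> carrier K" if "x \<in> carrier G" for x using f that by (rule hom_in_carrier)
  let ?h = "\<lambda>x. M #>\<^bsub>K\<^esub> f x"
  have "?h \<in> hom G (K Mod M)"
  proof (rule homI)
    show "?h x \<in> carrier (K Mod M)" if "x \<in> carrier G" for x
      using fK[OF that] by (auto simp: carrier_FactGroup)
    show "?h (x \<otimes>\<^bsub>G\<^esub> y) = ?h x \<otimes>\<^bsub>K Mod M\<^esub> ?h y" if "x \<in> carrier G" "y \<in> carrier G" for x y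
      using normal.rcos_sum[OF M fK[OF that(1)] fK[OF that(2)]] hom_mult[OF f that] by simp
  qed
  then interpret h: group_hom G "K Mod M" ?h
    by (intro group_hom.intro group_hom_axioms.intro G normal.factorgroup_is_group[OF M])
  have "kernel G (K Mod M) ?h = N"
  proof -
    have "?h x = M \<longleftrightarrow> x \<in> N" if "x \<in> carrier G" for x
      using K.coset_join1[OF _ fK[OF that] sub] K.coset_join2[OF fK[OF that] sub] ker[OF that] by blast
    then show ?thesis
      using subgroup.subset[OF normal_imp_subgroup[OF N]] by (auto simp: kernel_def)
  qed
  moreover have "?h ` carrier G = carrier (K Mod M)"
    unfolding carrier_FactGroup
  proof (intro equalityI subsetI)
    fix C assume "C \<in> (\<lambda>y. M #>\<^bsub>K\<^esub> y) ` carrier K"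
    then obtain y where y: "y \<in> carrier K" "C = M #>\<^bsub>K\<^esub> y" by blast
    obtain x where x: "x \<in> carrier G" "y \<otimes>\<^bsub>K\<^esub> inv\<^bsub>K\<^esub> f x \<in> M" using surj[OF y(1)] by blast
    then have "C = ?h x" using K.rcos_eq_iff[OF sub y(1) fK[OF x(1)]] y(2) by simp
    then show "C \<in> ?h ` carrier G" using x(1) by blast
  qed (use fK in blast)
  ultimately show ?thesis using h.FactGroup_iso by metis
qed

context ramified_unitary_involution
begin

lemma restrict_simps:
  "monoid.mult (U \<restriction> S) = (*)" "one (U \<restriction> S) = 1" "N #>\<^bsub>U \<restriction> S\<^esub> x = N #>\<^bsub>U\<^esub> x"
  "set_mult (U \<restriction> S) = set_mult U"
  by (auto simp: U_mult U_one r_coset_def set_mult_def fun_eq_iff)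

lemma restrict_inverse: "subgroup S U \<Longrightarrow> x \<in> S \<Longrightarrow> inv\<^bsub>U \<restriction> S\<^esub> x = iv x"
  by (rule group.m_inv_consistent[OF group_U])

lemma central_subgroup_normal:
  assumes "subgroup N U" "N \<subseteq> Z"
  shows "N \<lhd> U"
proof (rule group.normal_invI[OF group_U assms(1)])
  fix x h assume x: "x \<in> Eu" and h: "h \<in> N"
  have "x * h = h * x" using assms(2) h Z_commute by (metis subsetD)
  then have "x * h * iv x = h" using x by simp
  then show "x \<otimes>\<^bsub>U\<^esub> h \<otimes>\<^bsub>U\<^esub> iv x \<in> N" using h by (simp add: U_mult)
qed

lemma normal_mu: "mu k \<lhd> U"
  by (rule central_subgroup_normal[OF subgroup_mu]) (use mu_Z in blast)

lemma normal_PR: "PR k \<lhd> U"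
  by (rule central_subgroup_normal[OF subgroup_PR]) (use PRD(3) in blast)

lemmas normal_restrict = group.normal_restrict_supergroup[OF group_U]

lemma normal_Sigma_SN: "\<Sigma> \<lhd> U \<restriction> SN"
  by (rule normal_restrict[OF subgroup_SN normal_Sigma Sigma_subset_SN])

lemma normal_PR_e_n: "PR e \<lhd> U \<restriction> PR n"
  by (rule normal_restrict[OF subgroup_PR normal_PR PR_mono])

lemma normal_mu_inverted: "mu e \<lhd> U \<restriction> mu_T0_inverted \<Gamma> E \<tau> n"
  by (rule normal_restrict[OF subgroup_mu_inverted normal_mu mu_e_subset_inverted])

lemma normal_mu_e_n: "mu e \<lhd> U \<restriction> mu n"
  by (rule normal_restrict[OF subgroup_mu normal_mu mu_e_subset_n])

text \<open>The decomposition \<open>a = t * s\<close> is not unique, so the isomorphism is built in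
  the opposite direction, from the inclusion of \<open>PR n\<close> into \<open>SN\<close>, and then
  inverted. The decomposition gives surjectivity modulo \<open>\<Sigma>\<close>; the kernel is
  \<open>PR n \<inter> \<Sigma> = PR e\<close>.\<close>

lemma unitary_SK1_iso:
  "unitary_SK1 \<Gamma> E \<tau> \<cong> (U \<restriction> PR n) Mod PR e"
proof -
  let ?P = "PR"
  have "(U \<restriction> ?P n) Mod ?P e \<cong> (U \<restriction> SN) Mod \<Sigma>"
  proof (rule quotient_iso[where f = "\<lambda>x. x"])
    show "group (U \<restriction> ?P n)" "group (U \<restriction> SN)"
      by (rule group.subgroup_imp_group[OF group_U], rule subgroup_PR subgroup_SN)+
    show "?P e \<lhd> U \<restriction> ?P n" by (rule normal_PR_e_n)
    show "\<Sigma> \<lhd> U \<restriction> SN" by (rule normal_Sigma_SN)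
    show "(\<lambda>x. x) \<in> hom (U \<restriction> ?P n) (U \<restriction> SN)"
      using PR_subset_SN by (intro homI) (auto simp: restrict_simps)
    show "x \<in> \<Sigma> \<longleftrightarrow> x \<in> ?P e" if "x \<in> carrier (U \<restriction> ?P n)" for x
      using that Sigma_degree0 PR_subset_Sigma PRD(1) by auto
    fix y assume "y \<in> carrier (U \<restriction> SN)"
    then have y: "y \<in> SN" by simp
    then have yU: "y \<in> Eu" by (simp add: Sigma_Nrd_eq)
    obtain t s where ts: "t \<in> E deg0" "t \<noteq> 0" "s \<in> Eu" "\<tau> s = s" "y = t * s"
      by (rule symmetric_decomposition[OF yU])
    have tP: "t \<in> ?P n" using y ts SN_iff by blast
    have "y * iv t = s"
      using Z_commute[OF PRD(3)[OF tP], of s] PRD(4)[OF tP] ts(5) by simp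
    then have "y \<otimes>\<^bsub>U \<restriction> SN\<^esub> inv\<^bsub>U \<restriction> SN\<^esub> t \<in> \<Sigma>"
      using restrict_inverse[OF subgroup_SN] PR_subset_SN tP Sigma_symmetric[OF ts(3,4)]
      by (auto simp: restrict_simps)
    then show "\<exists>x\<in>carrier (U \<restriction> ?P n). y \<otimes>\<^bsub>U \<restriction> SN\<^esub> inv\<^bsub>U \<restriction> SN\<^esub> x \<in> \<Sigma>"
      using tP by auto
  qed
  then show ?thesis
    unfolding unitary_SK1_def
    by (rule group.iso_sym[OF normal.factorgroup_is_group[OF normal_PR_e_n]])
qed

text \<open>The kernel comes from \<open>PR_iff_mu\<close>; by \<open>mu_inverted_om\<close>, that
  is Hilbert 90, \<open>om\<close> is surjective.\<close>

lemma PR_quotient_iso: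
  "(U \<restriction> PR n) Mod PR e
    \<cong> (U \<restriction> mu_T0_inverted \<Gamma> E \<tau> n) Mod mu e"
proof (rule quotient_iso[where f = om])
  let ?P = "PR" and ?M = "mu_T0_inverted \<Gamma> E \<tau> n"
  show "group (U \<restriction> ?P n)" "group (U \<restriction> ?M)"
    by (rule group.subgroup_imp_group[OF group_U], rule subgroup_PR subgroup_mu_inverted)+
  show "?P e \<lhd> U \<restriction> ?P n" by (rule normal_PR_e_n)
  show "mu e \<lhd> U \<restriction> ?M" by (rule normal_mu_inverted)
  show "om \<in> hom (U \<restriction> ?P n) (U \<restriction> ?M)"
  proof (rule homI)
    fix x assume "x \<in> carrier (U \<restriction> ?P n)"
    then have x: "x \<in> ?P n" by simp
    show "om x \<in> carrier (U \<restriction> ?M)" using om_mu_inverted[OF x] by simp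
    fix y assume "y \<in> carrier (U \<restriction> ?P n)"
    then have y: "y \<in> ?P n" by simp
    show "om (x \<otimes>\<^bsub>U \<restriction> ?P n\<^esub> y) = om x \<otimes>\<^bsub>U \<restriction> ?M\<^esub> om y"
      using om_mult[OF PRD(1,2)[OF x] PRD(1,2)[OF y]] by (simp only: restrict_simps)
  qed
  show "om x \<in> mu e \<longleftrightarrow> x \<in> ?P e" if "x \<in> carrier (U \<restriction> ?P n)" for x
  proof -
    have x: "x \<in> ?P n" using that by simp
    show ?thesis using PR_iff_mu[OF PRD(1,2)[OF x]] by simp
  qed
  fix y assume "y \<in> carrier (U \<restriction> ?M)"
  then have y: "y \<in> ?M" by simp
  then obtain t where t: "t \<in> ?P n" "om t = y" by (rule mu_inverted_om)
  have "y \<in> Eu" using y subgroup.subset[OF subgroup_mu_inverted] by blast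
  then have "y \<otimes>\<^bsub>U \<restriction> ?M\<^esub> inv\<^bsub>U \<restriction> ?M\<^esub> om t \<in> mu e"
    using restrict_inverse[OF subgroup_mu_inverted y] t(2) subgroup.one_closed[OF subgroup_mu, of e]
    by (simp add: restrict_simps U_one)
  then show "\<exists>x\<in>carrier (U \<restriction> ?P n). y \<otimes>\<^bsub>U \<restriction> ?M\<^esub> inv\<^bsub>U \<restriction> ?M\<^esub> om x \<in> mu e"
    using t(1) by auto
qed

section \<open>The map alpha on K_1\<close>

lemma normal_commutators: "CM \<lhd> U"
  using normal_mu[of e] by (simp add: commutators_eq_mu)

lemma commutator_coset_eq_iff:
  assumes "x \<in> Eu" "y \<in> Eu"
  shows "CM #>\<^bsub>U\<^esub> x = CM #>\<^bsub>U\<^esub> y \<longleftrightarrow> x * iv y \<in> CM"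
  by (rule units.rcos_eq_iff[OF subgroup_commutators assms])

lemma om_hom: "(\<lambda>a. CM #>\<^bsub>U\<^esub> om a) \<in> hom U (K1 \<Gamma> E)"
proof (rule homI)
  show "CM #>\<^bsub>U\<^esub> om a \<in> carrier (K1 \<Gamma> E)" if "a \<in> Eu" for a
    using om_U[OF that] by (auto simp: K1_def carrier_FactGroup)
  fix a b assume ab: "a \<in> Eu" "b \<in> Eu"
  have "CM #>\<^bsub>U\<^esub> om (a * b) = CM #>\<^bsub>U\<^esub> (om a * om b)"
    using commutator_coset_eq_iff om_mult_mod_commutators[OF ab] ab by (simp add: om_U)
  then show "CM #>\<^bsub>U\<^esub> om (a \<otimes>\<^bsub>U\<^esub> b)
      = (CM #>\<^bsub>U\<^esub> om a) \<otimes>\<^bsub>K1 \<Gamma> E\<^esub> (CM #>\<^bsub>U\<^esub> om b)"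
    using normal.rcos_sum[OF normal_commutators om_U[OF ab(1)] om_U[OF ab(2)]]
    by (simp add: K1_def U_mult)
qed

lemma om_Sigma: 
  assumes "x \<in> \<Sigma>" shows "om x \<in> CM"
proof -
  obtain u s where us: "u \<in> PR e" "s \<in> Eu" "\<tau> s = s" "x = u * s"
    using Sigma_form[OF assms] by blast
  note uD = PRD[OF us(1)]
  have "om x = om u" unfolding us(4) by (rule om_symmetric_factor[OF uD(1,2) us(2,3)])
  then show ?thesis using PR_iff_mu[OF uD(1,2)] us(1) by (simp add: commutators_eq_mu)
qed

text \<open>Well-definedness of \<open>\<alpha>\<close>: \<open>x\<close> and \<open>y\<close>
  differ by an element of \<open>\<Sigma>\<close>, and \<open>om\<close> sends
  \<open>\<Sigma>\<close> into E'.\<close>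

lemma om_coset_cong:
  assumes "x \<in> Eu" "y \<in> Eu" "\<Sigma> #>\<^bsub>U\<^esub> x = \<Sigma> #>\<^bsub>U\<^esub> y"
  shows "CM #>\<^bsub>U\<^esub> om x = CM #>\<^bsub>U\<^esub> om y"
proof -
  let ?C = "CM"
  have s: "x * iv y \<in> \<Sigma>" using units.rcos_eq_iff[OF subgroup_Sigma assms(1,2)] assms(3) by simp
  then have sU: "x * iv y \<in> Eu" by (rule Sigma_U)
  have "om (x * iv y * y) * iv (om (x * iv y) * om y) \<in> ?C"
    by (rule om_mult_mod_commutators[OF sU assms(2)])
  then have "?C #>\<^bsub>U\<^esub> om x = ?C #>\<^bsub>U\<^esub> (om (x * iv y) * om y)"
    using commutator_coset_eq_iff om_U assms(1,2) sU by simp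
  also have "\<dots> = ?C #>\<^bsub>U\<^esub> om y"
    using commutator_coset_eq_iff om_U[OF assms(2)] om_U[OF sU] om_Sigma[OF s] by simp
  finally show ?thesis .
qed

text \<open>Every class of the unitary SK_1 has a representative in T_0 with the same
  \<open>om\<close>, so claims about \<open>\<alpha>\<close> reduce to T_0, where \<open>om\<close>
  is multiplicative.\<close>

lemma SN_coset:
  assumes "x \<in> SN"
  obtains t where "t \<in> PR n" "\<Sigma> #>\<^bsub>U\<^esub> x = \<Sigma> #>\<^bsub>U\<^esub> t" "om x = om t"
proof -
  have xU: "x \<in> Eu" using assms by (simp add: Sigma_Nrd_eq)
  obtain t s where ts: "t \<in> E deg0" "t \<noteq> 0" "s \<in> Eu" "\<tau> s = s" "x = t * s"
    by (rule symmetric_decomposition[OF xU])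
  have tP: "t \<in> PR n" using assms ts SN_iff by blast
  note tD = PRD[OF tP]
  have "x * iv t = s" using Z_commute[OF tD(3), of s] tD(4) ts(5) by simp
  then have "\<Sigma> #>\<^bsub>U\<^esub> x = \<Sigma> #>\<^bsub>U\<^esub> t"
    using units.rcos_eq_iff[OF subgroup_Sigma xU tD(4)] Sigma_symmetric[OF ts(3,4)] by simp
  moreover have "om x = om t" unfolding ts(5) by (rule om_symmetric_factor[OF ts(1-4)])
  ultimately show thesis using that tP by blast
qed

lemma alpha_exists:
  "\<exists>\<alpha> \<in> hom (unitary_K1 \<Gamma> E \<tau>) (K1 \<Gamma> E).
    (\<forall>a \<in> Eu. \<alpha> (\<Sigma> #>\<^bsub>U\<^esub> a) = CM #>\<^bsub>U\<^esub> om a)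
    \<and> \<alpha> \<in> hom (unitary_SK1 \<Gamma> E \<tau>) (SK1 \<Gamma> E)
    \<and> inj_on \<alpha> (carrier (unitary_SK1 \<Gamma> E \<tau>))
    \<and> (odd e \<longrightarrow> \<alpha> \<in> iso (unitary_SK1 \<Gamma> E \<tau>) (SK1 \<Gamma> E))"
proof -
  let ?C = "CM" and ?P = "PR"
  \<comment> \<open>\<open>\<alpha>\<close> is constructed once, on all of K_1. The same function
    serves on the unitary SK_1, because cosets of \<open>\<Sigma>\<close> in the subgroup
    \<open>SN\<close> are cosets in E^*.\<close>
  have "\<exists>\<alpha>. \<alpha> \<in> hom (U Mod \<Sigma>) (K1 \<Gamma> E)
      \<and> (\<forall>x\<in>Eu. \<alpha> (\<Sigma> #>\<^bsub>U\<^esub> x) = ?C #>\<^bsub>U\<^esub> om x)"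
    by (rule FactGroup_universal[OF om_hom normal_Sigma om_coset_cong]) blast+
  then obtain \<alpha> where "\<alpha> \<in> hom (U Mod \<Sigma>) (K1 \<Gamma> E)"
    and \<alpha>: "\<And>x. x \<in> Eu \<Longrightarrow> \<alpha> (\<Sigma> #>\<^bsub>U\<^esub> x) = ?C #>\<^bsub>U\<^esub> om x"
    by blast
  then have \<alpha>_hom: "\<alpha> \<in> hom (unitary_K1 \<Gamma> E \<tau>) (K1 \<Gamma> E)" by (simp add: unitary_K1_def)
  have SN_U: "x \<in> Eu" if "x \<in> SN" for x using that by (simp add: Sigma_Nrd_eq)
  have car: "carrier (unitary_SK1 \<Gamma> E \<tau>) = (\<lambda>x. \<Sigma> #>\<^bsub>U\<^esub> x) ` SN"
    by (simp add: unitary_SK1_def carrier_FactGroup restrict_simps)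
  have car': "carrier (SK1 \<Gamma> E) = (\<lambda>x. ?C #>\<^bsub>U\<^esub> x) ` mu n"
    by (simp add: SK1_def carrier_FactGroup restrict_simps Nrd_one_eq)
  have inc: "carrier (unitary_SK1 \<Gamma> E \<tau>) \<subseteq> carrier (unitary_K1 \<Gamma> E \<tau>)"
    using SN_U by (auto simp: car unitary_K1_def carrier_FactGroup)
  have \<alpha>_hom': "\<alpha> \<in> hom (unitary_SK1 \<Gamma> E \<tau>) (SK1 \<Gamma> E)"
  proof (rule homI)
    fix A assume A: "A \<in> carrier (unitary_SK1 \<Gamma> E \<tau>)"
    then obtain x where x: "x \<in> SN" "A = \<Sigma> #>\<^bsub>U\<^esub> x" by (auto simp: car)
    obtain t where t: "t \<in> ?P n" "om x = om t" by (rule SN_coset[OF x(1)])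
    have "om t \<in> mu n" using PR_iff_mu[OF PRD(1,2)[OF t(1)]] t(1) by blast
    then show "\<alpha> A \<in> carrier (SK1 \<Gamma> E)" using x t \<alpha>[OF SN_U[OF x(1)]] by (auto simp: car')
    fix A' assume A': "A' \<in> carrier (unitary_SK1 \<Gamma> E \<tau>)"
    have "\<alpha> (A \<otimes>\<^bsub>unitary_K1 \<Gamma> E \<tau>\<^esub> A') = \<alpha> A \<otimes>\<^bsub>K1 \<Gamma> E\<^esub> \<alpha> A'"
      using inc A A' by (intro hom_mult[OF \<alpha>_hom]) auto
    then show "\<alpha> (A \<otimes>\<^bsub>unitary_SK1 \<Gamma> E \<tau>\<^esub> A') = \<alpha> A \<otimes>\<^bsub>SK1 \<Gamma> E\<^esub> \<alpha> A'"
      by (simp add: unitary_K1_def K1_def unitary_SK1_def SK1_def restrict_simps)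
  qed
  have inj: "inj_on \<alpha> (carrier (unitary_SK1 \<Gamma> E \<tau>))"
  proof (rule inj_onI)
    fix A A' assume "A \<in> carrier (unitary_SK1 \<Gamma> E \<tau>)" "A' \<in> carrier (unitary_SK1 \<Gamma> E \<tau>)"
      and eq: "\<alpha> A = \<alpha> A'"
    then obtain x x' where x: "x \<in> SN" "A = \<Sigma> #>\<^bsub>U\<^esub> x" and x': "x' \<in> SN" "A' = \<Sigma> #>\<^bsub>U\<^esub> x'"
      by (auto simp: car)
    obtain t where t: "t \<in> ?P n" "\<Sigma> #>\<^bsub>U\<^esub> x = \<Sigma> #>\<^bsub>U\<^esub> t" "om x = om t" by (rule SN_coset[OF x(1)])
    obtain t' where t': "t' \<in> ?P n" "\<Sigma> #>\<^bsub>U\<^esub> x' = \<Sigma> #>\<^bsub>U\<^esub> t'" "om x' = om t'" by (rule SN_coset[OF x'(1)])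
    note tD = PRD[OF t(1)] and tD' = PRD[OF t'(1)]
    have "?C #>\<^bsub>U\<^esub> om t = ?C #>\<^bsub>U\<^esub> om t'"
      using eq x x' t(3) t'(3) \<alpha>[OF SN_U[OF x(1)]] \<alpha>[OF SN_U[OF x'(1)]] by simp
    \<comment> \<open>Equal images mean that \<open>om (t * iv t')\<close> lies in
      \<open>mu e\<close>, that is, \<open>t * iv t'\<close> lies in \<open>PR e\<close>, a subset
      of \<open>\<Sigma>\<close>.\<close>
    then have "om t * iv (om t') \<in> mu e"
      using commutator_coset_eq_iff[OF om_U[OF tD(4)] om_U[OF tD'(4)]] by (simp add: commutators_eq_mu)
    moreover have i: "iv t' \<in> E deg0" "iv t' \<noteq> 0"
      using E0_inverse[OF tD'(1,2)] U_nonzero[OF units.inv_closed[OF tD'(4)]] by auto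
    moreover have "om (t * iv t') = om t * iv (om t')"
      using om_mult[OF tD(1,2) i] om_inverse[OF tD'(1,2)] by simp
    moreover have tt: "t * iv t' \<in> E deg0" "t * iv t' \<noteq> 0" using E0_mult[OF tD(1) i(1)] tD(2) i(2) by auto
    ultimately have "t * iv t' \<in> ?P e" using PR_iff_mu[OF tt] by simp
    then have "t * iv t' \<in> \<Sigma>" by (rule PR_subset_Sigma)
    then have "\<Sigma> #>\<^bsub>U\<^esub> t = \<Sigma> #>\<^bsub>U\<^esub> t'" using units.rcos_eq_iff[OF subgroup_Sigma tD(4) tD'(4)] by simp
    then show "A = A'" using x x' t t' by simp
  qed
  have "\<alpha> \<in> iso (unitary_SK1 \<Gamma> E \<tau>) (SK1 \<Gamma> E)" if "odd e"
  proof -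
    have "carrier (SK1 \<Gamma> E) \<subseteq> \<alpha> ` carrier (unitary_SK1 \<Gamma> E \<tau>)"
    proof
      fix A assume "A \<in> carrier (SK1 \<Gamma> E)"
      then obtain \<omega> where w: "\<omega> \<in> mu_T0_inverted \<Gamma> E \<tau> n" "A = ?C #>\<^bsub>U\<^esub> \<omega>"
        using mu_inverted_odd[OF \<open>odd e\<close>] by (auto simp: car')
      obtain t where t: "t \<in> ?P n" "om t = \<omega>" by (rule mu_inverted_om[OF w(1)])
      have "A = \<alpha> (\<Sigma> #>\<^bsub>U\<^esub> t)" using \<alpha>[OF PRD(4)[OF t(1)]] t(2) w(2) by simp
      then show "A \<in> \<alpha> ` carrier (unitary_SK1 \<Gamma> E \<tau>)"
        using t(1) PR_subset_SN by (auto simp: car)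
    qed
    moreover have "\<alpha> ` carrier (unitary_SK1 \<Gamma> E \<tau>) \<subseteq> carrier (SK1 \<Gamma> E)"
      using hom_in_carrier[OF \<alpha>_hom'] by blast
    ultimately show ?thesis using inj \<alpha>_hom' by (simp add: iso_def bij_betw_def)
  qed
  with \<alpha>_hom \<alpha> \<alpha>_hom' inj show ?thesis by (intro bexI[of _ \<alpha>] conjI ballI impI)
qed

lemma normal_commutators_Nrd_one: "CM \<lhd> U \<restriction> Nrd_one \<Gamma> E"
  using normal_mu_e_n by (simp add: commutators_eq_mu Nrd_one_eq)

text \<open>After rewriting, both sides are the same group, as E' equals \<open>mu e\<close> and the
  units of norm 1 are \<open>mu n\<close>.\<close>

lemma SK1_iso: "SK1 \<Gamma> E \<cong> (U \<restriction> mu n) Mod mu e"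
  by (simp add: SK1_def commutators_eq_mu Nrd_one_eq)

section \<open>T_0 as an extension of R_0\<close>

lemma T0_simps:
  "carrier (T0_ring \<Gamma> E) = E deg0" "monoid.mult (T0_ring \<Gamma> E) = (*)" "one (T0_ring \<Gamma> E) = 1"
  "ring.zero (T0_ring \<Gamma> E) = 0" "add (T0_ring \<Gamma> E) = (+)"
  by (simp_all add: T0_ring_def ring_of_type_algebra_def central_part_degree0)

lemma field_T0: "field (T0_ring \<Gamma> E)"
proof -
  have "cring (T0_ring \<Gamma> E)"
  proof (rule cringI)
    show "abelian_group (T0_ring \<Gamma> E)"
      by (rule abelian_groupI)
        (auto simp: T0_simps component_zero component_add add_ac intro: bexI[OF _ component_minus])
    show "Group.comm_monoid (T0_ring \<Gamma> E)"
      by (rule comm_monoidI) (auto simp: T0_simps E0_mult one_mem mult.assoc E0_commute)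
  qed (simp add: T0_simps distrib_right)
  moreover have "Units (T0_ring \<Gamma> E) = carrier (T0_ring \<Gamma> E) - {\<zero>\<^bsub>T0_ring \<Gamma> E\<^esub>}"
  proof (intro equalityI subsetI)
    fix x assume "x \<in> carrier (T0_ring \<Gamma> E) - {\<zero>\<^bsub>T0_ring \<Gamma> E\<^esub>}"
    then have x: "x \<in> E deg0" "x \<noteq> 0" by (auto simp: T0_simps)
    then show "x \<in> Units (T0_ring \<Gamma> E)"
      using E0_inverse[OF x] Z_U[OF degree0_Z[OF x]] by (auto simp: Units_def T0_simps intro!: bexI[of _ "iv x"])
  qed (auto simp: Units_def T0_simps)
  ultimately show ?thesis by (rule cring.cring_fieldI)
qed

text \<open>\<open>mu e\<close> has exactly \<open>e\<close> elements, so one of them differs from 1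
  and -1; as \<open>\<tau>\<close> inverts it, being fixed would make its square 1.\<close>

lemma mu_nontrivial_square:
  assumes "2 < e"
  obtains \<omega> where "\<omega> \<in> mu e" "\<tau> \<omega> \<noteq> \<omega>"
proof -
  have "\<not> mu e \<subseteq> {1, - 1}"
  proof
    assume "mu e \<subseteq> {1, - 1}"
    then have "card (mu e) \<le> card {1, - 1 :: 'a}" by (intro card_mono) auto
    also have "\<dots> \<le> 2" by (simp add: card_insert_if)
    finally show False using card_mu assms by simp
  qed
  then obtain \<omega> where w: "\<omega> \<in> mu e" "\<omega> \<noteq> 1" "\<omega> \<noteq> - 1" by blast
  have "\<tau> \<omega> \<noteq> \<omega>"
  proof
    assume "\<tau> \<omega> = \<omega>"
    then have "\<omega> * \<omega> = 1" using tau_mu[OF w(1)] Z_U[OF mu_Z[OF w(1)]] by (metis units.r_inv)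
    then have "(\<omega> - 1) * (\<omega> + 1) = 0" by (simp add: algebra_simps)
    then show False using w by (auto simp: eq_neg_iff_add_eq_0)
  qed
  with w that show thesis by blast
qed

text \<open>For a root of unity \<open>\<omega>\<close> moved by \<open>\<tau>\<close>, every
  \<open>t\<close> in T_0 is \<open>q * \<omega> + r\<close> with \<open>q\<close> and
  \<open>r\<close> in R_0; the coefficients are written down explicitly.\<close>

lemma T0_generated:
  assumes "2 < e"
  shows "central_part E deg0
    = generate_field (T0_ring \<Gamma> E) (fixed_part E \<tau> deg0 \<union> mu e)" (is "_ = ?F")
proof
  interpret T0: field "T0_ring \<Gamma> E" by (rule field_T0)
  show "?F \<subseteq> central_part E deg0"
    using T0.generate_field_incl[of "fixed_part E \<tau> deg0 \<union> mu e"]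
    by (auto simp: T0_simps central_part_degree0 fixed_part_def mu_T0_eq)
  obtain \<omega> where w: "\<omega> \<in> mu e" "\<tau> \<omega> \<noteq> \<omega>" by (rule mu_nontrivial_square[OF assms])
  have w0: "\<omega> \<in> E deg0" using w by (simp add: mu_T0_eq)
  have d: "\<omega> - \<tau> \<omega> \<in> E deg0" "\<omega> - \<tau> \<omega> \<noteq> 0" using w(2) w0 tau_E0 E0_diff by auto
  have dU: "\<omega> - \<tau> \<omega> \<in> Eu" using Z_U[OF degree0_Z[OF d]] .
  have fixed: "x \<in> ?F" if "x \<in> E deg0" "\<tau> x = x" for x
    using that by (intro generate_field.incl) (simp add: fixed_part_def central_part_degree0)
  show "central_part E deg0 \<subseteq> ?F"
  proof
    fix t assume "t \<in> central_part E deg0"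
    then have t: "t \<in> E deg0" by (simp add: central_part_degree0)
    have td: "t - \<tau> t \<in> E deg0" using t tau_E0 E0_diff by blast
    \<comment> \<open>Subtracting from \<open>t = q * \<omega> + r\<close> its image under
      \<open>\<tau>\<close>, with \<open>q\<close> and \<open>r\<close> fixed, leaves
      \<open>t - \<tau> t = q * (\<omega> - \<tau> \<omega>)\<close>, which determines
      \<open>q\<close>.\<close>
    define q where "q = (t - \<tau> t) * iv (\<omega> - \<tau> \<omega>)"
    have q0: "q \<in> E deg0" unfolding q_def using td E0_inverse[OF d] by (rule E0_mult)
    have qd: "q * (\<omega> - \<tau> \<omega>) = t - \<tau> t" using dU by (simp add: q_def)
    have "\<tau> (q * (\<omega> - \<tau> \<omega>)) = \<tau> (t - \<tau> t)" by (simp only: qd)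
    then have "(\<tau> \<omega> - \<omega>) * \<tau> q = \<tau> t - t" by (simp add: tau_mult tau_diff)
    then have "(\<omega> - \<tau> \<omega>) * \<tau> q = t - \<tau> t" by (simp add: algebra_simps)
    then have "(\<omega> - \<tau> \<omega>) * \<tau> q = (\<omega> - \<tau> \<omega>) * q"
      using qd E0_commute[OF q0, of "\<omega> - \<tau> \<omega>"] by simp
    then have qfix: "\<tau> q = q" using d(2) by simp
    have "\<tau> (t - q * \<omega>) = \<tau> t - \<tau> \<omega> * q" by (simp add: tau_diff tau_mult qfix)
    also have "\<tau> \<omega> * q = q * \<tau> \<omega>" by (rule E0_commute[OF q0, symmetric])
    also have "\<tau> t - q * \<tau> \<omega> = t - q * \<omega>" using qd by (simp add: algebra_simps)
    finally have rfix: "\<tau> (t - q * \<omega>) = t - q * \<omega>" .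
    have r0: "t - q * \<omega> \<in> E deg0" using t E0_mult[OF q0 w0] E0_diff by blast
    have "q \<otimes>\<^bsub>T0_ring \<Gamma> E\<^esub> \<omega> \<in> ?F"
      by (rule generate_field.eng_mult[OF fixed[OF q0 qfix]]) (rule generate_field.incl, use w in blast)
    then have "(t - q * \<omega>) \<oplus>\<^bsub>T0_ring \<Gamma> E\<^esub> (q \<otimes>\<^bsub>T0_ring \<Gamma> E\<^esub> \<omega>) \<in> ?F"
      by (rule generate_field.eng_add[OF fixed[OF r0 rfix]])
    then show "t \<in> ?F" by (simp add: T0_simps)
  qed
qed

end

text \<open>\<open>Mod\<close> can be formed with any subset, so the normality conjuncts certify
  that the quotients in the three isomorphisms are quotients by normal subgroups. The first conjunct
  places the e-th roots of unity of the closure in T_0, and \<open>\<alpha>\<close> is one map on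
  K_1 whose restriction carries claims (i) and (ii).\<close>

theorem theorem5p1:
  fixes \<Gamma> :: "('g, 'h) monoid_scheme"
    and E :: "'g \<Rightarrow> 'a::ring_1_no_zero_divisors set"
    and \<tau> :: "'a \<Rightarrow> 'a"
    and n e :: nat
  assumes "graded_division_ring \<Gamma> E"
    and "has_index \<Gamma> E n"
    and "graded_involution \<Gamma> E \<tau>"
    and "unitary \<tau>"
    and "totally_ramified \<Gamma> E"
    and "degrees \<Gamma> (central_part E) = degrees \<Gamma> (fixed_part E \<tau>)"
    and "e = group_exponent ((\<Gamma> \<restriction> degrees \<Gamma> E) Mod degrees \<Gamma> (central_part E))"
  shows "roots_of_unity e \<subseteq> center_to_closure ` {t. of_center t \<in> central_part E \<one>\<^bsub>\<Gamma>\<^esub>}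
    \<and> Sigma_sym \<Gamma> E \<tau> \<lhd> unit_group \<Gamma> E
    \<and> Sigma_sym \<Gamma> E \<tau> \<lhd> unit_group \<Gamma> E \<restriction> Sigma_Nrd \<Gamma> E \<tau>
    \<and> power_in_R0 \<Gamma> E \<tau> e \<lhd> unit_group \<Gamma> E \<restriction> power_in_R0 \<Gamma> E \<tau> n
    \<and> mu_T0 \<Gamma> E e \<lhd> unit_group \<Gamma> E \<restriction> mu_T0_inverted \<Gamma> E \<tau> n
    \<and> unitary_SK1 \<Gamma> E \<tau>
        \<cong> (unit_group \<Gamma> E \<restriction> power_in_R0 \<Gamma> E \<tau> n) Mod power_in_R0 \<Gamma> E \<tau> e
    \<and> (unit_group \<Gamma> E \<restriction> power_in_R0 \<Gamma> E \<tau> n) Mod power_in_R0 \<Gamma> E \<tau> e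
        \<cong> (unit_group \<Gamma> E \<restriction> mu_T0_inverted \<Gamma> E \<tau> n) Mod mu_T0 \<Gamma> E e
    \<and> (\<exists>\<alpha> \<in> hom (unitary_K1 \<Gamma> E \<tau>) (K1 \<Gamma> E).
          (\<forall>a \<in> carrier (unit_group \<Gamma> E).
             \<alpha> (Sigma_sym \<Gamma> E \<tau> #>\<^bsub>unit_group \<Gamma> E\<^esub> a)
               = commutators \<Gamma> E #>\<^bsub>unit_group \<Gamma> E\<^esub> one_minus \<Gamma> E \<tau> a)
          \<and> \<alpha> \<in> hom (unitary_SK1 \<Gamma> E \<tau>) (SK1 \<Gamma> E)
          \<and> inj_on \<alpha> (carrier (unitary_SK1 \<Gamma> E \<tau>))
          \<and> (odd e \<longrightarrow> \<alpha> \<in> iso (unitary_SK1 \<Gamma> E \<tau>) (SK1 \<Gamma> E)))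
    \<and> commutators \<Gamma> E \<lhd> unit_group \<Gamma> E \<restriction> Nrd_one \<Gamma> E
    \<and> mu_T0 \<Gamma> E e \<lhd> unit_group \<Gamma> E \<restriction> mu_T0 \<Gamma> E n
    \<and> SK1 \<Gamma> E \<cong> (unit_group \<Gamma> E \<restriction> mu_T0 \<Gamma> E n) Mod mu_T0 \<Gamma> E e
    \<and> (2 < e \<longrightarrow>
         central_part E \<one>\<^bsub>\<Gamma>\<^esub>
           = generate_field (T0_ring \<Gamma> E) (fixed_part E \<tau> \<one>\<^bsub>\<Gamma>\<^esub> \<union> mu_T0 \<Gamma> E e)
         \<and> (\<forall>\<omega> \<in> mu_T0 \<Gamma> E e. \<tau> \<omega> = inv\<^bsub>unit_group \<Gamma> E\<^esub> \<omega>))"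
proof -
  obtain B where B: "B \<subseteq> homogeneous \<Gamma> E" "\<not> center.dependent B" "center.span B = UNIV"
      "finite B" "card B = n\<^sup>2"
    using assms(2) unfolding has_index_def by blast
  have loc: "ramified_unitary_involution \<Gamma> E B n e \<tau>"
    by (intro ramified_unitary_involution.intro ramified_unitary_involution_axioms.intro
        totally_ramified_exponent.intro totally_ramified_exponent_axioms.intro
        totally_ramified_basis.intro totally_ramified_basis_axioms.intro
        totally_ramified_algebra.intro totally_ramified_algebra_axioms.intro
        graded_division_algebra.intro assms B)
  note L = loc[THEN ramified_unitary_involution.axioms(1)]
  show ?thesis
    by (intro conjI impI ballI
        totally_ramified_exponent.roots_of_unity_subset[OF L]
        ramified_unitary_involution.normal_Sigma[OF loc]
        ramified_unitary_involution.normal_Sigma_SN[OF loc]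
        ramified_unitary_involution.normal_PR_e_n[OF loc]
        ramified_unitary_involution.normal_mu_inverted[OF loc]
        ramified_unitary_involution.unitary_SK1_iso[OF loc]
        ramified_unitary_involution.PR_quotient_iso[OF loc]
        ramified_unitary_involution.alpha_exists[OF loc]
        ramified_unitary_involution.normal_commutators_Nrd_one[OF loc]
        ramified_unitary_involution.normal_mu_e_n[OF loc]
        ramified_unitary_involution.SK1_iso[OF loc]
        ramified_unitary_involution.T0_generated[OF loc]
        ramified_unitary_involution.tau_mu[OF loc])
qed

end
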